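(* Fix any $\varepsilon>0$, a query $Q$, and a dataset $\{P_1,\dots,P_n\}$, where $Q\subset\mathbb{R}^d$ and each $P_i\subset\mathbb{R}^d$ is a set of unit vectors. Let $m=|Q|+\max_{i\in[n]}|P_i|$. Let $$k_{\mathrm{sim}}=O\!\left(\frac{\log(m/\varepsilon)}{\varepsilon^2}\right),\qquad d_{\mathrm{proj}}=O\!\left(\frac{1}{\varepsilon^2}\log(mdn/\varepsilon)\right),\qquad R_{\mathrm{reps}}=O\!\left(\frac{1}{\varepsilon^2}\log n\right),$$ so that $d_{\mathrm{FDE}}=\left(\frac{m}{\varepsilon}\right)^{O(1/\varepsilon^2)}\cdot\log^2 n$. Let $\mathbf{F}_{\mathrm{q}}(Q)$ and $\mathbf{F}_{\mathrm{doc}}(P_1),\dots,\mathbf{F}_{\mathrm{doc}}(P_n)$ be the query and document fixed dimensional encodings with these parameters. Then if $i^*=\arg\max_{i\in[n]}\langle\mathbf{F}_{\mathrm{q}}(Q),\mathbf{F}_{\mathrm{doc}}(P_i)\rangle$, with high probability (i.e. $1-1/\mathrm{poly}(n)$) we have $$\mathrm{NChamfer}(Q,P_{i^*})\;\ge\;\max_{i\in[n]}\mathrm{NChamfer}(Q,P_i)-\varepsilon .$$ Given the query $Q$, the document $P_{i^*}$ can be recovered in time $$O\!\left(|Q|\,\max\{d,n\}\,\frac{1}{\varepsilon^4}\,\log\!\Big(\frac{mdn}{\varepsilon}\Big)\log n\right).$$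
   Context: All sets of vectors are finite and nonempty, and $[n]=\{1,\dots,n\}$. Chamfer similarity: for $Q,P\subset\mathbb{R}^d$, $\mathrm{Chamfer}(Q,P)=\sum_{q\in Q}\max_{p\in P}\langle q,p\rangle$ and $\mathrm{NChamfer}(Q,P)=\frac{1}{|Q|}\mathrm{Chamfer}(Q,P)$. The vectors of $Q$, like those of the $P_i$, are unit vectors. Fixed dimensional encodings (FDEs): the parameters are positive integers $k_{\mathrm{sim}},d_{\mathrm{proj}},R_{\mathrm{reps}}$; put $B=2^{k_{\mathrm{sim}}}$ and identify the $B$ clusters with the bit strings in $\{0,1\}^{k_{\mathrm{sim}}}$. Partition (SimHash): sample random Gaussian vectors $g_1,\dots,g_{k_{\mathrm{sim}}}\in\mathbb{R}^d$ and let $\varphi(x)=(\mathbf{1}(\langle g_1,x\rangle>0),\dots,\mathbf{1}(\langle g_{k_{\mathrm{sim}}},x\rangle>0))\in\{0,1\}^{k_{\mathrm{sim}}}$. Blocks: for each cluster $k$, the query block is $\vec q_{(k)}=\sum_{q\in Q,\ \varphi(q)=k}q$ (the zero vector if no such $q$ exists). For a document $P$, the block $\vec p_{(k)}$ is the average $\frac{1}{|P\cap\varphi^{-1}(k)|}\sum_{p\in P,\ \varphi(p)=k}p$ if $P\cap\varphi^{-1}(k)\neq\emptyset$; if $P\cap\varphi^{-1}(k)=\emptyset$, then $\vec p_{(k)}=p$ for a point $p\in P$ minimizing the Hamming distance between $\varphi(p)$ and $k$, with ties broken arbitrarily. Empty clusters are filled in this way for documents only, never for queries. Inner projection: $\psi:\mathbb{R}^d\to\mathbb{R}^{d_{\mathrm{proj}}}$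 is $\psi(x)=\frac{1}{\sqrt{d_{\mathrm{proj}}}}Sx$ with $S\in\mathbb{R}^{d_{\mathrm{proj}}\times d}$ a random matrix with independent uniformly distributed $\pm1$ entries; when $d_{\mathrm{proj}}=d$, $\psi$ is instead the identity. The vectors $\vec q_\psi$ and $\vec p_\psi$ are the concatenations over all clusters $k$ of $\psi(\vec q_{(k)})$ and of $\psi(\vec p_{(k)})$, respectively. Repetitions: this is repeated $R_{\mathrm{reps}}$ times independently, with partitions $\varphi_i$ and projections $\psi_i$ (the same ones being used for the query and all documents), and $\mathbf{F}_{\mathrm{q}}(Q)$, $\mathbf{F}_{\mathrm{doc}}(P)$ are the concatenations of the resulting $R_{\mathrm{reps}}$ vectors, in $\mathbb{R}^{d_{\mathrm{FDE}}}$ with $d_{\mathrm{FDE}}=B\cdot d_{\mathrm{proj}}\cdot R_{\mathrm{reps}}$. Setting a parameter equal to $O(f)$ means setting it to $Cf$ (rounded up to an integer) for a sufficiently large constant $C$. Probability is over the random choices of the partitions and projections. The document encodings $\mathbf{F}_{\mathrm{doc}}(P_i)$ are computed in advance, before the query $Q$ is given; the stated time is for processing the query.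
   Formalization: For n≥2, ε≤1: the O(1/ε²) constant in d_FDE may depend on d (as stated it fails as d→∞), or is uniform with log n·log(dn) for log²n. Time is literal for n≥2, ε≤1; otherwise its factors (1/ε²)log(mdn/ε), (1/ε²)log n are rounded up to integers ≥1 (for n=1 the stated bound is 0). *)

theory Defs
  imports "HOL-Probability.Probability" "Jordan_Normal_Form.Matrix"
begin

unbundle no vec_syntax
no_notation inner (infix "\<bullet>" 70)
hide_const (open) Finite_Cartesian_Product.vec Finite_Cartesian_Product.mat

section \<open>Chamfer similarity\<close>

text \<open>The dimension d has to be quantified inside the statement (the hidden constants do not depend
  on it), so points of d-dimensional space are elements of \<^term>\<open>carrier_vec d\<close>.\<close>

definition unit_vec_set :: "nat \<Rightarrow> real vec set \<Rightarrow> bool" where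
  "unit_vec_set d A \<longleftrightarrow> finite A \<and> A \<noteq> {} \<and> A \<subseteq> carrier_vec d \<and> (\<forall>x\<in>A. sqrt (x \<bullet> x) = 1)"

definition Chamfer :: "real vec set \<Rightarrow> real vec set \<Rightarrow> real" where
  "Chamfer Q P = (\<Sum>q\<in>Q. MAX p\<in>P. q \<bullet> p)"

definition NChamfer :: "real vec set \<Rightarrow> real vec set \<Rightarrow> real" where
  "NChamfer Q P = (1 / real (card Q)) * Chamfer Q P"

section \<open>Randomness\<close>

text \<open>An outcome is a pair (g, s): g (r, j, l) is coordinate l of the j-th Gaussian vector of
  repetition r, and s (r, i, l) is the (i, l) entry of the sign matrix of repetition r.
  All indices start at 0.\<close>

type_synonym randomness = "(nat \<times> nat \<times> nat \<Rightarrow> real) \<times> (nat \<times> nat \<times> nat \<Rightarrow> real)"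

definition fde_space :: "nat \<Rightarrow> nat \<Rightarrow> nat \<Rightarrow> nat \<Rightarrow> randomness measure" where
  "fde_space d k dp R =
     (\<Pi>\<^sub>M x\<in>{..<R} \<times> {..<k} \<times> {..<d}. density lborel (\<lambda>t. ennreal (std_normal_density t))) \<Otimes>\<^sub>M
     (\<Pi>\<^sub>M x\<in>{..<R} \<times> {..<dp} \<times> {..<d}. measure_pmf (pmf_of_set {-1, 1}))"

definition gauss_vec :: "nat \<Rightarrow> randomness \<Rightarrow> nat \<Rightarrow> nat \<Rightarrow> real vec" where
  "gauss_vec d \<omega> r j = vec d (\<lambda>l. fst \<omega> (r, j, l))"

definition simhash :: "nat \<Rightarrow> nat \<Rightarrow> randomness \<Rightarrow> nat \<Rightarrow> real vec \<Rightarrow> bool list" where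
  "simhash d k \<omega> r x = map (\<lambda>j. gauss_vec d \<omega> r j \<bullet> x > 0) [0..<k]"

definition proj_mat :: "nat \<Rightarrow> nat \<Rightarrow> randomness \<Rightarrow> nat \<Rightarrow> real mat" where
  "proj_mat d dp \<omega> r =
     (if dp = d then 1\<^sub>m d
      else (1 / sqrt (real dp)) \<cdot>\<^sub>m mat dp d (\<lambda>(i, l). snd \<omega> (r, i, l)))"

section \<open>Fixed dimensional encodings\<close>

definition clusters :: "nat \<Rightarrow> bool list list" where
  "clusters k = List.n_lists k [False, True]"

definition hamming :: "bool list \<Rightarrow> bool list \<Rightarrow> nat" where
  "hamming u v = card {j. j < length u \<and> u ! j \<noteq> v ! j}"

abbreviation vec_sum :: "nat \<Rightarrow> real vec set \<Rightarrow> real vec" where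
  "vec_sum d A \<equiv> finsum_vec TYPE(real) d (\<lambda>x. x) A"

definition query_block :: "nat \<Rightarrow> (real vec \<Rightarrow> bool list) \<Rightarrow> real vec set \<Rightarrow> bool list \<Rightarrow> real vec" where
  "query_block d \<phi> Q b = vec_sum d {q \<in> Q. \<phi> q = b}"

text \<open>Ties between nearest points are broken arbitrarily, so the block of a document is
  a relation: v is one of the admissible blocks of P for the cluster b.\<close>

definition is_doc_block ::
    "nat \<Rightarrow> (real vec \<Rightarrow> bool list) \<Rightarrow> real vec set \<Rightarrow> bool list \<Rightarrow> real vec \<Rightarrow> bool" where
  "is_doc_block d \<phi> P b v \<longleftrightarrow>
     (let C = {p \<in> P. \<phi> p = b} in
      if C \<noteq> {} then v = (1 / real (card C)) \<cdot>\<^sub>v vec_sum d C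
      else v \<in> P \<and> (\<forall>p\<in>P. hamming (\<phi> v) b \<le> hamming (\<phi> p) b))"

definition fde_dim :: "nat \<Rightarrow> nat \<Rightarrow> nat \<Rightarrow> nat" where
  "fde_dim k dp R = 2 ^ k * dp * R"

definition fde_concat ::
    "nat \<Rightarrow> nat \<Rightarrow> nat \<Rightarrow> nat \<Rightarrow> randomness \<Rightarrow> (nat \<Rightarrow> bool list \<Rightarrow> real vec) \<Rightarrow> real vec" where
  "fde_concat d k dp R \<omega> blk =
     vec_of_list (concat [list_of_vec (proj_mat d dp \<omega> r *\<^sub>v blk r b). r \<leftarrow> [0..<R], b \<leftarrow> clusters k])"

definition fde_query ::
    "nat \<Rightarrow> nat \<Rightarrow> nat \<Rightarrow> nat \<Rightarrow> randomness \<Rightarrow> real vec set \<Rightarrow> real vec" where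
  "fde_query d k dp R \<omega> Q = fde_concat d k dp R \<omega> (\<lambda>r b. query_block d (simhash d k \<omega> r) Q b)"

definition is_fde_doc ::
    "nat \<Rightarrow> nat \<Rightarrow> nat \<Rightarrow> nat \<Rightarrow> randomness \<Rightarrow> real vec set \<Rightarrow> real vec \<Rightarrow> bool" where
  "is_fde_doc d k dp R \<omega> P v \<longleftrightarrow>
     (\<exists>blk. (\<forall>r<R. \<forall>b\<in>set (clusters k). is_doc_block d (simhash d k \<omega> r) P b (blk r b)) \<and>
            v = fde_concat d k dp R \<omega> blk)"

definition is_fde_docs ::
    "nat \<Rightarrow> nat \<Rightarrow> nat \<Rightarrow> nat \<Rightarrow> randomness \<Rightarrow> nat \<Rightarrow> (nat \<Rightarrow> real vec set) \<Rightarrow> (nat \<Rightarrow> real vec) \<Rightarrow> bool" where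
  "is_fde_docs d k dp R \<omega> n P F \<longleftrightarrow> (\<forall>i\<in>{1..n}. is_fde_doc d k dp R \<omega> (P i) (F i))"

text \<open>i is an index attaining the maximum of the inner products with the encoded documents;
  there may be several.\<close>

definition is_best_doc :: "nat \<Rightarrow> real vec \<Rightarrow> (nat \<Rightarrow> real vec) \<Rightarrow> nat \<Rightarrow> bool" where
  "is_best_doc n Fq F i \<longleftrightarrow> is_arg_max (\<lambda>i. Fq \<bullet> F i) (\<lambda>i. i \<in> {1..n}) i"

text \<open>A parameter set to O(f) with hidden constant C. The outer maximum only keeps parameters
  positive when f is not (large \<open>\<epsilon>\<close>, or n = 1).\<close>

definition param :: "real \<Rightarrow> real \<Rightarrow> nat" where
  "param C f = max 1 (nat \<lceil>C * f\<rceil>)"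

lemma dim_fde_concat: "dim_vec (fde_concat d k dp R \<omega> blk) = fde_dim k dp R"
proof -
  define f where "f = (\<lambda>r b. list_of_vec (proj_mat d dp \<omega> r *\<^sub>v blk r b))"
  have len: "length (f r b) = dp" for r b
    by (simp add: f_def proj_mat_def)
  have row: "length (concat (map (f r) ys)) = dp * length ys" for r ys
    by (induction ys) (auto simp: len)
  have "length (concat (concat (map (\<lambda>r. map (f r) ys) xs))) = length ys * dp * length xs" for xs ys
    by (induction xs) (auto simp: row)
  moreover have "fde_concat d k dp R \<omega> blk =
      vec_of_list (concat (concat (map (\<lambda>r. map (f r) (clusters k)) [0..<R])))"
    by (simp add: fde_concat_def f_def)
  ultimately show ?thesis
    by (simp only: dim_vec_of_list) (simp add: fde_dim_def clusters_def length_n_lists numeral_2_eq_2)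
qed

section \<open>Model of computation\<close>

text \<open>A real RAM with unit-cost arithmetic and comparisons, as a structured language: registers
  hold natural numbers, arrays hold real numbers and are randomly accessed. The only real literals
  are 0 and 1, there is no rounding operation, and natural numbers have no division and no bitwise
  operations.\<close>

record ram =
  nreg :: "string \<Rightarrow> nat"
  rmem :: "string \<Rightarrow> nat \<Rightarrow> real"

datatype nexp = NConst nat | NReg string | NAdd nexp nexp | NSub nexp nexp | NMul nexp nexp

datatype rexp = RZero | ROne | RGet string nexp
  | RAdd rexp rexp | RSub rexp rexp | RMul rexp rexp | RDiv rexp rexp

datatype test = NLess nexp nexp | RLess rexp rexp

datatype prog = Skip | NSet string nexp | RSet string nexp rexp | Seq prog prog
  | If test prog prog | While test prog

primrec nval :: "nexp \<Rightarrow> ram \<Rightarrow> nat" where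
  "nval (NConst c) s = c"
| "nval (NReg x) s = nreg s x"
| "nval (NAdd a b) s = nval a s + nval b s"
| "nval (NSub a b) s = nval a s - nval b s"
| "nval (NMul a b) s = nval a s * nval b s"

primrec rval :: "rexp \<Rightarrow> ram \<Rightarrow> real" where
  "rval RZero s = 0"
| "rval ROne s = 1"
| "rval (RGet x a) s = rmem s x (nval a s)"
| "rval (RAdd a b) s = rval a s + rval b s"
| "rval (RSub a b) s = rval a s - rval b s"
| "rval (RMul a b) s = rval a s * rval b s"
| "rval (RDiv a b) s = rval a s / rval b s"

primrec tval :: "test \<Rightarrow> ram \<Rightarrow> bool" where
  "tval (NLess a b) s = (nval a s < nval b s)"
| "tval (RLess a b) s = (rval a s < rval b s)"

primrec ncost :: "nexp \<Rightarrow> nat" where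
  "ncost (NConst c) = 1"
| "ncost (NReg x) = 1"
| "ncost (NAdd a b) = ncost a + ncost b + 1"
| "ncost (NSub a b) = ncost a + ncost b + 1"
| "ncost (NMul a b) = ncost a + ncost b + 1"

primrec rcost :: "rexp \<Rightarrow> nat" where
  "rcost RZero = 1"
| "rcost ROne = 1"
| "rcost (RGet x a) = ncost a + 1"
| "rcost (RAdd a b) = rcost a + rcost b + 1"
| "rcost (RSub a b) = rcost a + rcost b + 1"
| "rcost (RMul a b) = rcost a + rcost b + 1"
| "rcost (RDiv a b) = rcost a + rcost b + 1"

primrec tcost :: "test \<Rightarrow> nat" where
  "tcost (NLess a b) = ncost a + ncost b + 1"
| "tcost (RLess a b) = rcost a + rcost b + 1"

text \<open>\<open>exec c s t s'\<close>: started in s, the program c halts in s' after t steps.\<close>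

inductive exec :: "prog \<Rightarrow> ram \<Rightarrow> nat \<Rightarrow> ram \<Rightarrow> bool" where
  Skip: "exec Skip s 1 s"
| NSet: "exec (NSet x a) s (ncost a + 1) (s\<lparr>nreg := (nreg s)(x := nval a s)\<rparr>)"
| RSet: "exec (RSet x a e) s (ncost a + rcost e + 1)
           (s\<lparr>rmem := (rmem s)(x := (rmem s x)(nval a s := rval e s))\<rparr>)"
| Seq: "exec c1 s t1 s' \<Longrightarrow> exec c2 s' t2 s'' \<Longrightarrow> exec (Seq c1 c2) s (t1 + t2) s''"
| IfTrue: "tval b s \<Longrightarrow> exec c1 s t s' \<Longrightarrow> exec (If b c1 c2) s (tcost b + t) s'"
| IfFalse: "\<not> tval b s \<Longrightarrow> exec c2 s t s' \<Longrightarrow> exec (If b c1 c2) s (tcost b + t) s'"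
| WhileFalse: "\<not> tval b s \<Longrightarrow> exec (While b c) s (tcost b) s"
| WhileTrue: "tval b s \<Longrightarrow> exec c s t1 s' \<Longrightarrow> exec (While b c) s' t2 s'' \<Longrightarrow>
    exec (While b c) s (tcost b + t1 + t2) s''"

text \<open>Memory contents when the query, an enumeration qs of Q, arrives: the parameters, the query
  vectors, and the data computed in advance, namely the Gaussian vectors, the matrices of the inner
  projections and the document encodings F 1, ..., F n (all stored row by row).
  The rest of the memory is arbitrary. In particular the query encoding is not available.\<close>

definition query_input ::
    "nat \<Rightarrow> nat \<Rightarrow> nat \<Rightarrow> nat \<Rightarrow> randomness \<Rightarrow> nat \<Rightarrow> (nat \<Rightarrow> real vec) \<Rightarrow> real vec list \<Rightarrow> ram \<Rightarrow> bool"
  where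
  "query_input d k dp R \<omega> n F qs s \<longleftrightarrow>
     nreg s ''d'' = d \<and> nreg s ''ksim'' = k \<and> nreg s ''dproj'' = dp \<and> nreg s ''R'' = R \<and>
     nreg s ''n'' = n \<and> nreg s ''nq'' = length qs \<and>
     (\<forall>a<length qs. \<forall>l<d. rmem s ''Q'' (a * d + l) = (qs ! a) $ l) \<and>
     (\<forall>r<R. \<forall>j<k. \<forall>l<d. rmem s ''G'' ((r * k + j) * d + l) = gauss_vec d \<omega> r j $ l) \<and>
     (\<forall>r<R. \<forall>i<dp. \<forall>l<d. rmem s ''A'' ((r * dp + i) * d + l) = proj_mat d dp \<omega> r $$ (i, l)) \<and>
     (\<forall>i<n. \<forall>t<fde_dim k dp R. rmem s ''F'' (i * fde_dim k dp R + t) = F (Suc i) $ t)"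

text \<open>The document is returned as its index, in a register. The time is the worst case over all
  outcomes of the randomness, all tie breakings and all enumerations of the query.\<close>

definition recovers_in_time ::
    "prog \<Rightarrow> nat \<Rightarrow> nat \<Rightarrow> nat \<Rightarrow> nat \<Rightarrow> nat \<Rightarrow> real vec set \<Rightarrow> (nat \<Rightarrow> real vec set) \<Rightarrow> real \<Rightarrow> bool"
  where
  "recovers_in_time c d k dp R n Q P T \<longleftrightarrow>
     (\<forall>\<omega>\<in>space (fde_space d k dp R). \<forall>F qs s.
        is_fde_docs d k dp R \<omega> n P F \<and> distinct qs \<and> set qs = Q \<and> query_input d k dp R \<omega> n F qs s \<longrightarrow>
        (\<exists>t s'. exec c s t s' \<and> real t \<le> T \<and>
                is_best_doc n (fde_query d k dp R \<omega> Q) F (nreg s' ''out'')))"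

end

(* A SimHash bit separates two unit vectors with a probability that depends only on their inner
   product, and a gap in the inner products yields a proportional gap in these probabilities. By
   Hoeffding's inequality over the bits of a hash, every document point that enters the block of a
   query vector is nearly optimal for it, outside an event of probability O(epsilon) per repetition;
   Hoeffding's inequality over the repetitions then bounds the fraction of bad repetitions.

   A union bound over the repetitions would need a target dimension growing with their number, whose
   constant is independent of the other ones. Instead the excess of the projection errors over
   epsilon is averaged over the repetitions: its expectation is exponentially small in the target
   dimension, so Markov's inequality suffices.

   A query vector contributes to a single block per repetition, hence the query is processed by
   hashing and projecting each vector and reading one block of every document; the exponentially
   long query encoding is never written down. *)

theory Submission
  imports Defs
begin

section \<open>Gaussian hyperplanes\<close>

text \<open>The law of two hash bits is usually computed by rotating into the plane of the two
  vectors, giving arccos r / pi for the probability that they differ. Here only characteristic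
  functions are used: the covariance of two signs becomes an integral whose growth in r can be read
  off. The slope 1 / 100 obtained in place of 1 / pi only costs constants.

  The number of bits does not grow with n, so misordered points cannot be excluded for all documents
  at once. They are made rare, at most \<open>\<epsilon>\<close> / 64 per repetition, and the number
  of repetitions alone pays for the union bound over documents.

  As inner products lie in [-1, 1], a misordered repetition costs at most 2.

  Since ties are broken arbitrarily, accuracy is quantified over all admissible encodings, and it
  takes an argument of its own that this defines an event.\<close>

locale gaussian_family = prob_space +
  fixes G :: "'i \<Rightarrow> 'a \<Rightarrow> real" and I :: "'i set"
  assumes indep: "indep_vars (\<lambda>_. borel) G I"
    and std_normal: "\<And>l. l \<in> I \<Longrightarrow> distr M borel (G l) = std_normal_distribution"
begin

definition lin :: "('i \<Rightarrow> real) \<Rightarrow> 'a \<Rightarrow> real" where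
  "lin w \<omega> = (\<Sum>l\<in>I. G l \<omega> * w l)"

lemma rv: "l \<in> I \<Longrightarrow> random_variable borel (G l)"
  using indep by (auto simp: indep_vars_def)

lemma lin_measurable [measurable]: "random_variable borel (lin w)"
  unfolding lin_def by (intro borel_measurable_sum borel_measurable_times rv) auto

lemma char_lin: "char (distr M borel (lin w)) t = exp (- (t\<^sup>2 * (\<Sum>l\<in>I. (w l)\<^sup>2) / 2))"
proof (cases "finite I")
  case True
  have ind: "indep_vars (\<lambda>_. borel) (\<lambda>l \<omega>. G l \<omega> * w l) I"
    by (rule indep_vars_compose2[OF indep, where Y="\<lambda>l x. x * w l"]) auto
  have "char (distr M borel (\<lambda>\<omega>. G l \<omega> * w l)) t = exp (- (t\<^sup>2 * (w l)\<^sup>2 / 2))" if l: "l \<in> I" for l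
  proof -
    have "char (distr M borel (\<lambda>\<omega>. G l \<omega> * w l)) t = char (distr M borel (G l)) (t * w l)"
      using rv[OF l] by (simp add: char_def integral_distr mult_ac)
    then show ?thesis
      using std_normal[OF l] by (simp add: char_std_normal_distribution power_mult_distrib)
  qed
  then have "char (distr M borel (lin w)) t = (\<Prod>l\<in>I. complex_of_real (exp (- (t\<^sup>2 * (w l)\<^sup>2 / 2))))"
    using char_distr_sum[OF ind] by (simp add: lin_def[abs_def])
  also have "\<dots> = exp (- (t\<^sup>2 * (\<Sum>l\<in>I. (w l)\<^sup>2) / 2))"
    using True by (simp add: sum_negf sum_divide_distrib sum_distrib_left flip: of_real_prod exp_sum)
  finally show ?thesis .
\<comment> \<open>For infinite \<open>I\<close> every sum is 0 by convention: the form is constant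
  and both sides are 1.\<close>
qed (simp add: lin_def char_def integral_distr prob_space del: distr_const)

text \<open>The real part of the characteristic function at 1; this is how normality enters the
  covariance computation.\<close>

lemma expectation_cos_lin: "expectation (\<lambda>\<omega>. cos (lin w \<omega>)) = exp (- (\<Sum>l\<in>I. (w l)\<^sup>2) / 2)"
proof -
  have "expectation (\<lambda>\<omega>. cos (lin w \<omega>)) = expectation (\<lambda>\<omega>. Re (iexp (lin w \<omega>)))"
    by (simp add: Re_exp)
  also have "\<dots> = Re (expectation (\<lambda>\<omega>. iexp (lin w \<omega>)))"
    by (rule integral_Re) (intro integrable_iexp; simp)
  also have "\<dots> = Re (char (distr M borel (lin w)) 1)"
    by (simp add: char_def integral_distr)
  finally show ?thesis unfolding char_lin by simp
qed

text \<open>The characteristic function identifies the law as standard normal, which has no atoms.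
  Hash bits test \<open>> 0\<close>, whereas the sign function takes a third value at 0; this value
  is thereby excluded.\<close>

lemma AE_lin_nonzero:
  assumes w: "(\<Sum>l\<in>I. (w l)\<^sup>2) = 1"
  shows "AE \<omega> in M. lin w \<omega> \<noteq> 0"
proof -
  have eq: "distr M borel (lin w) = std_normal_distribution"
  proof (rule Levy_uniqueness)
    show "real_distribution (distr M borel (lin w))" by (rule real_distribution_distr) simp
    show "char (distr M borel (lin w)) = char std_normal_distribution"
      using char_lin[of w] w by (simp add: char_std_normal_distribution fun_eq_iff)
  qed (rule real_dist_normal_dist)
  have "AE x in distr M borel (lin w). x \<noteq> 0"
    unfolding eq using AE_lborel_singleton[of "0::real"] by (subst AE_density) (auto elim: eventually_mono)
  then show ?thesis by (subst (asm) AE_distr_iff) auto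
qed

end

text \<open>A bounded approximation of \<open>pi / 2\<close> times the sign function by a mixture of sines, to which
  characteristic functions apply.\<close>

definition trunc :: "nat \<Rightarrow> real measure" where
  "trunc N = density lborel (\<lambda>u. ennreal (indicator {1 / real N..real N} u))"

text \<open>Dirichlet's integral, cut off at both ends. On the support of \<open>trunc N\<close> the
  maximum equals u; in this form the integrand is bounded by N at every u, on the support or
  not.\<close>

definition trunc_sgn :: "nat \<Rightarrow> real \<Rightarrow> real" where
  "trunc_sgn N x = (\<integral>u. sin (u * x) / max u (1 / real N) \<partial>trunc N)"

lemma sets_trunc[simp, measurable_cong]: "sets (trunc N) = sets borel"
  and space_trunc[simp]: "space (trunc N) = UNIV"
  by (simp_all add: trunc_def)

lemma finite_measure_trunc: "finite_measure (trunc N)"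
  by (rule finite_measureI) (simp add: trunc_def emeasure_density ennreal_indicator emeasure_lborel_Icc_eq)

text \<open>As a function of u, \<open>Si (u * x)\<close> is an antiderivative of the integrand.
  Convergence and boundedness are then inherited from the sine integral.\<close>

lemma trunc_sgn_eq_Si:
  assumes "N \<ge> 1"
  shows "trunc_sgn N x = Si (real N * x) - Si (x / real N)"
proof -
  have pt: "indicator {1 / real N..real N} u *\<^sub>R (sin (u * x) / max u (1 / real N)) =
      (indicator {1 / real N..real N} u *\<^sub>R (x * sinc (u * x)) :: real)" for u
  proof (cases "u \<in> {1 / real N..real N}")
    case True
    then have "1 / real N \<le> u" by simp
    moreover have "1 / real N > 0" using assms by simp
    ultimately have "u > 0" "max u (1 / real N) = u" by linarith+
    then show ?thesis by (auto simp: indicator_def)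
  next
    case False
    then show ?thesis by (simp only: indicator_simps(2)[OF False] scaleR_zero_left)
  qed
  have "trunc_sgn N x = (\<integral>u. indicator {1 / real N..real N} u *\<^sub>R (x * sinc (u * x)) \<partial>lborel)"
    unfolding trunc_sgn_def trunc_def pt[symmetric] by (subst integral_density) auto
  also have "\<dots> = Si (real N * x) - Si (1 / real N * x)"
  proof (rule integral_FTC_Icc)
    show "1 / real N \<le> real N" using assms by (simp add: field_simps mult_ge1_I)
    show "continuous_on {1 / real N..real N} (\<lambda>u. x * sinc (u * x))"
      by (intro continuous_intros)
    fix u
    have "((\<lambda>u. Si (u * x)) has_real_derivative sinc (u * x) * x) (at u within {1 / real N..real N})"
      by (rule DERIV_chain2[OF DERIV_Si]) (auto intro!: derivative_eq_intros)
    then show "((\<lambda>u. Si (u * x)) has_vector_derivative x * sinc (u * x)) (at u within {1 / real N..real N})"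
      by (simp add: has_real_derivative_iff_has_vector_derivative mult_ac)
  qed
  finally show ?thesis by simp
qed

lemma trunc_sgn_tendsto: "(\<lambda>N. trunc_sgn N x) \<longlonglongrightarrow> pi / 2 * sgn x"
proof -
  have lim: "(\<lambda>N. Si (real N * y) - Si (y / real N)) \<longlonglongrightarrow> pi / 2" if "y > 0" for y
  proof -
    have "(\<lambda>N. Si (real N * y)) \<longlonglongrightarrow> pi / 2"
      by (rule filterlim_compose[OF Si_at_top])
        (use that in \<open>auto intro!: filterlim_at_top_mult_tendsto_pos[OF tendsto_const] filterlim_real_sequentially\<close>)
    moreover have "(\<lambda>N. Si (y / real N)) \<longlonglongrightarrow> Si 0"
      by (rule isCont_tendsto_compose[OF isCont_Si]) (rule lim_const_over_n)
    ultimately show ?thesis using Si_neg[of 0] tendsto_diff by fastforce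
  qed
  have ev: "eventually (\<lambda>N. Si (real N * x) - Si (x / real N) = trunc_sgn N x) sequentially"
    using eventually_ge_at_top[of 1] by eventually_elim (simp add: trunc_sgn_eq_Si)
  consider "x = 0" | "x > 0" | "x < 0" by linarith
  then have "(\<lambda>N. Si (real N * x) - Si (x / real N)) \<longlonglongrightarrow> pi / 2 * sgn x"
  proof cases
    case 3
    have "Si (real N * x) - Si (x / real N) = - (Si (real N * - x) - Si (- x / real N))" for N
    proof -
      have "Si (- (real N * - x)) = - Si (real N * - x)" "Si (- (- x / real N)) = - Si (- x / real N)"
        using 3 by (intro Si_neg; simp add: divide_nonpos_nonneg mult_nonneg_nonpos)+
      then show ?thesis by simp
    qed
    then show ?thesis using tendsto_minus[OF lim[of "-x"]] 3 by simp
  qed (use lim in auto)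
  then show ?thesis using ev by (rule Lim_transform_eventually)
qed

text \<open>Uniform in N as well as in x: this supplies the dominating constant when N tends to
  infinity in \<open>separation_gap\<close>.\<close>

lemma bounded_trunc_sgn: "\<exists>B. \<forall>N\<ge>1. \<forall>x. \<bar>trunc_sgn N x\<bar> \<le> B"
proof -
  obtain B where "\<And>T. \<bar>Si T\<bar> \<le> B" using bounded_Si by blast
  then have "\<bar>trunc_sgn N x\<bar> \<le> B + B" if "N \<ge> 1" for N x
    unfolding trunc_sgn_eq_Si[OF that]
    by (intro order_trans[OF abs_triangle_ineq4] add_mono)
  then show ?thesis by blast
qed

lemma borel_measurable_trunc_sgn[measurable]: "trunc_sgn N \<in> borel_measurable borel"
proof -
  interpret finite_measure "trunc N" by (rule finite_measure_trunc)
  show ?thesis unfolding trunc_sgn_def by measurable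
qed

text \<open>Grothendieck's identity in the guise of an integral: the covariance of the signs of two
  Gaussian projections depends on the inner product only, through a kernel with derivative at
  least \<open>exp (- (u\<^sup>2 + v\<^sup>2) / 2)\<close>.\<close>

definition sgn_kernel :: "real \<Rightarrow> real \<Rightarrow> real \<Rightarrow> real" where
  "sgn_kernel r u v = exp (- (u\<^sup>2 + v\<^sup>2) / 2) * sinh (r * u * v)"

section \<open>The gap in the separation probabilities of a random hyperplane\<close>

text \<open>Fubini brings the expectation under the integrals over u and v. A product of sines is
  half a difference of the cosines of u x - v y and u x + v y; their Gaussian expectations are exp
  (- (u^2 + v^2) / 2) times exp (r u v) and exp (- r u v), whence the hyperbolic sine.\<close>

lemma (in gaussian_family) expectation_trunc_sgn:
  assumes x: "(\<Sum>l\<in>I. (x l)\<^sup>2) = 1" and y: "(\<Sum>l\<in>I. (y l)\<^sup>2) = 1" and N: "N \<ge> 1"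
  shows "expectation (\<lambda>\<omega>. trunc_sgn N (lin x \<omega>) * trunc_sgn N (lin y \<omega>)) =
    (\<integral>(u, v). sgn_kernel (\<Sum>l\<in>I. x l * y l) u v / (max u (1 / N) * max v (1 / N)) \<partial>(trunc N \<Otimes>\<^sub>M trunc N))"
proof -
  let ?r = "\<Sum>l\<in>I. x l * y l"
  interpret T: finite_measure "trunc N" by (rule finite_measure_trunc)
  interpret TT: finite_measure "trunc N \<Otimes>\<^sub>M trunc N"
    by (rule finite_measure_pair_measure; rule finite_measure_trunc)
  interpret P: pair_sigma_finite "trunc N" "trunc N" ..
  interpret MT: pair_sigma_finite M "trunc N \<Otimes>\<^sub>M trunc N" ..
  interpret FM: finite_measure "M \<Otimes>\<^sub>M (trunc N \<Otimes>\<^sub>M trunc N)"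
    by (rule finite_measure_pair_measure) unfold_locales
  define m where "m u = max u (1 / real N)" for u
  have [measurable]: "m \<in> borel_measurable borel" unfolding m_def by measurable
  have m: "m u > 0" "\<bar>a / m u\<bar> \<le> N" if "\<bar>a\<bar> \<le> 1" for a u
  proof -
    show p: "m u > 0" using N by (simp add: m_def less_max_iff_disj)
    have "\<bar>a / m u\<bar> \<le> 1 / (1 / N)"
      unfolding abs_divide using that N p by (intro frac_le) (auto simp: m_def)
    then show "\<bar>a / m u\<bar> \<le> N" by simp
  qed
  have prodbd: "\<bar>sin a / m u * (sin b / m v)\<bar> \<le> real N * real N" for a b u v
    unfolding abs_mult by (intro mult_mono m abs_sin_le_one) auto
  have prod: "trunc_sgn N a * trunc_sgn N b =
      (\<integral>(u, v). sin (u * a) / m u * (sin (v * b) / m v) \<partial>(trunc N \<Otimes>\<^sub>M trunc N))" for a b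
  proof -
    have int: "integrable (trunc N \<Otimes>\<^sub>M trunc N) (\<lambda>(u, v). sin (u * a) / m u * (sin (v * b) / m v))"
      by (rule TT.integrable_const_bound[where B="real N * real N"])
        (auto intro!: AE_I2 simp only: split_beta real_norm_def prodbd, measurable)
    show ?thesis
      unfolding P.integral_fst'[OF int, symmetric] prod.case integral_mult_right_zero integral_mult_left_zero
      by (simp only: trunc_sgn_def m_def)
  qed
  have inner: "expectation (\<lambda>\<omega>. sin (u * lin x \<omega>) / m u * (sin (v * lin y \<omega>) / m v)) =
      sgn_kernel ?r u v / (m u * m v)" for u v
  proof -
    \<comment> \<open>The sign s, either 1 or -1, treats both cosines at once.\<close>
    have sq: "(\<Sum>l\<in>I. (u * x l + s * (v * y l))\<^sup>2) = u\<^sup>2 + v\<^sup>2 + s * (2 * (?r * u * v))" if "s\<^sup>2 = 1" for s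
    proof -
      have "(\<Sum>l\<in>I. (u * x l + s * (v * y l))\<^sup>2) = (\<Sum>l\<in>I. u\<^sup>2 * (x l)\<^sup>2 + s\<^sup>2 * v\<^sup>2 * (y l)\<^sup>2 + s * 2 * u * v * (x l * y l))"
        by (rule sum.cong) (auto simp: power2_eq_square algebra_simps)
      also have "\<dots> = u\<^sup>2 * (\<Sum>l\<in>I. (x l)\<^sup>2) + s\<^sup>2 * v\<^sup>2 * (\<Sum>l\<in>I. (y l)\<^sup>2) + s * 2 * u * v * ?r"
        by (simp add: sum.distrib sum_distrib_left)
      finally show ?thesis using x y that by (simp add: algebra_simps)
    qed
    have cos: "expectation (\<lambda>\<omega>. cos (u * lin x \<omega> + s * (v * lin y \<omega>))) =
        exp (- (u\<^sup>2 + v\<^sup>2) / 2) * exp (- s * (?r * u * v))" if "s\<^sup>2 = 1" for s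
    proof -
      have "u * lin x \<omega> + s * (v * lin y \<omega>) = lin (\<lambda>l. u * x l + s * (v * y l)) \<omega>" for \<omega>
        by (simp add: lin_def sum_distrib_left sum.distrib algebra_simps)
      then have "expectation (\<lambda>\<omega>. cos (u * lin x \<omega> + s * (v * lin y \<omega>))) = exp (- (u\<^sup>2 + v\<^sup>2 + s * (2 * (?r * u * v))) / 2)"
        using expectation_cos_lin[of "\<lambda>l. u * x l + s * (v * y l)"]
        by (simp only: sq[OF that])
      also have "\<dots> = exp (- (u\<^sup>2 + v\<^sup>2) / 2 + - s * (?r * u * v))"
        by (rule arg_cong[where f=exp]) (simp add: field_simps)
      finally show ?thesis by (simp only: exp_add)
    qed
    have "expectation (\<lambda>\<omega>. sin (u * lin x \<omega>) / m u * (sin (v * lin y \<omega>) / m v)) =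
       expectation (\<lambda>\<omega>. (cos (u * lin x \<omega> + (-1) * (v * lin y \<omega>)) - cos (u * lin x \<omega> + 1 * (v * lin y \<omega>))) / (2 * m u * m v))"
    proof -
      have "sin a / m u * (sin b / m v) = (cos (a + (-1) * b) - cos (a + 1 * b)) / (2 * m u * m v)" for a b
      proof -
        have *: "sin a * sin b = (cos (a + (-1) * b) - cos (a + 1 * b)) / 2" by (simp add: sin_times_sin)
        have "sin a / m u * (sin b / m v) = sin a * sin b / (m u * m v)" by simp
        also have "\<dots> = (cos (a + (-1) * b) - cos (a + 1 * b)) / (2 * m u * m v)"
          unfolding * by (simp add: mult.assoc)
        finally show ?thesis .
      qed
      then show ?thesis by (simp only:)
    qed
    also have "\<dots> = (expectation (\<lambda>\<omega>. cos (u * lin x \<omega> + (-1) * (v * lin y \<omega>))) - expectation (\<lambda>\<omega>. cos (u * lin x \<omega> + 1 * (v * lin y \<omega>)))) / (2 * m u * m v)"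
      by (subst integral_divide_zero, subst Bochner_Integration.integral_diff)
        (auto intro!: integrable_const_bound[where B=1])
    also have "\<dots> = sgn_kernel ?r u v / (m u * m v)"
    proof -
      define E where "E = exp (- (u\<^sup>2 + v\<^sup>2) / 2)"
      have "sgn_kernel ?r u v = (E * exp (- (-1) * (?r * u * v)) - E * exp (- 1 * (?r * u * v))) / 2"
        by (simp add: sgn_kernel_def sinh_def E_def right_diff_distrib)
      moreover have "(-1)\<^sup>2 = (1::real)" "1\<^sup>2 = (1::real)" by simp_all
      ultimately show ?thesis by (simp only: cos E_def[symmetric] divide_divide_eq_left mult.assoc)
    qed
    finally show ?thesis .
  qed
  have int: "integrable (M \<Otimes>\<^sub>M (trunc N \<Otimes>\<^sub>M trunc N))
      (\<lambda>(\<omega>, (u, v)). sin (u * lin x \<omega>) / m u * (sin (v * lin y \<omega>) / m v))"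
    by (rule FM.integrable_const_bound[where B="real N * real N"])
      (auto intro!: AE_I2 simp only: split_beta real_norm_def prodbd, measurable)
  have "expectation (\<lambda>\<omega>. trunc_sgn N (lin x \<omega>) * trunc_sgn N (lin y \<omega>)) =
    (\<integral>\<omega>. (\<integral>w. (case w of (u, v) \<Rightarrow> sin (u * lin x \<omega>) / m u * (sin (v * lin y \<omega>) / m v)) \<partial>(trunc N \<Otimes>\<^sub>M trunc N)) \<partial>M)"
    by (simp add: prod)
  also have "\<dots> = (\<integral>w. (\<integral>\<omega>. (case w of (u, v) \<Rightarrow> sin (u * lin x \<omega>) / m u * (sin (v * lin y \<omega>) / m v)) \<partial>M) \<partial>(trunc N \<Otimes>\<^sub>M trunc N))"
    by (rule MT.Fubini_integral[symmetric]) (use int in simp)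
  also have "\<dots> = (\<integral>(u, v). sgn_kernel ?r u v / (m u * m v) \<partial>(trunc N \<Otimes>\<^sub>M trunc N))"
    by (rule Bochner_Integration.integral_cong) (simp_all only: split_beta inner)
  finally show ?thesis by (simp add: m_def)
qed

lemma sinh_diff_ge:
  fixes a b :: real
  assumes "b \<le> a"
  shows "a - b \<le> sinh a - sinh b"
proof -
  have "(\<lambda>x::real. sinh x - x) b \<le> (\<lambda>x. sinh x - x) a"
  proof (rule DERIV_nonneg_imp_nondecreasing[OF assms])
    fix x :: real
    show "\<exists>y. ((\<lambda>x. sinh x - x) has_real_derivative y) (at x) \<and> 0 \<le> y"
      by (rule exI[of _ "cosh x - 1"]) (auto intro!: derivative_eq_intros simp: cosh_real_ge_1)
  qed
  then show ?thesis by simp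
qed

lemma abs_sinh_le: "\<bar>sinh x\<bar> \<le> exp \<bar>x\<bar>" for x :: real
proof -
  have *: "\<bar>(a - b) / 2\<bar> \<le> e" if "0 < a" "0 < b" "a \<le> e" "b \<le> e" for a b e :: real
    using that by (simp add: abs_le_iff)
  have "sinh x = (exp x - exp (- x)) / 2" by (simp add: sinh_def)
  moreover have "\<bar>(exp x - exp (- x)) / 2\<bar> \<le> exp \<bar>x\<bar>" by (rule *) auto
  ultimately show ?thesis by (simp only:)
qed

lemma borel_measurable_sgn_kernel[measurable (raw)]:
  assumes [measurable]: "f \<in> borel_measurable M" "g \<in> borel_measurable M"
  shows "(\<lambda>x. sgn_kernel r (f x) (g x)) \<in> borel_measurable M"
  unfolding sgn_kernel_def sinh_def by measurable

text \<open>On the support u and v are positive, so the integrand grows with r. The derivative of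
  sinh is at least 1, which yields a factor u v that cancels the weights 1 / (u v). On the square
  [1/2, 1] x [1/2, 1] the increment is therefore at least (r1 - r2) / e, and its measure 1 / 4 with
  e <= 3 gives 1 / 12. For N >= 2 the truncation contains this square.\<close>

lemma sgn_kernel_integral_diff:
  assumes r: "r2 \<le> r1" and N: "N \<ge> 2"
  shows "(r1 - r2) / 12 \<le>
    (\<integral>(u, v). sgn_kernel r1 u v / (max u (1 / N) * max v (1 / N)) \<partial>(trunc N \<Otimes>\<^sub>M trunc N)) -
    (\<integral>(u, v). sgn_kernel r2 u v / (max u (1 / N) * max v (1 / N)) \<partial>(trunc N \<Otimes>\<^sub>M trunc N))"
proof -
  interpret T: finite_measure "trunc N" by (rule finite_measure_trunc)
  interpret TT: finite_measure "trunc N \<Otimes>\<^sub>M trunc N"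
    by (rule finite_measure_pair_measure; rule finite_measure_trunc)
  interpret P: pair_sigma_finite "trunc N" "trunc N" ..
  let ?m = "\<lambda>u. max u (1 / real N)"
  let ?S = "{1/2..1::real} \<times> {1/2..1::real}"
  have N0: "1 / real N > 0" "1 / real N \<le> 1 / 2" using N by (auto simp: field_simps)
  have AE1: "AE u in trunc N. u \<in> {1 / real N..real N}"
    unfolding trunc_def by (subst AE_density) (auto simp: ennreal_indicator indicator_def)
  have AE: "AE w in trunc N \<Otimes>\<^sub>M trunc N. fst w \<in> {1 / real N..real N} \<and> snd w \<in> {1 / real N..real N}"
  proof (rule P.AE_pair_measure)
    show "AE u in trunc N. AE v in trunc N.
        fst (u, v) \<in> {1 / real N..real N} \<and> snd (u, v) \<in> {1 / real N..real N}"
      using AE1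
    proof eventually_elim
      case (elim u)
      show ?case using AE1 by eventually_elim (use elim in simp)
    qed
  qed measurable
  have int: "integrable (trunc N \<Otimes>\<^sub>M trunc N) (\<lambda>(u, v). sgn_kernel r u v / (?m u * ?m v))" for r
  proof (rule TT.integrable_const_bound[where B="exp (\<bar>r\<bar> * N * N) * (real N * real N)"])
    show "AE x in trunc N \<Otimes>\<^sub>M trunc N. norm (case x of (u, v) \<Rightarrow> sgn_kernel r u v / (?m u * ?m v))
      \<le> exp (\<bar>r\<bar> * N * N) * (real N * real N)"
      using AE
    proof eventually_elim
      case (elim w)
      define u v where "u = fst w" and "v = snd w"
      have 1: "1 / real N \<le> u" "u \<le> N" "1 / real N \<le> v" "v \<le> N"
        using elim by (auto simp: u_def v_def)
      have u: "u > 0" "v > 0" "?m u = u" "?m v = v" using 1 N0 by linarith+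
      have "1 / u \<le> 1 / (1 / real N)" "1 / v \<le> 1 / (1 / real N)"
        using 1 N0 by (intro frac_le; simp)+
      then have a: "1 / u * (1 / v) \<le> real N * real N"
        using u by (intro mult_mono) auto
      have "\<bar>sinh (r * u * v)\<bar> \<le> exp \<bar>r * u * v\<bar>" by (rule abs_sinh_le)
      moreover have "\<bar>r * u * v\<bar> \<le> \<bar>r\<bar> * N * N"
        using 1 u unfolding abs_mult by (intro mult_mono) auto
      ultimately have b: "\<bar>sinh (r * u * v)\<bar> \<le> exp (\<bar>r\<bar> * N * N)"
        by (meson exp_le_cancel_iff order.trans)
      have "exp (- (u\<^sup>2 + v\<^sup>2) / 2) \<le> 1" by simp
      then have "\<bar>sgn_kernel r u v\<bar> \<le> 1 * exp (\<bar>r\<bar> * N * N)"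
        unfolding sgn_kernel_def abs_mult by (intro mult_mono b) auto
      then have "\<bar>sgn_kernel r u v\<bar> * (1 / u * (1 / v)) \<le> exp (\<bar>r\<bar> * N * N) * (real N * real N)"
        using u by (intro mult_mono[OF _ a]) auto
      then have "\<bar>sgn_kernel r u v / (?m u * ?m v)\<bar> \<le> exp (\<bar>r\<bar> * N * N) * (real N * real N)"
        unfolding u(3,4) abs_divide abs_mult using u(1,2) by simp
      then show ?case by (simp only: split_beta u_def v_def real_norm_def)
    qed
  qed measurable
  have mS: "measure (trunc N \<Otimes>\<^sub>M trunc N) ?S = 1 / 4"
  proof -
    have "emeasure (trunc N) {1/2..1} = emeasure lborel {1/2..1::real}"
      unfolding trunc_def
    proof (subst emeasure_density)
      have "ennreal (indicator {1 / real N..real N} x) * indicator {1 / 2..1} x = indicator {1/2..1} x" for x :: real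
      proof -
        have "x \<in> {1 / real N..real N}" if "x \<in> {1/2..1}"
          using that N0 N unfolding atLeastAtMost_iff by linarith
        then show ?thesis by (auto split: split_indicator)
      qed
      then show "(\<integral>\<^sup>+ x. ennreal (indicator {1 / real N..real N} x) * indicator {1 / 2..1} x \<partial>lborel) = emeasure lborel {1/2..1::real}"
        by simp
    qed auto
    also have "\<dots> = ennreal (1 / 2)" by (simp add: emeasure_lborel_Icc_eq)
    finally have "emeasure (trunc N \<Otimes>\<^sub>M trunc N) ?S = ennreal (1 / 2) * ennreal (1 / 2)"
      by (subst T.emeasure_pair_measure_Times) auto
    also have "\<dots> = ennreal (1 / 4)" by (subst ennreal_mult[symmetric]) auto
    finally show ?thesis by (simp add: measure_def)
  qed
  have "(r1 - r2) / 12 \<le> ((r1 - r2) * exp (- 1)) * (1 / 4)"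
    using mult_left_mono[OF exp_le, of "r1 - r2"] r by (simp add: exp_minus field_simps)
  also have "\<dots> = (\<integral>x. ((r1 - r2) * exp (- 1)) * indicator ?S x \<partial>(trunc N \<Otimes>\<^sub>M trunc N))"
    by (simp add: mS)
  also have "\<dots> \<le> (\<integral>x. (case x of (u, v) \<Rightarrow> sgn_kernel r1 u v / (?m u * ?m v)) -
      (case x of (u, v) \<Rightarrow> sgn_kernel r2 u v / (?m u * ?m v)) \<partial>(trunc N \<Otimes>\<^sub>M trunc N))"
  proof (rule integral_mono_AE)
    show "AE x in trunc N \<Otimes>\<^sub>M trunc N. ((r1 - r2) * exp (- 1)) * indicator ?S x \<le>
       (case x of (u, v) \<Rightarrow> sgn_kernel r1 u v / (?m u * ?m v)) -
      (case x of (u, v) \<Rightarrow> sgn_kernel r2 u v / (?m u * ?m v))"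
      using AE
    proof eventually_elim
      case (elim w)
      define u v where "u = fst w" and "v = snd w"
      have 1: "1 / real N \<le> u" "1 / real N \<le> v"
        using elim by (auto simp: u_def v_def)
      then have u: "u > 0" "v > 0" "?m u = u" "?m v = v" using N0 by linarith+
      define e where "e = exp (- (u\<^sup>2 + v\<^sup>2) / 2)"
      have "r1 * u * v - r2 * u * v \<le> sinh (r1 * u * v) - sinh (r2 * u * v)"
        using r u by (intro sinh_diff_ge mult_right_mono) auto
      then have "e * ((r1 - r2) * (u * v)) \<le> e * (sinh (r1 * u * v) - sinh (r2 * u * v))"
        by (intro mult_left_mono) (auto simp: e_def algebra_simps)
      moreover have "sgn_kernel r u v = e * sinh (r * u * v)" for r
        by (simp add: sgn_kernel_def e_def)
      ultimately have *: "e * (r1 - r2) \<le> sgn_kernel r1 u v / (?m u * ?m v) - sgn_kernel r2 u v / (?m u * ?m v)"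
        using u by (simp add: field_simps)
      have "(r1 - r2) * exp (- 1) * indicator ?S (u, v) \<le> e * (r1 - r2)"
      proof (cases "(u, v) \<in> ?S")
        case True
        then have "u\<^sup>2 \<le> 1" "v\<^sup>2 \<le> 1" using u by (auto intro: power_le_one)
        then have "- 1 \<le> - (u\<^sup>2 + v\<^sup>2) / 2" by (simp add: field_simps)
        then have "exp (- 1) \<le> e" unfolding e_def exp_le_cancel_iff .
        then have "exp (- 1) * (r1 - r2) \<le> e * (r1 - r2)" using r by (intro mult_right_mono) auto
        then show ?thesis unfolding indicator_simps(1)[OF True] by (simp only: mult_1_right mult.commute)
      next
        case False
        have "0 \<le> e * (r1 - r2)" using r by (simp add: e_def)
        then show ?thesis by (simp only: indicator_simps(2)[OF False] mult_zero_right)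
      qed
      with * have "(r1 - r2) * exp (- 1) * indicator ?S (u, v) \<le>
          sgn_kernel r1 u v / (?m u * ?m v) - sgn_kernel r2 u v / (?m u * ?m v)" by linarith
      then show ?case by (simp only: split_beta u_def v_def prod.collapse)
    qed
    show "integrable (trunc N \<Otimes>\<^sub>M trunc N) (\<lambda>x. (r1 - r2) * exp (- 1) * indicator ?S x)"
      by (rule integrable_mult_right) (simp add: less_top[symmetric])
  qed (intro Bochner_Integration.integrable_diff int)
  finally show ?thesis unfolding Bochner_Integration.integral_diff[OF int int] .
qed

text \<open>A product of two nonzero signs is 1 minus twice the indicator of separation. Letting N
  tend to infinity thus turns the integral estimate into one for separation probabilities, with the
  factor (pi / 2)^2 from the limit of \<open>trunc_sgn\<close>.\<close>

theorem (in gaussian_family) separation_gap: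
  assumes q: "(\<Sum>l\<in>I. (q l)\<^sup>2) = 1" and p: "(\<Sum>l\<in>I. (p l)\<^sup>2) = 1" and p': "(\<Sum>l\<in>I. (p' l)\<^sup>2) = 1"
    and le: "(\<Sum>l\<in>I. q l * p l) \<le> (\<Sum>l\<in>I. q l * p' l)"
  shows "((\<Sum>l\<in>I. q l * p' l) - (\<Sum>l\<in>I. q l * p l)) / 100 \<le>
    \<P>(\<omega> in M. (lin q \<omega> > 0) \<noteq> (lin p \<omega> > 0)) - \<P>(\<omega> in M. (lin q \<omega> > 0) \<noteq> (lin p' \<omega> > 0))"
proof -
  define E where "E x y N = expectation (\<lambda>\<omega>. trunc_sgn N (lin x \<omega>) * trunc_sgn N (lin y \<omega>))" for x y N
  define h where "h x y = prob {\<omega>\<in>space M. (lin x \<omega> > 0) \<noteq> (lin y \<omega> > 0)}" for x y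
  obtain B where B: "\<And>N x. N \<ge> 1 \<Longrightarrow> \<bar>trunc_sgn N x\<bar> \<le> B" using bounded_trunc_sgn by blast
  have lim: "E x y \<longlonglongrightarrow> (pi / 2)\<^sup>2 * (1 - 2 * h x y)"
    if x: "(\<Sum>l\<in>I. (x l)\<^sup>2) = 1" and y: "(\<Sum>l\<in>I. (y l)\<^sup>2) = 1" for x y
  proof -
    \<comment> \<open>The index is shifted because the uniform bound on \<open>trunc_sgn\<close>
      starts at N = 1.\<close>
    have "(\<lambda>N. E x y (Suc N)) \<longlonglongrightarrow> expectation (\<lambda>\<omega>. (pi / 2 * sgn (lin x \<omega>)) * (pi / 2 * sgn (lin y \<omega>)))"
      unfolding E_def
    proof (rule integral_dominated_convergence[where w="\<lambda>_. B * B"])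
      show "AE \<omega> in M. (\<lambda>N. trunc_sgn (Suc N) (lin x \<omega>) * trunc_sgn (Suc N) (lin y \<omega>))
          \<longlonglongrightarrow> pi / 2 * sgn (lin x \<omega>) * (pi / 2 * sgn (lin y \<omega>))"
        by (intro AE_I2 tendsto_mult LIMSEQ_Suc trunc_sgn_tendsto)
      show "AE \<omega> in M. norm (trunc_sgn (Suc N) (lin x \<omega>) * trunc_sgn (Suc N) (lin y \<omega>)) \<le> B * B" for N
        unfolding real_norm_def abs_mult
        by (intro AE_I2 mult_mono B order_trans[OF abs_ge_zero B[of 1 0]]) auto
    qed auto
    also have "expectation (\<lambda>\<omega>. (pi / 2 * sgn (lin x \<omega>)) * (pi / 2 * sgn (lin y \<omega>))) =
       expectation (\<lambda>\<omega>. (pi / 2)\<^sup>2 * (1 - 2 * indicator {\<omega>\<in>space M. (lin x \<omega> > 0) \<noteq> (lin y \<omega> > 0)} \<omega>))"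
    proof (rule integral_cong_AE)
      have "AE \<omega> in M. lin x \<omega> \<noteq> 0" "AE \<omega> in M. lin y \<omega> \<noteq> 0"
        by (rule AE_lin_nonzero[OF x], rule AE_lin_nonzero[OF y])
      then show "AE \<omega> in M. (pi / 2 * sgn (lin x \<omega>)) * (pi / 2 * sgn (lin y \<omega>)) =
          (pi / 2)\<^sup>2 * (1 - 2 * indicator {\<omega>\<in>space M. (lin x \<omega> > 0) \<noteq> (lin y \<omega> > 0)} \<omega>)"
        using AE_space by eventually_elim (auto simp: sgn_if power2_eq_square)
    qed auto
    also have "\<dots> = (pi / 2)\<^sup>2 * (1 - 2 * h x y)"
    proof -
      define A where "A = {\<omega>\<in>space M. (lin x \<omega> > 0) \<noteq> (lin y \<omega> > 0)}"
      have A: "A \<in> events" unfolding A_def by measurable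
      then show ?thesis unfolding h_def A_def[symmetric]
        by (subst integral_mult_right_zero, subst Bochner_Integration.integral_diff)
          (auto simp: prob_space less_top[symmetric])
    qed
    finally show ?thesis by (rule LIMSEQ_imp_Suc)
  qed
  let ?d = "(\<Sum>l\<in>I. q l * p' l) - (\<Sum>l\<in>I. q l * p l)"
  have "?d / 12 \<le> (pi / 2)\<^sup>2 * (1 - 2 * h q p') - (pi / 2)\<^sup>2 * (1 - 2 * h q p)"
  proof (rule LIMSEQ_le_const)
    show "(\<lambda>N. E q p' N - E q p N) \<longlonglongrightarrow> (pi / 2)\<^sup>2 * (1 - 2 * h q p') - (pi / 2)\<^sup>2 * (1 - 2 * h q p)"
      by (intro tendsto_diff lim q p p')
    have "?d / 12 \<le> E q p' N - E q p N" if "N \<ge> 2" for N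
      using sgn_kernel_integral_diff[OF le that] expectation_trunc_sgn[OF q p, of N]
        expectation_trunc_sgn[OF q p', of N] that
      by (simp add: E_def)
    then show "\<exists>n. \<forall>N\<ge>n. ?d / 12 \<le> E q p' N - E q p N" by blast
  qed
  also have "\<dots> = (h q p - h q p') * (2 * (pi / 2)\<^sup>2)" by (simp add: algebra_simps)
  finally have *: "?d / 12 \<le> (h q p - h q p') * (2 * (pi / 2)\<^sup>2)" .
  \<comment> \<open>The crude bound 4 for (pi / 2)^2 may be inserted only once the difference of the
    probabilities is known to be nonnegative. Then 12 * 8 = 96 is rounded up to 100.\<close>
  have "(pi / 2)\<^sup>2 \<le> 2\<^sup>2" using pi_less_4 by (intro power_mono) auto
  moreover have "h q p - h q p' \<ge> 0"
  proof (rule ccontr)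
    assume "\<not> h q p - h q p' \<ge> 0"
    then have "(h q p - h q p') * (2 * (pi / 2)\<^sup>2) < 0" by (intro mult_neg_pos) auto
    moreover have "?d / 12 \<ge> 0" using le by simp
    ultimately show False using * by linarith
  qed
  ultimately have "(h q p - h q p') * (2 * (pi / 2)\<^sup>2) \<le> (h q p - h q p') * 8" by (intro mult_left_mono) auto
  with * have "?d / 12 \<le> (h q p - h q p') * 8" by (rule order.trans)
  then have "?d / 100 \<le> h q p - h q p'" using le by (simp add: field_simps)
  then show ?thesis by (simp only: h_def)
qed

section \<open>Sign projections\<close>

text \<open>Independent uniform signs: values -1 and 1 together with mean 0 determine the
  law.\<close>

definition (in prob_space) rademacher :: "('i \<Rightarrow> 'a \<Rightarrow> real) \<Rightarrow> 'i set \<Rightarrow> bool" where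
  "rademacher S I \<longleftrightarrow> finite I \<and> indep_vars (\<lambda>_. borel) S I \<and>
     (\<forall>l\<in>I. (AE \<omega> in M. S l \<omega> \<in> {-1, 1}) \<and> expectation (S l) = 0)"

lemma (in prob_space) rademacher_rv:
  "rademacher S I \<Longrightarrow> l \<in> I \<Longrightarrow> random_variable borel (S l)"
  by (auto simp: rademacher_def indep_vars_def)

text \<open>Hoeffding's lemma for each term, which lies in an interval of length 2 |w l|: the
  exponent is 4 (w l)^2 / 8.\<close>

lemma (in prob_space) rademacher_sum_mgf:
  assumes S: "rademacher S I"
  shows "(\<integral>\<^sup>+\<omega>. exp (\<Sum>l\<in>I. S l \<omega> * w l) \<partial>M) \<le> exp ((\<Sum>l\<in>I. (w l)\<^sup>2) / 2)"
proof -
  have fin: "finite I" and ind: "indep_vars (\<lambda>_. borel) S I" using S by (auto simp: rademacher_def)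
  have "(\<integral>\<^sup>+\<omega>. exp (\<Sum>l\<in>I. S l \<omega> * w l) \<partial>M) = (\<integral>\<^sup>+\<omega>. (\<Prod>l\<in>I. ennreal (exp (S l \<omega> * w l))) \<partial>M)"
    using fin by (simp add: exp_sum prod_ennreal)
  also have "\<dots> = (\<Prod>l\<in>I. \<integral>\<^sup>+\<omega>. ennreal (exp (S l \<omega> * w l)) \<partial>M)"
    by (rule indep_vars_nn_integral[OF fin])
      (rule indep_vars_compose2[OF ind, where Y="\<lambda>l x. ennreal (exp (x * w l))"], auto)
  also have "\<dots> \<le> (\<Prod>l\<in>I. ennreal (exp ((w l)\<^sup>2 / 2)))"
  proof (rule prod_mono_ennreal)
    fix l assume l: "l \<in> I"
    note [measurable] = rademacher_rv[OF S l]
    have AE: "AE \<omega> in M. S l \<omega> \<in> {-1, 1}" "expectation (S l) = 0"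
      using S l by (auto simp: rademacher_def)
    interpret X: interval_bounded_random_variable M "\<lambda>\<omega>. S l \<omega> * w l" "- \<bar>w l\<bar>" "\<bar>w l\<bar>"
      by unfold_locales (use AE(1) in \<open>auto elim!: eventually_mono\<close>)
    have "(\<integral>\<^sup>+\<omega>. ennreal (exp (1 * (S l \<omega> * w l))) \<partial>M) \<le> ennreal (exp (1\<^sup>2 * (\<bar>w l\<bar> - - \<bar>w l\<bar>)\<^sup>2 / 8))"
      by (rule X.Hoeffdings_lemma_nn_integral_0) (use AE(2) in auto)
    also have "1\<^sup>2 * (\<bar>w l\<bar> - - \<bar>w l\<bar>)\<^sup>2 / 8 = (w l)\<^sup>2 / 2" by (simp add: power2_eq_square)
    finally show "(\<integral>\<^sup>+\<omega>. ennreal (exp (S l \<omega> * w l)) \<partial>M) \<le> ennreal (exp ((w l)\<^sup>2 / 2))" by simp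
  qed
  also have "\<dots> = exp ((\<Sum>l\<in>I. (w l)\<^sup>2) / 2)"
    using fin by (simp add: exp_sum prod_ennreal sum_divide_distrib)
  finally show ?thesis .
qed

text \<open>The Gaussian function is a Gaussian mixture of exponentials, which linearizes the square.\<close>

lemma exp_square_eq_gaussian_mixture:
  fixes x :: real
  shows "ennreal (exp (x\<^sup>2 / 4)) = (\<integral>\<^sup>+g. exp (g * x / sqrt 2) * std_normal_density g \<partial>lborel)"
proof -
  have "exp (g * x / sqrt 2) * std_normal_density g = exp (x\<^sup>2 / 4) * normal_density (x / sqrt 2) 1 g" for g
  proof -
    have "g * x / sqrt 2 + - g\<^sup>2 / 2 = x\<^sup>2 / 4 + - ((g - x / sqrt 2)\<^sup>2 / 2)"
      by (simp add: power2_diff power_divide field_simps)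
    then have "exp (g * x / sqrt 2) * exp (- g\<^sup>2 / 2) = exp (x\<^sup>2 / 4) * exp (- ((g - x / sqrt 2)\<^sup>2 / 2))"
      by (simp only: exp_add[symmetric])
    then show ?thesis by (simp add: normal_density_def)
  qed
  then have "(\<integral>\<^sup>+g. exp (g * x / sqrt 2) * std_normal_density g \<partial>lborel) =
      (\<integral>\<^sup>+g. ennreal (exp (x\<^sup>2 / 4)) * ennreal (normal_density (x / sqrt 2) 1 g) \<partial>lborel)"
    by (simp add: ennreal_mult')
  also have "\<dots> = ennreal (exp (x\<^sup>2 / 4)) * 1"
    by (subst nn_integral_cmult, simp, subst nn_integral_eq_integral) auto
  finally show ?thesis by simp
qed

text \<open>With the Gaussian variable g integrated last, the exponent is linear in the signs; their
  moment generating function contributes exp (g^2 / 4), whose mean under the standard Gaussian is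
  sqrt 2 <= 3 / 2.\<close>

lemma (in prob_space) rademacher_sum_exp_square:
  assumes S: "rademacher S I" and u: "(\<Sum>l\<in>I. (u l)\<^sup>2) = 1"
  shows "(\<integral>\<^sup>+\<omega>. exp ((\<Sum>l\<in>I. S l \<omega> * u l)\<^sup>2 / 4) \<partial>M) \<le> ennreal (3 / 2)"
proof -
  define X where "X \<omega> = (\<Sum>l\<in>I. S l \<omega> * u l)" for \<omega>
  have [measurable]: "random_variable borel X"
    unfolding X_def by (intro borel_measurable_sum borel_measurable_times rademacher_rv[OF S]) auto
  interpret pair_sigma_finite M "lborel :: real measure" ..
  have "(\<integral>\<^sup>+\<omega>. exp ((X \<omega>)\<^sup>2 / 4) \<partial>M) =
      (\<integral>\<^sup>+\<omega>. (\<integral>\<^sup>+g. ennreal (exp (g * X \<omega> / sqrt 2) * std_normal_density g) \<partial>lborel) \<partial>M)"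
    by (simp only: exp_square_eq_gaussian_mixture)
  also have "\<dots> = (\<integral>\<^sup>+g. (\<integral>\<^sup>+\<omega>. ennreal (exp (g * X \<omega> / sqrt 2) * std_normal_density g) \<partial>M) \<partial>lborel)"
    by (rule Fubini'[symmetric]) simp
  also have "\<dots> \<le> (\<integral>\<^sup>+g. ennreal (sqrt 2 * normal_density 0 (sqrt 2) g) \<partial>lborel)"
  proof (rule nn_integral_mono)
    fix g :: real
    have "(\<integral>\<^sup>+\<omega>. ennreal (exp (g * X \<omega> / sqrt 2) * std_normal_density g) \<partial>M) =
       (\<integral>\<^sup>+\<omega>. ennreal (exp (\<Sum>l\<in>I. S l \<omega> * (g * u l / sqrt 2))) \<partial>M) * std_normal_density g"
    proof -
      have "g * X \<omega> / sqrt 2 = (\<Sum>l\<in>I. S l \<omega> * (g * u l / sqrt 2))" for \<omega>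
        by (simp add: X_def sum_distrib_left sum_divide_distrib mult_ac)
      note this[symmetric]
      then show ?thesis
        by (simp only:) (subst nn_integral_multc[symmetric], auto simp: ennreal_mult'')
    qed
    also have "\<dots> \<le> ennreal (exp ((\<Sum>l\<in>I. (g * u l / sqrt 2)\<^sup>2) / 2)) * std_normal_density g"
      by (intro mult_right_mono rademacher_sum_mgf[OF S]) auto
    also have "(\<Sum>l\<in>I. (g * u l / sqrt 2)\<^sup>2) = g\<^sup>2 / 2 * (\<Sum>l\<in>I. (u l)\<^sup>2)"
      by (simp add: power_mult_distrib power_divide sum_distrib_left)
    also have "ennreal (exp (g\<^sup>2 / 2 * (\<Sum>l\<in>I. (u l)\<^sup>2) / 2)) * std_normal_density g =
        ennreal (exp (g\<^sup>2 / 4) * std_normal_density g)"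
      by (simp add: u ennreal_mult'')
    also have "exp (g\<^sup>2 / 4) * std_normal_density g = sqrt 2 * normal_density 0 (sqrt 2) g"
    proof -
      have "exp (g\<^sup>2 / 4) * exp (- g\<^sup>2 / 2) = exp (- g\<^sup>2 / 4)"
        by (simp add: exp_add[symmetric])
      then show ?thesis by (simp add: normal_density_def real_sqrt_mult real_sqrt_mult_self field_simps)
    qed
    finally show "(\<integral>\<^sup>+\<omega>. ennreal (exp (g * X \<omega> / sqrt 2) * std_normal_density g) \<partial>M) \<le> ennreal (sqrt 2 * normal_density 0 (sqrt 2) g)" .
  qed
  also have "\<dots> = ennreal (sqrt 2)"
    by (subst nn_integral_eq_integral) auto
  also have "\<dots> \<le> ennreal (3 / 2)"
    by (intro ennreal_leI real_le_lsqrt) (auto simp: power2_eq_square)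
  finally show ?thesis by (simp add: X_def)
qed

section \<open>Exponential moments of products of sign sums\<close>

lemma exp_le_quadratic:
  fixes x :: real
  shows "exp x \<le> 1 + x + x\<^sup>2 * exp \<bar>x\<bar>"
proof -
  have 1: "exp x - 1 \<le> x * exp x"
    using mult_left_mono[OF exp_ge_add_one_self[of "- x"], of "exp x"] by (simp add: exp_minus algebra_simps)
  show ?thesis
  proof (cases "x \<ge> 0")
    case True
    then have "x * (exp x - 1) \<le> x * (x * exp x)" using 1 by (intro mult_left_mono) auto
    then show ?thesis using 1 True by (simp add: algebra_simps power2_eq_square)
  next
    case False
    moreover have "1 - exp x \<le> - x" using exp_ge_add_one_self[of x] by linarith
    ultimately have "(- x) * (1 - exp x) \<le> (- x) * (- x)" by (intro mult_left_mono) auto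
    moreover have "x\<^sup>2 * 1 \<le> x\<^sup>2 * exp \<bar>x\<bar>" by (intro mult_left_mono) auto
    ultimately show ?thesis using 1 by (simp add: algebra_simps power2_eq_square)
  qed
qed

text \<open>Put |w| = 8 s. Then (l w)^2 = 64 l^2 s^2, while s^2 <= 2 exp s and |l w| <= s, so the
  remainder is at most 128 l^2 exp (2 s). It is paid by the exponential moment at 1 / 4, which a
  product of two sign sums still has.\<close>

lemma exp_mult_le_quadratic:
  fixes l w :: real
  assumes "\<bar>l\<bar> \<le> 1 / 8"
  shows "exp (l * w) \<le> 1 + l * w + 128 * l\<^sup>2 * exp (\<bar>w\<bar> / 4)"
proof -
  define s where "s = \<bar>w\<bar> / 8"
  have s: "s \<ge> 0" "\<bar>w\<bar> = 8 * s" by (auto simp: s_def)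
  have "s\<^sup>2 \<le> 2 * exp s" using exp_lower_Taylor_quadratic[OF s(1)] s by linarith
  moreover have "\<bar>l * w\<bar> \<le> 1 / 8 * \<bar>w\<bar>" unfolding abs_mult by (intro mult_right_mono assms) auto
  then have "exp \<bar>l * w\<bar> \<le> exp s" by (simp add: s_def)
  ultimately have "s\<^sup>2 * exp \<bar>l * w\<bar> \<le> (2 * exp s) * exp s"
    by (intro mult_mono) auto
  also have "\<dots> = 2 * exp (\<bar>w\<bar> / 4)" by (simp add: s_def exp_add[symmetric])
  finally have "(64 * l\<^sup>2) * (s\<^sup>2 * exp \<bar>l * w\<bar>) \<le> (64 * l\<^sup>2) * (2 * exp (\<bar>w\<bar> / 4))"
    by (intro mult_left_mono) auto
  moreover have "(l * w)\<^sup>2 * exp \<bar>l * w\<bar> = (64 * l\<^sup>2) * (s\<^sup>2 * exp \<bar>l * w\<bar>)"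
    by (simp add: s_def power_divide power_mult_distrib)
  ultimately show ?thesis using exp_le_quadratic[of "l * w"] by linarith
qed

lemma abs_sum_mult_le_one:
  fixes x y :: "'i \<Rightarrow> real"
  assumes "(\<Sum>l\<in>I. (x l)\<^sup>2) = 1" "(\<Sum>l\<in>I. (y l)\<^sup>2) = 1"
  shows "\<bar>\<Sum>l\<in>I. x l * y l\<bar> \<le> 1"
proof -
  have *: "(\<Sum>l\<in>I. x l * z l) \<le> 1" if "(\<Sum>l\<in>I. (z l)\<^sup>2) = 1" for z
  proof -
    have "(\<Sum>l\<in>I. x l * z l) \<le> (\<Sum>l\<in>I. ((x l)\<^sup>2 + (z l)\<^sup>2) / 2)"
      by (intro sum_mono) (use sum_squares_bound in \<open>auto simp: field_simps\<close>)
    then show ?thesis using assms that by (simp add: sum_divide_distrib[symmetric] sum.distrib)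
  qed
  from *[of y] *[of "\<lambda>l. - y l"] assms show ?thesis by (simp add: sum_negf abs_le_iff)
qed


text \<open>Serves at three levels: the rows of a sign matrix, the bits of a hash, and the
  repetitions.\<close>

lemma (in prob_space) indep_vars_blocks:
  assumes ind: "indep_vars (\<lambda>_. N) X I"
    and K: "\<And>j. j \<in> J \<Longrightarrow> K j \<subseteq> I" "disjoint_family_on K J"
    and f: "\<And>j. j \<in> J \<Longrightarrow> f j \<in> measurable (PiM (K j) (\<lambda>_. N)) N'"
  shows "indep_vars (\<lambda>_. N') (\<lambda>j \<omega>. f j (\<lambda>i\<in>K j. X i \<omega>)) J"
  by (rule indep_vars_compose2[OF indep_vars_restrict[OF ind K], where Y=f]) (use f in auto)

lemma (in prob_space) rademacher_subset:
  "rademacher S I \<Longrightarrow> J \<subseteq> I \<Longrightarrow> rademacher S J"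
  by (auto simp: rademacher_def intro: indep_vars_subset finite_subset)

text \<open>The product of the two sums has mean equal to the inner product, because distinct signs
  are uncorrelated. The linear term of \<open>exp_mult_le_quadratic\<close> vanishes, and E exp (|W|
  / 4) <= 2 makes the rest 1 + 256 l^2.\<close>

lemma (in prob_space) rademacher_product_mgf:
  assumes S: "rademacher S I"
    and x: "(\<Sum>l\<in>I. (x l)\<^sup>2) = 1" and y: "(\<Sum>l\<in>I. (y l)\<^sup>2) = 1" and l: "\<bar>l\<bar> \<le> 1 / 8"
  shows "(\<integral>\<^sup>+\<omega>. exp (l * ((\<Sum>l\<in>I. S l \<omega> * x l) * (\<Sum>l\<in>I. S l \<omega> * y l) - (\<Sum>l\<in>I. x l * y l))) \<partial>M)
    \<le> exp (256 * l\<^sup>2)"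
proof -
  have fin: "finite I" and ind: "indep_vars (\<lambda>_. borel) S I" using S by (auto simp: rademacher_def)
  have AE: "AE \<omega> in M. S l \<omega> \<in> {-1, 1}" and E0: "expectation (S l) = 0" if "l \<in> I" for l
    using S that by (auto simp: rademacher_def)
  define X where "X z \<omega> = (\<Sum>l\<in>I. S l \<omega> * z l)" for z \<omega>
  define r where "r = (\<Sum>l\<in>I. x l * y l)"
  have [measurable]: "random_variable borel (X z)" for z
    unfolding X_def by (intro borel_measurable_sum borel_measurable_times rademacher_rv[OF S]) auto
  have Sint: "integrable M (S l)" if "l \<in> I" for l
    using AE[OF that] rademacher_rv[OF S that]
    by (intro integrable_const_bound[where B=1]) (auto elim!: eventually_mono)
  have SS: "integrable M (\<lambda>\<omega>. S l \<omega> * S l' \<omega>)"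
    "expectation (\<lambda>\<omega>. S l \<omega> * S l' \<omega>) = (if l = l' then 1 else 0)" if "l \<in> I" "l' \<in> I" for l l'
  proof -
    note [measurable] = rademacher_rv[OF S that(1)] rademacher_rv[OF S that(2)]
    show int: "integrable M (\<lambda>\<omega>. S l \<omega> * S l' \<omega>)"
      using AE[OF that(1)] AE[OF that(2)]
      by (intro integrable_const_bound[where B=1]) (auto elim!: eventually_elim2)
    show "expectation (\<lambda>\<omega>. S l \<omega> * S l' \<omega>) = (if l = l' then 1 else 0)"
    proof (cases "l = l'")
      case True
      have "expectation (\<lambda>\<omega>. S l \<omega> * S l' \<omega>) = expectation (\<lambda>_. 1)"
        using AE[OF that(1)] True by (intro integral_cong_AE) (auto elim!: eventually_mono)
      then show ?thesis using True by (simp add: prob_space)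
    next
      case False
      have "(\<integral>\<omega>. (\<Prod>i\<in>{l, l'}. S i \<omega>) \<partial>M) = (\<Prod>i\<in>{l, l'}. expectation (S i))"
        by (rule indep_vars_lebesgue_integral) (use that Sint in \<open>auto intro: indep_vars_subset[OF ind]\<close>)
      then show ?thesis using False E0 that by simp
    qed
  qed
  have XX: "X x \<omega> * X y \<omega> = (\<Sum>l\<in>I. \<Sum>l'\<in>I. (x l * y l') * (S l \<omega> * S l' \<omega>))" for \<omega>
    by (simp add: X_def sum_product mult_ac)
  have Wint: "integrable M (\<lambda>\<omega>. X x \<omega> * X y \<omega>)"
    unfolding XX by (intro Bochner_Integration.integrable_sum integrable_mult_right SS)
  have EW: "expectation (\<lambda>\<omega>. X x \<omega> * X y \<omega>) = r"
    using fin unfolding XX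
    by (simp add: Bochner_Integration.integral_sum SS r_def sum.delta' if_distrib cong: if_cong)
  have r: "\<bar>r\<bar> \<le> 1" unfolding r_def by (rule abs_sum_mult_le_one[OF x y])
  define W where "W \<omega> = X x \<omega> * X y \<omega> - r" for \<omega>
  have [measurable]: "random_variable borel W" unfolding W_def by measurable
  have exW: "(\<integral>\<^sup>+\<omega>. exp (\<bar>W \<omega>\<bar> / 4) \<partial>M) \<le> ennreal 2"
  proof -
    \<comment> \<open>Centring costs exp (1 / 4) <= 4 / 3, and the mixed term is at most half the
      sum of squares. Two terms of weight 2 / 3 with moments at most 3 / 2 then add up to 2.\<close>
    have "exp (\<bar>W \<omega>\<bar> / 4) \<le> 2 / 3 * exp ((X x \<omega>)\<^sup>2 / 4) + 2 / 3 * exp ((X y \<omega>)\<^sup>2 / 4)" for \<omega>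
    proof -
      define a b where "a = exp ((X x \<omega>)\<^sup>2 / 8)" and "b = exp ((X y \<omega>)\<^sup>2 / 8)"
      have "2 * (\<bar>X x \<omega>\<bar> * \<bar>X y \<omega>\<bar>) \<le> (X x \<omega>)\<^sup>2 + (X y \<omega>)\<^sup>2"
        using sum_squares_bound[of "\<bar>X x \<omega>\<bar>" "\<bar>X y \<omega>\<bar>"] by (simp add: mult.assoc)
      moreover have "\<bar>W \<omega>\<bar> \<le> \<bar>X x \<omega>\<bar> * \<bar>X y \<omega>\<bar> + 1"
        using r unfolding W_def abs_mult[symmetric] by linarith
      ultimately have "\<bar>W \<omega>\<bar> / 4 \<le> 1 / 4 + ((X x \<omega>)\<^sup>2 / 8 + (X y \<omega>)\<^sup>2 / 8)" by (simp add: field_simps)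
      then have "exp (\<bar>W \<omega>\<bar> / 4) \<le> exp (1 / 4) * (a * b)"
        unfolding a_def b_def exp_add[symmetric] by simp
      also have "\<dots> \<le> 4 / 3 * ((a\<^sup>2 + b\<^sup>2) / 2)"
      proof (intro mult_mono)
        have "3 / 4 \<le> exp (- (1 / 4) :: real)" using exp_ge_add_one_self[of "- (1/4) :: real"] by simp
        then show "exp (1 / 4) \<le> (4 / 3 :: real)" by (simp add: exp_minus field_simps)
        show "a * b \<le> (a\<^sup>2 + b\<^sup>2) / 2" using sum_squares_bound[of a b] by simp
      qed (auto simp: a_def b_def)
      also have "a\<^sup>2 = exp ((X x \<omega>)\<^sup>2 / 4)" by (simp add: a_def exp_double[symmetric])
      also have "b\<^sup>2 = exp ((X y \<omega>)\<^sup>2 / 4)" by (simp add: b_def exp_double[symmetric])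
      finally show ?thesis by (simp add: field_simps)
    qed
    then have "(\<integral>\<^sup>+\<omega>. exp (\<bar>W \<omega>\<bar> / 4) \<partial>M) \<le>
        (\<integral>\<^sup>+\<omega>. ennreal (2 / 3) * ennreal (exp ((X x \<omega>)\<^sup>2 / 4)) + ennreal (2 / 3) * ennreal (exp ((X y \<omega>)\<^sup>2 / 4)) \<partial>M)"
      by (intro nn_integral_mono) (simp add: ennreal_mult'[symmetric] ennreal_plus[symmetric] del: ennreal_plus)
    also have "\<dots> = ennreal (2 / 3) * (\<integral>\<^sup>+\<omega>. exp ((X x \<omega>)\<^sup>2 / 4) \<partial>M) + ennreal (2 / 3) * (\<integral>\<^sup>+\<omega>. exp ((X y \<omega>)\<^sup>2 / 4) \<partial>M)"
      by (subst nn_integral_add, simp, simp) (simp add: nn_integral_cmult)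
    also have "\<dots> \<le> ennreal (2 / 3) * ennreal (3 / 2) + ennreal (2 / 3) * ennreal (3 / 2)"
      unfolding X_def by (intro add_mono mult_left_mono rademacher_sum_exp_square[OF S] x y) auto
    also have "\<dots> = ennreal 2" by (simp add: ennreal_mult'[symmetric] ennreal_plus[symmetric] del: ennreal_plus)
    finally show ?thesis .
  qed
  have intE: "integrable M (\<lambda>\<omega>. exp (\<bar>W \<omega>\<bar> / 4))"
    by (rule integrableI_nonneg) (use exW in \<open>auto intro: le_less_trans\<close>)
  have EE: "expectation (\<lambda>\<omega>. exp (\<bar>W \<omega>\<bar> / 4)) \<le> 2"
  proof -
    have "ennreal (expectation (\<lambda>\<omega>. exp (\<bar>W \<omega>\<bar> / 4))) \<le> ennreal 2"
      using exW nn_integral_eq_integral[OF intE] by (simp del: ennreal_numeral)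
    then show ?thesis by (subst (asm) ennreal_le_iff) auto
  qed
  have Wi: "integrable M W" unfolding W_def using Wint by auto
  have "(\<integral>\<^sup>+\<omega>. exp (l * W \<omega>) \<partial>M) \<le> (\<integral>\<^sup>+\<omega>. ennreal (1 + l * W \<omega> + 128 * l\<^sup>2 * exp (\<bar>W \<omega>\<bar> / 4)) \<partial>M)"
    by (intro nn_integral_mono ennreal_leI exp_mult_le_quadratic[OF l])
  also have "\<dots> = ennreal (expectation (\<lambda>\<omega>. 1 + l * W \<omega> + 128 * l\<^sup>2 * exp (\<bar>W \<omega>\<bar> / 4)))"
  proof (rule nn_integral_eq_integral)
    show "integrable M (\<lambda>\<omega>. 1 + l * W \<omega> + 128 * l\<^sup>2 * exp (\<bar>W \<omega>\<bar> / 4))"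
      using intE Wi by auto
    show "AE \<omega> in M. 0 \<le> 1 + l * W \<omega> + 128 * l\<^sup>2 * exp (\<bar>W \<omega>\<bar> / 4)"
      using exp_mult_le_quadratic[OF l] by (auto intro: order_trans[OF exp_ge_zero])
  qed
  also have "expectation (\<lambda>\<omega>. 1 + l * W \<omega> + 128 * l\<^sup>2 * exp (\<bar>W \<omega>\<bar> / 4)) =
      1 + l * expectation W + 128 * l\<^sup>2 * expectation (\<lambda>\<omega>. exp (\<bar>W \<omega>\<bar> / 4))"
    using intE Wi by (simp add: prob_space)
  also have "expectation W = 0" unfolding W_def using Wint EW by (simp add: prob_space)
  also have "1 + l * 0 + 128 * l\<^sup>2 * expectation (\<lambda>\<omega>. exp (\<bar>W \<omega>\<bar> / 4)) \<le> 1 + 256 * l\<^sup>2"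
    using mult_left_mono[OF EE, of "128 * l\<^sup>2"] by simp
  also have "\<dots> \<le> exp (256 * l\<^sup>2)" by (rule exp_ge_add_one_self)
  finally show ?thesis by (simp add: W_def X_def r_def ennreal_leI)
qed


text \<open>The rows \<open>K j\<close> are disjoint index blocks, so the exponential of the sum
  factors over independent rows.\<close>

lemma (in prob_space) rademacher_rows_mgf:
  fixes l :: real
  assumes S: "rademacher S I" and J: "finite J"
    and K: "\<And>j. j \<in> J \<Longrightarrow> K j \<subseteq> I" "disjoint_family_on K J"
    and x: "\<And>j. j \<in> J \<Longrightarrow> (\<Sum>i\<in>K j. (x i)\<^sup>2) = 1" and y: "\<And>j. j \<in> J \<Longrightarrow> (\<Sum>i\<in>K j. (y i)\<^sup>2) = 1"
    and r: "\<And>j. j \<in> J \<Longrightarrow> (\<Sum>i\<in>K j. x i * y i) = r" and l: "\<bar>l\<bar> \<le> 1 / 8"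
  shows "(\<integral>\<^sup>+\<omega>. exp (l * (\<Sum>j\<in>J. (\<Sum>i\<in>K j. S i \<omega> * x i) * (\<Sum>i\<in>K j. S i \<omega> * y i) - r)) \<partial>M)
    \<le> exp (256 * card J * l\<^sup>2)"
proof -
  have ind: "indep_vars (\<lambda>_. borel) S I" using S by (auto simp: rademacher_def)
  define f where "f j z = ennreal (exp (l * ((\<Sum>i\<in>K j. z i * x i) * (\<Sum>i\<in>K j. z i * y i) - r)))" for j z
  have f: "f j \<in> borel_measurable (PiM (K j) (\<lambda>_. borel))" for j
    unfolding f_def by measurable
  have fS: "f j (\<lambda>i\<in>K j. S i \<omega>) = ennreal (exp (l * ((\<Sum>i\<in>K j. S i \<omega> * x i) * (\<Sum>i\<in>K j. S i \<omega> * y i) - r)))" for j \<omega>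
    by (simp add: f_def cong: sum.cong)
  have "(\<integral>\<^sup>+\<omega>. exp (l * (\<Sum>j\<in>J. (\<Sum>i\<in>K j. S i \<omega> * x i) * (\<Sum>i\<in>K j. S i \<omega> * y i) - r)) \<partial>M) =
      (\<integral>\<^sup>+\<omega>. (\<Prod>j\<in>J. f j (\<lambda>i\<in>K j. S i \<omega>)) \<partial>M)"
    unfolding fS using J by (simp add: sum_distrib_left exp_sum prod_ennreal)
  also have "\<dots> = (\<Prod>j\<in>J. \<integral>\<^sup>+\<omega>. f j (\<lambda>i\<in>K j. S i \<omega>) \<partial>M)"
    by (rule indep_vars_nn_integral[OF J]) (rule indep_vars_blocks[OF ind K f], auto)
  also have "\<dots> \<le> (\<Prod>j\<in>J. ennreal (exp (256 * l\<^sup>2)))"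
  proof (rule prod_mono_ennreal)
    fix j assume j: "j \<in> J"
    show "(\<integral>\<^sup>+\<omega>. f j (\<lambda>i\<in>K j. S i \<omega>) \<partial>M) \<le> ennreal (exp (256 * l\<^sup>2))"
      unfolding fS using rademacher_product_mgf[OF rademacher_subset[OF S K(1)[OF j]] x[OF j] y[OF j] l] r[OF j]
      by simp
  qed
  also have "\<dots> = exp (256 * card J * l\<^sup>2)"
    by (simp add: ennreal_power exp_of_nat_mult[symmetric] mult_ac)
  finally show ?thesis .
qed

text \<open>A tail expectation rather than a tail probability, since Markov's inequality is applied
  to an average of such terms later. Above the threshold, m Z <= exp (m Z) <= exp (2 m Z - m e),
  which trades the truncated error for an exponential moment.\<close>

lemma (in prob_space) rademacher_rows_excess:
  fixes e :: real
  assumes S: "rademacher S I" and J: "finite J" "J \<noteq> {}"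
    and K: "\<And>j. j \<in> J \<Longrightarrow> K j \<subseteq> I" "disjoint_family_on K J"
    and x: "\<And>j. j \<in> J \<Longrightarrow> (\<Sum>i\<in>K j. (x i)\<^sup>2) = 1" and y: "\<And>j. j \<in> J \<Longrightarrow> (\<Sum>i\<in>K j. (y i)\<^sup>2) = 1"
    and r: "\<And>j. j \<in> J \<Longrightarrow> (\<Sum>i\<in>K j. x i * y i) = r" and e: "0 < e" "e \<le> 1"
  defines "Z \<equiv> \<lambda>\<omega>. \<bar>(\<Sum>j\<in>J. (\<Sum>i\<in>K j. S i \<omega> * x i) * (\<Sum>i\<in>K j. S i \<omega> * y i)) / card J - r\<bar>"
  shows "(\<integral>\<^sup>+\<omega>. ennreal (if Z \<omega> > e then Z \<omega> else 0) \<partial>M) \<le> 4096 / (card J * e) * exp (- (card J * e\<^sup>2 / 4096))"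
proof -
  define D where "D = real (card J)"
  have D: "D > 0" using J by (simp add: D_def card_gt_0_iff)
  define T where "T \<omega> = (\<Sum>j\<in>J. (\<Sum>i\<in>K j. S i \<omega> * x i) * (\<Sum>i\<in>K j. S i \<omega> * y i) - r)" for \<omega>
  have rv: "random_variable borel (\<lambda>\<omega>. \<Sum>i\<in>K j. S i \<omega> * z i)" if "j \<in> J" for j z
  proof -
    have "random_variable borel (S i)" if "i \<in> K j" for i
      using rademacher_rv[OF S] K(1)[OF \<open>j \<in> J\<close>] that by blast
    then show ?thesis by (intro borel_measurable_sum borel_measurable_times) auto
  qed
  have [measurable]: "random_variable borel T"
    unfolding T_def
    by (rule borel_measurable_sum, rule borel_measurable_diff, rule borel_measurable_times) (simp_all add: rv)
  have Z: "Z \<omega> = \<bar>T \<omega>\<bar> / D" for \<omega>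
  proof -
    have "T \<omega> / D = (\<Sum>j\<in>J. (\<Sum>i\<in>K j. S i \<omega> * x i) * (\<Sum>i\<in>K j. S i \<omega> * y i)) / D - r"
      using D by (simp add: T_def sum_subtractf D_def field_simps)
    then have "Z \<omega> = \<bar>T \<omega> / D\<bar>" by (simp only: Z_def D_def)
    then show ?thesis using D by simp
  qed
  \<comment> \<open>Together with l = e / 1024 this gives 2 m Z = |l T|. The moment bound has
    exponent 256 D l^2 = D e^2 / 4096, half of the gain m e, so a factor exp (- D e^2 / 4096)
    survives.\<close>
  define m where "m = D * e / 2048"
  have m: "m > 0" using D e by (simp add: m_def)
  define l where "l = e / 1024"
  have l: "\<bar>l\<bar> \<le> 1 / 8" "\<bar>- l\<bar> \<le> 1 / 8" using e by (auto simp: l_def)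
  have lm: "2 * m * Z \<omega> = \<bar>l * T \<omega>\<bar>" for \<omega>
    using D e by (simp add: Z m_def l_def abs_mult)
  define A where "A = exp (- (m * e)) / m"
  have pt: "(if Z \<omega> > e then Z \<omega> else 0) \<le> A * exp (l * T \<omega>) + A * exp (- l * T \<omega>)" for \<omega>
  proof (cases "Z \<omega> > e")
    case True
    have "m * Z \<omega> \<le> exp (m * Z \<omega>)" using exp_ge_add_one_self[of "m * Z \<omega>"] by linarith
    then have "Z \<omega> \<le> exp (m * Z \<omega>) / m" using m by (simp add: field_simps)
    also have "\<dots> \<le> exp (2 * m * Z \<omega> - m * e) / m"
      using True m by (intro divide_right_mono) auto
    also have "\<dots> = A * exp \<bar>l * T \<omega>\<bar>" by (simp add: A_def exp_diff exp_minus lm divide_inverse)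
    also have "\<dots> \<le> A * (exp (l * T \<omega>) + exp (- l * T \<omega>))"
      using m by (intro mult_left_mono) (auto simp: A_def abs_if)
    finally show ?thesis using True by (simp add: distrib_left)
  next
    case False
    have "0 \<le> A * exp (l * T \<omega>) + A * exp (- l * T \<omega>)"
      using m unfolding A_def by (intro add_nonneg_nonneg mult_nonneg_nonneg divide_nonneg_pos) auto
    then show ?thesis using False by simp
  qed
  have A: "A \<ge> 0" using m by (simp add: A_def)
  have "(\<integral>\<^sup>+\<omega>. ennreal (if Z \<omega> > e then Z \<omega> else 0) \<partial>M) \<le>
      (\<integral>\<^sup>+\<omega>. ennreal A * ennreal (exp (l * T \<omega>)) + ennreal A * ennreal (exp (- l * T \<omega>)) \<partial>M)"
  proof (rule nn_integral_mono)
    fix \<omega>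
    have "ennreal (if Z \<omega> > e then Z \<omega> else 0) \<le> ennreal (A * exp (l * T \<omega>) + A * exp (- l * T \<omega>))"
      by (rule ennreal_leI) (rule pt)
    also have "\<dots> = ennreal A * ennreal (exp (l * T \<omega>)) + ennreal A * ennreal (exp (- l * T \<omega>))"
      using A by (subst ennreal_plus) (auto simp: ennreal_mult')
    finally show "ennreal (if Z \<omega> > e then Z \<omega> else 0) \<le> \<dots>" .
  qed
  also have "\<dots> = ennreal A * (\<integral>\<^sup>+\<omega>. exp (l * T \<omega>) \<partial>M) + ennreal A * (\<integral>\<^sup>+\<omega>. exp (- l * T \<omega>) \<partial>M)"
    by (subst nn_integral_add, simp, simp, subst (1 2) nn_integral_cmult) auto
  also have "\<dots> \<le> ennreal A * ennreal (exp (256 * D * l\<^sup>2)) + ennreal A * ennreal (exp (256 * D * (- l)\<^sup>2))"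
    using rademacher_rows_mgf[OF S J(1) K x y r l(1)] rademacher_rows_mgf[OF S J(1) K x y r l(2)]
    unfolding T_def D_def by (intro add_mono mult_left_mono) auto
  also have "\<dots> = ennreal (2 * A * exp (256 * D * l\<^sup>2))"
    using A by (simp add: ennreal_mult'[symmetric] ennreal_plus[symmetric] del: ennreal_plus)
  also have "2 * A * exp (256 * D * l\<^sup>2) = 4096 / (D * e) * exp (- (D * e\<^sup>2 / 4096))"
  proof -
    have "exp (- (m * e)) * exp (256 * D * l\<^sup>2) = exp (- (D * e\<^sup>2 / 4096))"
      by (simp add: exp_add[symmetric] m_def l_def power2_eq_square)
    then have "2 * A * exp (256 * D * l\<^sup>2) = 2 / m * exp (- (D * e\<^sup>2 / 4096))" by (simp add: A_def)
    also have "2 / m = 4096 / (D * e)" by (simp add: m_def)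
    finally show ?thesis .
  qed
  finally show ?thesis by (simp only: D_def)
qed

section \<open>Inner products of encodings\<close>

lemma nth_concat_blocks:
  assumes "\<And>xs. xs \<in> set xss \<Longrightarrow> length xs = n" "i < length xss" "j < n"
  shows "concat xss ! (i * n + j) = xss ! i ! j"
  using assms
proof (induction xss arbitrary: i)
  case (Cons xs xss)
  show ?case
  proof (cases i)
    case (Suc i')
    have "concat (xs # xss) ! (i * n + j) = concat xss ! (i' * n + j)"
      using Cons.prems(1)[of xs] Suc by (simp add: nth_append)
    then show ?thesis using Cons Suc by simp
  qed (use Cons.prems in \<open>simp add: nth_append\<close>)
qed simp

lemma sum_lessThan_mult:
  fixes f :: "nat \<Rightarrow> 'a :: comm_monoid_add"
  shows "sum f {..<a * b} = (\<Sum>i<a. \<Sum>j<b. f (i * b + j))"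
proof -
  have "sum f {i * b..<i * b + b} = (\<Sum>j<b. f (i * b + j))" for i
    using sum.shift_bounds_nat_ivl[of f 0 "i * b" b] by (simp add: atLeast0LessThan add.commute)
  then show ?thesis by (simp add: sum.nat_group[symmetric])
qed

section \<open>Positions of clusters and coordinates in an encoding\<close>

text \<open>The first bit has weight 1 because it varies fastest in \<open>clusters k\<close>; the
  code is the position of the bit string there. The program builds the same number from the bits of
  a hash, one after the other.\<close>

primrec bits_code :: "bool list \<Rightarrow> nat" where
  "bits_code [] = 0"
| "bits_code (b # bs) = of_bool b + 2 * bits_code bs"

lemma bits_code_less: "bits_code bs < 2 ^ length bs"
  by (induction bs) auto

lemma bits_code_append: "bits_code (xs @ [b]) = bits_code xs + 2 ^ length xs * of_bool b"
  by (induction xs) auto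

lemma length_clusters: "length (clusters k) = 2 ^ k"
  by (simp add: clusters_def length_n_lists numeral_2_eq_2)

lemma set_clusters: "set (clusters k) = {b. length b = k}"
  by (auto simp: clusters_def set_n_lists)

lemma distinct_clusters: "distinct (clusters k)"
  unfolding clusters_def by (rule distinct_n_lists) simp

lemma clusters_nth_code:
  assumes "length b = k"
  shows "clusters k ! bits_code b = b"
  using assms
proof (induction b arbitrary: k)
  case (Cons b bs)
  define n where "n = length bs"
  have k: "k = Suc n" using Cons.prems by (simp add: n_def)
  define xss where "xss = map (\<lambda>ys. map (\<lambda>y. y # ys) [False, True]) (clusters n)"
  have "clusters k = concat xss"
    by (simp add: k clusters_def xss_def)
  moreover have "concat xss ! (bits_code bs * 2 + of_bool b) = xss ! bits_code bs ! of_bool b"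
    by (rule nth_concat_blocks)
      (use bits_code_less[of bs] in \<open>auto simp: xss_def length_clusters n_def\<close>)
  moreover have "xss ! bits_code bs ! of_bool b = b # bs"
    using Cons.IH[of n] bits_code_less[of bs] by (cases b) (auto simp: xss_def length_clusters n_def)
  ultimately show ?case by (simp add: mult.commute add.commute)
qed (simp add: clusters_def)

lemma bits_code_bij: "bij_betw bits_code {b. length b = k} {..<2 ^ k}"
proof -
  have inj: "inj_on bits_code {b. length b = k}"
    by (rule inj_on_inverseI[of _ "\<lambda>c. clusters k ! c"]) (simp add: clusters_nth_code)
  have sub: "bits_code ` {b. length b = k} \<subseteq> {..<2 ^ k}"
    using bits_code_less by auto
  have "card {b :: bool list. length b = k} = 2 ^ k"
    using distinct_card[OF distinct_clusters, of k] by (simp add: set_clusters length_clusters)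
  then have "bits_code ` {b. length b = k} = {..<2 ^ k}"
    using sub by (intro card_subset_eq) (auto simp: card_image[OF inj])
  then show ?thesis using inj by (simp add: bij_betw_def)
qed

lemma fde_concat_nth:
  assumes "r < R" "length b = k" "i < dp"
  shows "fde_concat d k dp R \<omega> blk $ ((r * 2 ^ k + bits_code b) * dp + i) = (proj_mat d dp \<omega> r *\<^sub>v blk r b) $ i"
proof -
  define f where "f = (\<lambda>r b. list_of_vec (proj_mat d dp \<omega> r *\<^sub>v blk r b))"
  have len: "length (f r b) = dp" for r b by (simp add: f_def proj_mat_def)
  define xss where "xss = map (\<lambda>r. map (f r) (clusters k)) [0..<R]"
  have c: "bits_code b < 2 ^ k" using bits_code_less[of b] assms by simp
  have l: "length (concat xss) = R * 2 ^ k"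
    by (simp add: xss_def length_concat length_clusters comp_def sum_list_triv)
  have "r * 2 ^ k + bits_code b < R * 2 ^ k"
  proof -
    have "Suc r * 2 ^ k \<le> R * 2 ^ k" using assms(1) by (intro mult_right_mono) auto
    then show ?thesis using c by simp
  qed
  then have "concat (concat xss) ! ((r * 2 ^ k + bits_code b) * dp + i) = concat xss ! (r * 2 ^ k + bits_code b) ! i"
    using assms l by (intro nth_concat_blocks) (auto simp: xss_def len)
  also have "concat xss ! (r * 2 ^ k + bits_code b) = xss ! r ! bits_code b"
    using assms c by (intro nth_concat_blocks) (auto simp: xss_def length_clusters)
  also have "\<dots> = f r b"
    using assms c by (simp add: xss_def length_clusters clusters_nth_code)
  finally have "concat (concat xss) ! ((r * 2 ^ k + bits_code b) * dp + i) = f r b ! i" .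
  moreover have "fde_concat d k dp R \<omega> blk = vec_of_list (concat (concat xss))"
    by (simp add: fde_concat_def f_def xss_def)
  ultimately show ?thesis using assms
    by (simp add: vec_of_list_index f_def list_of_vec_index)
qed

lemma length_simhash [simp]: "length (simhash d k \<omega> r x) = k"
  by (simp add: simhash_def)

lemma dim_proj_mat [simp]: "dim_row (proj_mat d dp \<omega> r) = dp" "dim_col (proj_mat d dp \<omega> r) = d"
  by (auto simp: proj_mat_def)

lemma vec_sum_closed: "A \<subseteq> carrier_vec d \<Longrightarrow> vec_sum d A \<in> carrier_vec d"
  using finsum_vec_closed[of "\<lambda>x. x" A d] by auto

lemma vec_sum_index:
  assumes "finite A" "A \<subseteq> carrier_vec d" "l < d"
  shows "vec_sum d A $ l = (\<Sum>q\<in>A. q $ l)"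
  using assms index_finsum_vec[of A l d "\<lambda>x. x"] by auto

lemma mult_mat_vec_vec_sum:
  assumes "finite A" "A \<subseteq> carrier_vec d" "dim_col M = d" "i < dim_row M"
  shows "(M *\<^sub>v vec_sum d A) $ i = (\<Sum>q\<in>A. (M *\<^sub>v q) $ i)"
proof -
  have "vec_sum d A \<in> carrier_vec d"
    using assms(2) by (rule vec_sum_closed)
  then have "(M *\<^sub>v vec_sum d A) $ i = (\<Sum>l<d. M $$ (i, l) * (\<Sum>q\<in>A. q $ l))"
    using assms by (auto simp: scalar_prod_def vec_sum_index atLeast0LessThan intro!: sum.cong)
  also have "\<dots> = (\<Sum>q\<in>A. \<Sum>l<d. M $$ (i, l) * q $ l)"
    by (simp add: sum_distrib_left sum.swap[of _ A])
  also have "\<dots> = (\<Sum>q\<in>A. (M *\<^sub>v q) $ i)"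
    using assms by (intro sum.cong) (auto simp: scalar_prod_def atLeast0LessThan)
  finally show ?thesis .
qed

text \<open>The sum over all 2^k clusters collapses: projections are linear and every query vector
  belongs to one cluster per repetition. This is what spares the program the query encoding; v is
  arbitrary, so that its coordinates can be read directly as stored.\<close>

lemma fde_query_scalar_prod:
  assumes Q: "finite Q" "Q \<subseteq> carrier_vec d" and v: "dim_vec v = fde_dim k dp R"
  shows "fde_query d k dp R \<omega> Q \<bullet> v = (\<Sum>r<R. \<Sum>q\<in>Q. \<Sum>i<dp.
    (proj_mat d dp \<omega> r *\<^sub>v q) $ i * v $ ((r * 2 ^ k + bits_code (simhash d k \<omega> r q)) * dp + i))"
proof -
  let ?F = "fde_query d k dp R \<omega> Q"
  let ?A = "\<lambda>r. proj_mat d dp \<omega> r"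
  let ?h = "\<lambda>r q. simhash d k \<omega> r q"
  let ?L = "{b :: bool list. length b = k}"
  have finL: "finite ?L" using finite_set[of "clusters k"] by (simp add: set_clusters)
  have comp: "(\<Sum>i<dp. ?F $ ((r * 2 ^ k + bits_code b) * dp + i) * v $ ((r * 2 ^ k + bits_code b) * dp + i)) =
      (\<Sum>q\<in>{q\<in>Q. ?h r q = b}. \<Sum>i<dp. (?A r *\<^sub>v q) $ i * v $ ((r * 2 ^ k + bits_code (?h r q)) * dp + i))"
    if "r < R" "length b = k" for r b
  proof -
    have "?F $ ((r * 2 ^ k + bits_code b) * dp + i) = (\<Sum>q\<in>{q\<in>Q. ?h r q = b}. (?A r *\<^sub>v q) $ i)" if "i < dp" for i
      unfolding fde_query_def fde_concat_nth[OF \<open>r < R\<close> \<open>length b = k\<close> that] query_block_def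
      by (rule mult_mat_vec_vec_sum) (use Q that in auto)
    then show ?thesis
      by (simp add: sum_distrib_right sum.swap[of _ "{..<dp}"])
  qed
  have "?F \<bullet> v = (\<Sum>t<R * 2 ^ k * dp. ?F $ t * v $ t)"
    using v by (simp add: scalar_prod_def atLeast0LessThan fde_dim_def mult_ac)
  also have "\<dots> = (\<Sum>r<R. \<Sum>c<2 ^ k. \<Sum>i<dp. ?F $ ((r * 2 ^ k + c) * dp + i) * v $ ((r * 2 ^ k + c) * dp + i))"
    by (simp only: sum_lessThan_mult)
  also have "\<dots> = (\<Sum>r<R. \<Sum>b\<in>?L. \<Sum>i<dp. ?F $ ((r * 2 ^ k + bits_code b) * dp + i) * v $ ((r * 2 ^ k + bits_code b) * dp + i))"
    by (intro sum.cong refl sum.reindex_bij_betw[OF bits_code_bij, symmetric])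
  also have "\<dots> = (\<Sum>r<R. \<Sum>b\<in>?L. \<Sum>q\<in>{q\<in>Q. ?h r q = b}. \<Sum>i<dp.
      (?A r *\<^sub>v q) $ i * v $ ((r * 2 ^ k + bits_code (?h r q)) * dp + i))"
    by (intro sum.cong refl comp) auto
  also have "\<dots> = (\<Sum>r<R. \<Sum>q\<in>Q. \<Sum>i<dp.
      (?A r *\<^sub>v q) $ i * v $ ((r * 2 ^ k + bits_code (?h r q)) * dp + i))"
    by (intro sum.cong refl sum.group finL Q) auto
  finally show ?thesis .
qed

lemma fde_query_scalar_prod_doc:
  assumes Q: "finite Q" "Q \<subseteq> carrier_vec d"
  shows "fde_query d k dp R \<omega> Q \<bullet> fde_concat d k dp R \<omega> blk = (\<Sum>r<R. \<Sum>q\<in>Q.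
    (proj_mat d dp \<omega> r *\<^sub>v q) \<bullet> (proj_mat d dp \<omega> r *\<^sub>v blk r (simhash d k \<omega> r q)))"
  unfolding fde_query_scalar_prod[OF Q dim_fde_concat]
  by (intro sum.cong refl) (auto simp: scalar_prod_def[of _ "_ *\<^sub>v _"] fde_concat_nth atLeast0LessThan intro!: sum.cong)

section \<open>The query program\<close>

text \<open>Total correctness with an upper bound on the steps instead of the exact number, so that
  branches of different cost can be joined.\<close>

definition runs :: "prog \<Rightarrow> ram \<Rightarrow> nat \<Rightarrow> (ram \<Rightarrow> bool) \<Rightarrow> bool" where
  "runs c s T \<Phi> \<longleftrightarrow> (\<exists>t s'. exec c s t s' \<and> t \<le> T \<and> \<Phi> s')"

lemma runs_mono: "runs c s T \<Phi> \<Longrightarrow> T \<le> T' \<Longrightarrow> (\<And>s'. \<Phi> s' \<Longrightarrow> \<Psi> s') \<Longrightarrow> runs c s T' \<Psi>"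
  unfolding runs_def by (meson order_trans)

lemma runs_Seq:
  assumes "runs c1 s T1 \<Phi>" "\<And>s'. \<Phi> s' \<Longrightarrow> runs c2 s' T2 \<Psi>"
  shows "runs (Seq c1 c2) s (T1 + T2) \<Psi>"
  using assms unfolding runs_def by (meson add_mono exec.Seq)

lemma runs_Skip: "\<Phi> s \<Longrightarrow> 1 \<le> T \<Longrightarrow> runs Skip s T \<Phi>"
  unfolding runs_def using exec.Skip by blast

lemma runs_NSet:
  "\<Phi> (s\<lparr>nreg := (nreg s)(x := nval a s)\<rparr>) \<Longrightarrow> ncost a + 1 \<le> T \<Longrightarrow> runs (NSet x a) s T \<Phi>"
  unfolding runs_def using exec.NSet by blast

lemma runs_RSet:
  "\<Phi> (s\<lparr>rmem := (rmem s)(x := (rmem s x)(nval a s := rval e s))\<rparr>) \<Longrightarrow>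
    ncost a + rcost e + 1 \<le> T \<Longrightarrow> runs (RSet x a e) s T \<Phi>"
  unfolding runs_def using exec.RSet by blast

lemma runs_If:
  assumes "tval b s \<Longrightarrow> runs c1 s T \<Phi>" "\<not> tval b s \<Longrightarrow> runs c2 s T \<Phi>"
  shows "runs (If b c1 c2) s (tcost b + T) \<Phi>"
  using assms unfolding runs_def
  by (cases "tval b s") (meson add_left_mono exec.IfTrue, meson add_left_mono exec.IfFalse)

definition For :: "string \<Rightarrow> string \<Rightarrow> prog \<Rightarrow> prog" where
  "For x N c = Seq (NSet x (NConst 0))
     (While (NLess (NReg x) (NReg N)) (Seq c (NSet x (NAdd (NReg x) (NConst 1)))))"

text \<open>Per round, 7 steps pay for the test (3) and the increment (4); the final 5 pay for the
  initialization (2) and the failing test (3). The invariant is required of the state after the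
  increment, and the body has to preserve its counter.\<close>

lemma runs_For:
  assumes init: "I 0 (s\<lparr>nreg := (nreg s)(x := 0)\<rparr>)"
    and bound: "\<And>a s. I a s \<Longrightarrow> nreg s N = M"
    and step: "\<And>a s. a < M \<Longrightarrow> I a s \<Longrightarrow> nreg s x = a \<Longrightarrow>
      runs c s T (\<lambda>s'. nreg s' x = a \<and> I (Suc a) (s'\<lparr>nreg := (nreg s')(x := Suc a)\<rparr>))"
  shows "runs (For x N c) s (M * (T + 7) + 5) (\<lambda>s'. I M s' \<and> nreg s' x = M)"
proof -
  let ?b = "NLess (NReg x) (NReg N)"
  let ?c = "Seq c (NSet x (NAdd (NReg x) (NConst 1)))"
  have while: "runs (While ?b ?c) s ((M - a) * (T + 7) + 3) (\<lambda>s'. I M s' \<and> nreg s' x = M)"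
    if "I a s" "nreg s x = a" "a \<le> M" for a s
    using that
  proof (induction "M - a" arbitrary: a s)
    case 0
    then have b: "\<not> tval ?b s" and a: "a = M" using bound[OF \<open>I a s\<close>] by auto
    show ?case unfolding runs_def using exec.WhileFalse[OF b, of ?c] 0 a
      by (intro exI[of _ "tcost ?b"] exI[of _ s]) auto
  next
    case (Suc m)
    then have a: "a < M" by linarith
    have t: "tval ?b s" using Suc bound[OF \<open>I a s\<close>] a by auto
    have "runs ?c s (T + 4) (\<lambda>s'. I (Suc a) s' \<and> nreg s' x = Suc a)"
    proof (rule runs_Seq[OF step[OF a]])
      show "runs (NSet x (NAdd (NReg x) (NConst 1))) s' 4 (\<lambda>s'. I (Suc a) s' \<and> nreg s' x = Suc a)"
        if "nreg s' x = a \<and> I (Suc a) (s'\<lparr>nreg := (nreg s')(x := Suc a)\<rparr>)" for s'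
        using that by (intro runs_NSet) auto
    qed (use Suc in auto)
    then obtain t1 s1 where 1: "exec ?c s t1 s1" "t1 \<le> T + 4" "I (Suc a) s1" "nreg s1 x = Suc a"
      unfolding runs_def by auto
    have "runs (While ?b ?c) s1 ((M - Suc a) * (T + 7) + 3) (\<lambda>s'. I M s' \<and> nreg s' x = M)"
      using Suc 1 a by (intro Suc(1)) auto
    then obtain t2 s2 where 2: "exec (While ?b ?c) s1 t2 s2" "t2 \<le> (M - Suc a) * (T + 7) + 3"
        "I M s2" "nreg s2 x = M"
      unfolding runs_def by auto
    have "M - a = Suc (M - Suc a)" using a by simp
    then have "tcost ?b + t1 + t2 \<le> (M - a) * (T + 7) + 3" using 1 2 by simp
    then show ?case unfolding runs_def using exec.WhileTrue[OF t 1(1) 2(1)] 2 by blast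
  qed
  have "runs (For x N c) s (2 + ((M - 0) * (T + 7) + 3)) (\<lambda>s'. I M s' \<and> nreg s' x = M)"
    unfolding For_def
  proof (rule runs_Seq)
    show "runs (NSet x (NConst 0)) s 2 (\<lambda>s'. I 0 s' \<and> nreg s' x = 0)"
      using init by (intro runs_NSet) auto
    show "runs (While ?b ?c) s' ((M - 0) * (T + 7) + 3) (\<lambda>s'. I M s' \<and> nreg s' x = M)"
      if "I 0 s' \<and> nreg s' x = 0" for s'
      using that by (intro while) auto
  qed
  then show ?thesis by (rule runs_mono) auto
qed

definition frame :: "string set \<Rightarrow> string set \<Rightarrow> ram \<Rightarrow> ram \<Rightarrow> bool" where
  "frame X Y s s' \<longleftrightarrow> (\<forall>x. x \<notin> X \<longrightarrow> nreg s' x = nreg s x) \<and> (\<forall>y. y \<notin> Y \<longrightarrow> rmem s' y = rmem s y)"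

lemma frame_refl: "frame X Y s s"
  by (simp add: frame_def)

lemma frame_trans: "frame X Y s s' \<Longrightarrow> frame X' Y' s' s'' \<Longrightarrow> X' \<subseteq> X \<Longrightarrow> Y' \<subseteq> Y \<Longrightarrow> frame X Y s s''"
  unfolding frame_def by (metis subsetD)

lemma frame_nreg: "frame X Y s s' \<Longrightarrow> x \<in> X \<Longrightarrow> frame X Y s (s'\<lparr>nreg := (nreg s')(x := v)\<rparr>)"
  by (auto simp: frame_def)

lemma frameD:
  "frame X Y s s' \<Longrightarrow> x \<notin> X \<Longrightarrow> nreg s' x = nreg s x"
  "frame X Y s s' \<Longrightarrow> y \<notin> Y \<Longrightarrow> rmem s' y = rmem s y"
  by (auto simp: frame_def)

definition Accumulate :: "string \<Rightarrow> string \<Rightarrow> string \<Rightarrow> nexp \<Rightarrow> rexp \<Rightarrow> prog" where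
  "Accumulate x N y ix e = For x N (RSet y ix (RAdd (RGet y ix) e))"

text \<open>The summand is evaluated in any state that agrees with s outside x and y, so it cannot
  depend on the array that collects the sum. An assignment costs at most 30 + 3 steps and the loop
  overhead is 7, hence 40 per term.\<close>

lemma runs_Accumulate:
  assumes xN: "x \<noteq> N" and M: "nreg s N = M"
    and e: "\<And>a s'. a < M \<Longrightarrow> frame {x} {y} s s' \<Longrightarrow> nreg s' x = a \<Longrightarrow> nval ix s' = i \<and> rval e s' = f a"
    and c: "2 * ncost ix + rcost e \<le> 30"
  shows "runs (Accumulate x N y ix e) s (40 * M + 5)
    (\<lambda>s'. frame {x} {y} s s' \<and> rmem s' y = (rmem s y)(i := rmem s y i + (\<Sum>a<M. f a)))"
proof -
  define I where "I a s' \<longleftrightarrow> frame {x} {y} s s' \<and> rmem s' y = (rmem s y)(i := rmem s y i + (\<Sum>a<a. f a))" for a s'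
  have "runs (Accumulate x N y ix e) s (M * (33 + 7) + 5) (\<lambda>s'. I M s' \<and> nreg s' x = M)"
    unfolding Accumulate_def
  proof (rule runs_For)
    show "I 0 (s\<lparr>nreg := (nreg s)(x := 0)\<rparr>)" by (simp add: I_def frame_def)
    show "nreg s' N = M" if "I a s'" for a s'
      using that xN M by (auto simp: I_def frame_def)
    fix a s' assume a: "a < M" "I a s'" "nreg s' x = a"
    then have v: "nval ix s' = i" "rval e s' = f a" using e[of a s'] by (auto simp: I_def)
    show "runs (RSet y ix (RAdd (RGet y ix) e)) s' 33
        (\<lambda>s'. nreg s' x = a \<and> I (Suc a) (s'\<lparr>nreg := (nreg s')(x := Suc a)\<rparr>))"
      using a v c by (intro runs_RSet) (auto simp: I_def frame_def)
  qed
  then show ?thesis by (rule runs_mono) (auto simp: I_def)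
qed

section \<open>The query program and its subroutines\<close>

abbreviation (input) row_entry :: "string \<Rightarrow> nexp \<Rightarrow> rexp" where
  "row_entry y a \<equiv> RGet y (NAdd (NMul a (NReg ''d'')) (NReg ''l''))"

text \<open>Reals live in arrays only, so cell 0 of \<open>acc\<close> plays the part of a real
  variable. Register \<open>w\<close> holds the weight 2^j of the current bit, and \<open>c\<close>
  collects the code of the cluster; doubling stands in for bit operations.\<close>

definition hash_step :: prog where
  "hash_step =
     Seq (RSet ''acc'' (NConst 0) RZero)
     (Seq (Accumulate ''l'' ''d'' ''acc'' (NConst 0)
        (RMul (row_entry ''G'' (NAdd (NMul (NReg ''r'') (NReg ''ksim'')) (NReg ''j''))) (row_entry ''Q'' (NReg ''a''))))
     (Seq (If (RLess RZero (RGet ''acc'' (NConst 0))) (NSet ''c'' (NAdd (NReg ''c'') (NReg ''w''))) Skip)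
       (NSet ''w'' (NAdd (NReg ''w'') (NReg ''w'')))))"

definition hash_prog :: prog where
  "hash_prog = Seq (NSet ''c'' (NConst 0)) (Seq (NSet ''w'' (NConst 1)) (For ''j'' ''ksim'' hash_step))"

definition proj_prog :: prog where
  "proj_prog = For ''t'' ''dproj''
     (Seq (RSet ''T'' (NReg ''t'') RZero)
       (Accumulate ''l'' ''d'' ''T'' (NReg ''t'')
        (RMul (row_entry ''A'' (NAdd (NMul (NReg ''r'') (NReg ''dproj'')) (NReg ''t''))) (row_entry ''Q'' (NReg ''a'')))))"

text \<open>Of each document only the block at position (r, c) is read, i.e. \<open>dproj\<close>
  entries, although the stored encoding has exponential length. The scores in \<open>S\<close>
  accumulate over repetitions and query vectors.\<close>

definition score_prog :: prog where
  "score_prog = For ''i'' ''n''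
     (Accumulate ''t'' ''dproj'' ''S'' (NReg ''i'')
       (RMul (RGet ''T'' (NReg ''t''))
         (RGet ''F'' (NAdd (NMul (NReg ''i'') (NReg ''fd''))
           (NAdd (NMul (NAdd (NMul (NReg ''r'') (NReg ''pw'')) (NReg ''c'')) (NReg ''dproj'')) (NReg ''t''))))))"

text \<open>The final increment translates array positions, which start at 0, into document indices,
  which start at 1.\<close>

definition argmax_prog :: prog where
  "argmax_prog = Seq (NSet ''best'' (NConst 0)) (Seq (For ''i'' ''n''
     (If (RLess (RGet ''S'' (NReg ''best'')) (RGet ''S'' (NReg ''i''))) (NSet ''best'' (NReg ''i'')) Skip))
     (NSet ''out'' (NAdd (NReg ''best'') (NConst 1))))"

text \<open>\<open>pw\<close> and \<open>fd\<close> hold 2^k and the length of an encoding. They are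
  only used as addresses, and k doublings suffice to compute them.\<close>

definition retrieval_prog :: prog where
  "retrieval_prog =
     Seq (Seq (NSet ''pw'' (NConst 1)) (For ''j'' ''ksim'' (NSet ''pw'' (NAdd (NReg ''pw'') (NReg ''pw'')))))
     (Seq (NSet ''fd'' (NMul (NMul (NReg ''pw'') (NReg ''dproj'')) (NReg ''R'')))
     (Seq (For ''i'' ''n'' (RSet ''S'' (NReg ''i'') RZero))
     (Seq (For ''r'' ''R'' (For ''a'' ''nq'' (Seq hash_prog (Seq proj_prog score_prog))))
       argmax_prog)))"

section \<open>Correctness and cost of the subroutines\<close>

lemma runs_hash_prog:
  assumes d: "nreg s ''d'' = d" "nreg s ''ksim'' = k" "d \<ge> 1"
    and Q: "\<And>l. l < d \<Longrightarrow> rmem s ''Q'' (nreg s ''a'' * d + l) = q l"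
    and G: "\<And>j l. j < k \<Longrightarrow> l < d \<Longrightarrow> rmem s ''G'' ((nreg s ''r'' * k + j) * d + l) = g j l"
  shows "runs hash_prog s (90 * k * d + 10)
    (\<lambda>s'. frame {''c'', ''w'', ''j'', ''l''} {''acc''} s s' \<and>
      nreg s' ''c'' = bits_code (map (\<lambda>j. (\<Sum>l<d. g j l * q l) > 0) [0..<k]))"
proof -
  let ?X = "{''c'', ''w'', ''j'', ''l''}" and ?Y = "{''acc''}"
  let ?f = "\<lambda>j. (\<Sum>l<d. g j l * q l) > 0"
  define I where "I j s' \<longleftrightarrow> frame ?X ?Y s s' \<and> nreg s' ''c'' = bits_code (map ?f [0..<j]) \<and> nreg s' ''w'' = 2 ^ j" for j s'
  have step: "runs hash_step s1 (3 + ((40 * d + 5) + ((4 + 4) + 4)))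
     (\<lambda>s'. nreg s' ''j'' = j \<and> I (Suc j) (s'\<lparr>nreg := (nreg s')(''j'' := Suc j)\<rparr>))"
    if j: "j < k" "I j s1" "nreg s1 ''j'' = j" for j s1
  proof -
    let ?P = "\<lambda>s2. frame {} ?Y s1 s2 \<and> rmem s2 ''acc'' 0 = 0"
    let ?D = "\<lambda>s2 s3. frame {''l''} {''acc''} s2 s3 \<and>
      rmem s3 ''acc'' = (rmem s2 ''acc'')(0 := rmem s2 ''acc'' 0 + (\<Sum>l<d. g j l * q l))"
    let ?R = "\<lambda>s4. frame ?X ?Y s s4 \<and> nreg s4 ''j'' = j \<and> nreg s4 ''w'' = 2 ^ j \<and>
      nreg s4 ''c'' = bits_code (map ?f [0..<Suc j])"
    show ?thesis
      unfolding hash_step_def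
    proof (rule runs_Seq[where \<Phi>="?P"], goal_cases)
      case 1
      show ?case by (rule runs_RSet) (auto simp: frame_def)
    next
      case (2 s2)
      then have f2: "frame ?X ?Y s s2" using j by (auto simp: I_def intro: frame_trans)
      show ?case
      proof (rule runs_Seq[where \<Phi>="?D s2"], goal_cases)
        case 1
        show ?case
        proof (rule runs_Accumulate, goal_cases)
          case (3 l s3)
          have "nreg s3 ''j'' = j" using 3 2 j by (simp add: frame_def)
          moreover have "frame ?X ?Y s s3" using f2 3(2) by (rule frame_trans) auto
          ultimately show ?case
            using d G[OF j(1) 3(1)] Q[OF 3(1)] 3 by (simp add: frame_def)
        qed (use f2 d in \<open>simp_all add: frame_def\<close>)
      next
        case (2 s3)
        then have acc: "rmem s3 ''acc'' 0 = (\<Sum>l<d. g j l * q l)" using \<open>?P s2\<close> by simp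
        have r3: "nreg s3 ''j'' = j" "nreg s3 ''w'' = 2 ^ j" "nreg s3 ''c'' = bits_code (map ?f [0..<j])"
          using 2 \<open>?P s2\<close> j by (auto simp: frame_def I_def)
        from 2 f2 have f3: "frame ?X ?Y s s3" by (auto intro: frame_trans)
        show ?case
        proof (rule runs_Seq[where \<Phi>="?R"], goal_cases)
          case 1
          let ?b = "RLess RZero (RGet ''acc'' (NConst 0))"
          have "runs (If ?b (NSet ''c'' (NAdd (NReg ''c'') (NReg ''w''))) Skip) s3 (tcost ?b + 4) ?R"
          proof (rule runs_If)
            assume "tval ?b s3"
            then have "?R (s3\<lparr>nreg := (nreg s3)(''c'' := nval (NAdd (NReg ''c'') (NReg ''w'')) s3)\<rparr>)"
              using acc r3 f3 by (auto simp: frame_def bits_code_append)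
            then show "runs (NSet ''c'' (NAdd (NReg ''c'') (NReg ''w''))) s3 4 ?R" by (rule runs_NSet) simp
          next
            assume "\<not> tval ?b s3"
            then have "?R s3" using acc r3 f3 by (auto simp: bits_code_append)
            then show "runs Skip s3 4 ?R" by (rule runs_Skip) simp
          qed
          then show ?case by simp
        next
          case (2 s4)
          then show ?case by (intro runs_NSet) (auto simp: I_def frame_def)
        qed
      qed
    qed
  qed
  have "runs hash_prog s (2 + (2 + (k * ((3 + ((40 * d + 5) + ((4 + 4) + 4))) + 7) + 5))) (\<lambda>s'. I k s' \<and> nreg s' ''j'' = k)"
    unfolding hash_prog_def
  proof (rule runs_Seq[where \<Phi>="\<lambda>s'. frame ?X ?Y s s' \<and> nreg s' ''c'' = 0"], goal_cases)
    case 1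
    show ?case by (rule runs_NSet) (auto simp: frame_def)
  next
    case (2 s1)
    show ?case
    proof (rule runs_Seq[where \<Phi>="I 0"], goal_cases)
      case 1
      show ?case by (rule runs_NSet) (use 2 in \<open>auto simp: I_def frame_def\<close>)
    next
      case (2 s2)
      show ?case
      proof (rule runs_For[where I=I], goal_cases)
        case 1
        show ?case using 2 by (auto simp: I_def frame_def)
      next
        case (2 a s')
        then show ?case using d by (auto simp: I_def frame_def)
      qed (rule step)
    qed
  qed
  then show ?thesis
  proof (rule runs_mono)
    \<comment> \<open>As d >= 1, the constant overhead of each bit is absorbed by the term linear in
      d.\<close>
    have "k * (40 * d + 27) \<le> k * (90 * d)" using d(3) by (intro mult_left_mono) auto
    moreover have "2 + (2 + (k * ((3 + ((40 * d + 5) + ((4 + 4) + 4))) + 7) + 5)) = k * (40 * d + 27) + 9"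
      by simp
    moreover have "90 * k * d = k * (90 * d)" by simp
    ultimately show "2 + (2 + (k * ((3 + ((40 * d + 5) + ((4 + 4) + 4))) + 7) + 5)) \<le> 90 * k * d + 10"
      by linarith
  qed (auto simp: I_def)
qed

lemma runs_proj_prog:
  assumes d: "nreg s ''d'' = d" "nreg s ''dproj'' = dp" "d \<ge> 1"
    and Q: "\<And>l. l < d \<Longrightarrow> rmem s ''Q'' (nreg s ''a'' * d + l) = q l"
    and A: "\<And>t l. t < dp \<Longrightarrow> l < d \<Longrightarrow> rmem s ''A'' ((nreg s ''r'' * dp + t) * d + l) = A t l"
  shows "runs proj_prog s (60 * dp * d + 5)
    (\<lambda>s'. frame {''t'', ''l''} {''T''} s s' \<and> (\<forall>t<dp. rmem s' ''T'' t = (\<Sum>l<d. A t l * q l)))"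
proof -
  let ?X = "{''t'', ''l''}" and ?Y = "{''T''}"
  define I where "I j s' \<longleftrightarrow> frame ?X ?Y s s' \<and> (\<forall>t<j. rmem s' ''T'' t = (\<Sum>l<d. A t l * q l))" for j s'
  have "runs proj_prog s (dp * ((3 + (40 * d + 5)) + 7) + 5) (\<lambda>s'. I dp s' \<and> nreg s' ''t'' = dp)"
    unfolding proj_prog_def
  proof (rule runs_For)
    show "I 0 (s\<lparr>nreg := (nreg s)(''t'' := 0)\<rparr>)" by (auto simp: I_def frame_def)
    show "nreg s' ''dproj'' = dp" if "I a s'" for a s' using that d by (auto simp: I_def frame_def)
    fix t s1 assume t: "t < dp" "I t s1" "nreg s1 ''t'' = t"
    let ?P = "\<lambda>s2. frame {} ?Y s1 s2 \<and> rmem s2 ''T'' = (rmem s1 ''T'')(t := 0)"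
    let ?D = "\<lambda>s2 s3. frame {''l''} {''T''} s2 s3 \<and>
      rmem s3 ''T'' = (rmem s2 ''T'')(t := rmem s2 ''T'' t + (\<Sum>l<d. A t l * q l))"
    show "runs (Seq (RSet ''T'' (NReg ''t'') RZero)
       (Accumulate ''l'' ''d'' ''T'' (NReg ''t'')
        (RMul (row_entry ''A'' (NAdd (NMul (NReg ''r'') (NReg ''dproj'')) (NReg ''t''))) (row_entry ''Q'' (NReg ''a'')))))
      s1 (3 + (40 * d + 5)) (\<lambda>s'. nreg s' ''t'' = t \<and> I (Suc t) (s'\<lparr>nreg := (nreg s')(''t'' := Suc t)\<rparr>))"
    proof (rule runs_Seq[where \<Phi>="?P"], goal_cases)
      case 1
      show ?case by (rule runs_RSet) (auto simp: frame_def t)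
    next
      case (2 s2)
      then have f2: "frame ?X ?Y s s2" using t by (auto simp: I_def intro: frame_trans)
      show ?case
      proof (rule runs_mono[where T="40 * d + 5" and \<Phi>="?D s2"], goal_cases)
        case 1
        show ?case
        proof (rule runs_Accumulate, goal_cases)
          case (3 l s3)
          have "nreg s3 ''t'' = t" using 3 2 t by (simp add: frame_def)
          moreover have "frame ?X ?Y s s3" using f2 3(2) by (rule frame_trans) auto
          ultimately show ?case using d A[OF t(1) 3(1)] Q[OF 3(1)] 3 by (simp add: frame_def)
        qed (use f2 d in \<open>simp_all add: frame_def\<close>)
      next
        case (3 s3)
        then have "frame ?X ?Y s s3" using f2 by (auto intro: frame_trans)
        moreover have "nreg s3 ''t'' = t" using 2 3 t by (simp add: frame_def)
        ultimately show ?case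
          using 3 2 t unfolding I_def by (auto intro!: frame_nreg simp: less_Suc_eq)
      qed simp
    qed
  qed
  then show ?thesis
  proof (rule runs_mono)
    have "dp * (40 * d + 15) \<le> dp * (60 * d)" using d(3) by (intro mult_left_mono) auto
    then show "dp * ((3 + (40 * d + 5)) + 7) + 5 \<le> 60 * dp * d + 5"
      by (simp add: mult_ac)
  qed (auto simp: I_def)
qed

lemma runs_score_prog:
  assumes n: "nreg s ''n'' = n" "nreg s ''dproj'' = dp" "dp \<ge> 1"
    and T: "\<And>t. t < dp \<Longrightarrow> rmem s ''T'' t = T t"
    and F: "\<And>i t. i < n \<Longrightarrow> t < dp \<Longrightarrow> rmem s ''F'' (i * nreg s ''fd'' +
        ((nreg s ''r'' * nreg s ''pw'' + nreg s ''c'') * dp + t)) = F i t"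
  shows "runs score_prog s (60 * n * dp + 5)
    (\<lambda>s'. frame {''i'', ''t''} {''S''} s s' \<and> (\<forall>i<n. rmem s' ''S'' i = rmem s ''S'' i + (\<Sum>t<dp. T t * F i t)))"
proof -
  let ?X = "{''i'', ''t''}" and ?Y = "{''S''}"
  define I where "I j s' \<longleftrightarrow> frame ?X ?Y s s' \<and>
    (\<forall>i<n. rmem s' ''S'' i = rmem s ''S'' i + (if i < j then \<Sum>t<dp. T t * F i t else 0))" for j s'
  let ?e = "RMul (RGet ''T'' (NReg ''t''))
         (RGet ''F'' (NAdd (NMul (NReg ''i'') (NReg ''fd''))
           (NAdd (NMul (NAdd (NMul (NReg ''r'') (NReg ''pw'')) (NReg ''c'')) (NReg ''dproj'')) (NReg ''t''))))"
  have "runs score_prog s (n * ((40 * dp + 5) + 7) + 5) (\<lambda>s'. I n s' \<and> nreg s' ''i'' = n)"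
    unfolding score_prog_def
  proof (rule runs_For)
    show "I 0 (s\<lparr>nreg := (nreg s)(''i'' := 0)\<rparr>)" by (auto simp: I_def frame_def)
    show "nreg s' ''n'' = n" if "I a s'" for a s' using that n by (auto simp: I_def frame_def)
    fix i s1 assume i: "i < n" "I i s1" "nreg s1 ''i'' = i"
    have f1: "frame ?X ?Y s s1" using i by (simp add: I_def)
    have "runs (Accumulate ''t'' ''dproj'' ''S'' (NReg ''i'') ?e)
        s1 (40 * dp + 5) (\<lambda>s3. frame {''t''} {''S''} s1 s3 \<and>
           rmem s3 ''S'' = (rmem s1 ''S'')(i := rmem s1 ''S'' i + (\<Sum>t<dp. T t * F i t)))"
    proof (rule runs_Accumulate)
      show "nreg s1 ''dproj'' = dp" using f1 n by (simp add: frame_def)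
      fix t s3 assume t: "t < dp" "frame {''t''} {''S''} s1 s3" "nreg s3 ''t'' = t"
      have "nreg s3 ''i'' = i" using t(2) i by (simp add: frame_def)
      moreover have "frame ?X ?Y s s3" using f1 t(2) by (rule frame_trans) auto
      ultimately show "nval (NReg ''i'') s3 = i \<and> rval ?e s3 = T t * F i t"
        using n F[OF i(1) t(1)] T[OF t(1)] t by (simp add: frame_def)
    qed auto
    then show "runs (Accumulate ''t'' ''dproj'' ''S'' (NReg ''i'') ?e) s1 (40 * dp + 5)
        (\<lambda>s'. nreg s' ''i'' = i \<and> I (Suc i) (s'\<lparr>nreg := (nreg s')(''i'' := Suc i)\<rparr>))"
    proof (rule runs_mono)
      fix s3 assume s3: "frame {''t''} {''S''} s1 s3 \<and>
           rmem s3 ''S'' = (rmem s1 ''S'')(i := rmem s1 ''S'' i + (\<Sum>t<dp. T t * F i t))"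
      then have "frame ?X ?Y s s3" using f1 by (auto intro: frame_trans)
      moreover have "nreg s3 ''i'' = i" using s3 i by (simp add: frame_def)
      ultimately show "nreg s3 ''i'' = i \<and> I (Suc i) (s3\<lparr>nreg := (nreg s3)(''i'' := Suc i)\<rparr>)"
        using s3 i unfolding I_def by (auto intro!: frame_nreg)
    qed simp
  qed
  then show ?thesis
  proof (rule runs_mono)
    have "n * (40 * dp + 12) \<le> n * (60 * dp)" using n(3) by (intro mult_left_mono) auto
    then show "n * ((40 * dp + 5) + 7) + 5 \<le> 60 * n * dp + 5"
      by (simp add: mult_ac)
  qed (auto simp: I_def)
qed

lemma runs_argmax_prog:
  assumes n: "nreg s ''n'' = n" "n \<ge> 1" and S: "\<And>i. i < n \<Longrightarrow> rmem s ''S'' i = S (Suc i)"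
  shows "runs argmax_prog s (20 * n + 20) (\<lambda>s'. is_arg_max S (\<lambda>i. i \<in> {1..n}) (nreg s' ''out''))"
proof -
  define I where "I j s' \<longleftrightarrow> frame {''best'', ''i''} {} s s' \<and> nreg s' ''best'' < n \<and>
    (\<forall>i<j. S (Suc i) \<le> S (Suc (nreg s' ''best'')))" for j s'
  let ?b = "RLess (RGet ''S'' (NReg ''best'')) (RGet ''S'' (NReg ''i''))"
  have "runs argmax_prog s (2 + ((n * ((5 + 2) + 7) + 5) + 4))
      (\<lambda>s'. is_arg_max S (\<lambda>i. i \<in> {1..n}) (nreg s' ''out''))"
    unfolding argmax_prog_def
  proof (rule runs_Seq[where \<Phi>="I 0"], goal_cases)
    case 1
    show ?case by (rule runs_NSet) (use n in \<open>auto simp: I_def frame_def\<close>)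
  next
    case (2 s1)
    show ?case
    proof (rule runs_Seq[where \<Phi>="\<lambda>s'. I n s' \<and> nreg s' ''i'' = n"], goal_cases)
      case 1
      show ?case
      proof (rule runs_For[where I=I], goal_cases)
        case 1
        show ?case using 2 by (auto simp: I_def frame_def)
      next
        case (2 i s')
        then show ?case using n by (auto simp: I_def frame_def)
      next
        case i: (3 i s2)
        have v: "rmem s2 ''S'' i = S (Suc i)" "rmem s2 ''S'' (nreg s2 ''best'') = S (Suc (nreg s2 ''best''))"
          using i S by (auto simp: I_def frame_def)
        let ?G = "\<lambda>s'. nreg s' ''i'' = i \<and> I (Suc i) (s'\<lparr>nreg := (nreg s')(''i'' := Suc i)\<rparr>)"
        have "runs (If ?b (NSet ''best'' (NReg ''i'')) Skip) s2 (tcost ?b + 2) ?G"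
        proof (rule runs_If)
          assume "tval ?b s2"
          then have less: "S (Suc (nreg s2 ''best'')) < S (Suc i)" using v i by simp
          have "S (Suc i') \<le> S (Suc i)" if "i' < Suc i" for i'
          proof (cases "i' = i")
            case False
            then have "S (Suc i') \<le> S (Suc (nreg s2 ''best''))" using that i by (simp add: I_def)
            then show ?thesis using less by linarith
          qed simp
          then show "runs (NSet ''best'' (NReg ''i'')) s2 2 ?G"
            using i by (intro runs_NSet) (auto simp: I_def frame_def)
        next
          assume "\<not> tval ?b s2"
          then show "runs Skip s2 2 ?G"
            using i v by (intro runs_Skip) (auto simp: I_def frame_def less_Suc_eq)
        qed
        moreover have "tcost ?b = 5" by simp
        ultimately show ?case by (simp only:)
      qed
    next
      case (2 s2)
      show ?case
      proof (rule runs_NSet)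
        have "S j \<le> S (Suc (nreg s2 ''best''))" if "j \<in> {1..n}" for j
          using 2 that by (cases j) (auto simp: I_def)
        then show "is_arg_max S (\<lambda>i. i \<in> {1..n}) (nreg (s2\<lparr>nreg := (nreg s2)
            (''out'' := nval (NAdd (NReg ''best'') (NConst 1)) s2)\<rparr>) ''out'')"
          using 2 by (auto simp: is_arg_max_def I_def not_less)
      qed simp
    qed
  qed
  then show ?thesis by (rule runs_mono) auto
qed

section \<open>Correctness and cost of the whole program\<close>

text \<open>What the vector q adds to the score of document i in repetition r; by
  \<open>fde_query_scalar_prod\<close> these terms add up to the inner product of the
  encodings.\<close>

definition query_term ::
    "nat \<Rightarrow> nat \<Rightarrow> nat \<Rightarrow> randomness \<Rightarrow> (nat \<Rightarrow> real vec) \<Rightarrow> real vec \<Rightarrow> nat \<Rightarrow> nat \<Rightarrow> real" where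
  "query_term d k dp \<omega> F q r i = (\<Sum>t<dp. (proj_mat d dp \<omega> r *\<^sub>v q) $ t *
     F i $ ((r * 2 ^ k + bits_code (simhash d k \<omega> r q)) * dp + t))"

lemma runs_retrieval_step:
  fixes F :: "nat \<Rightarrow> real vec"
  defines "X \<equiv> {''pw'', ''fd'', ''i'', ''r'', ''a'', ''c'', ''w'', ''j'', ''l'', ''t'', ''best'', ''out''}"
    and "Y \<equiv> {''acc'', ''T'', ''S''}"
  assumes inp: "query_input d k dp R \<omega> n F qs s0" and fr: "frame X Y s0 s"
    and pos: "d \<ge> 1" "dp \<ge> 1"
    and regs: "nreg s ''pw'' = 2 ^ k" "nreg s ''fd'' = fde_dim k dp R" "nreg s ''r'' = r" "nreg s ''a'' = a"
    and ra: "r < R" "a < length qs" and dim: "qs ! a \<in> carrier_vec d"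
  shows "runs (Seq hash_prog (Seq proj_prog score_prog)) s (90 * k * d + 10 + (60 * dp * d + 5 + (60 * n * dp + 5)))
    (\<lambda>s'. frame {''c'', ''w'', ''j'', ''l'', ''t'', ''i''} Y s s' \<and>
      (\<forall>i<n. rmem s' ''S'' i = rmem s ''S'' i + query_term d k dp \<omega> F (qs ! a) r (Suc i)))"
proof -
  let ?c = "bits_code (simhash d k \<omega> r (qs ! a))"
  let ?q = "proj_mat d dp \<omega> r *\<^sub>v (qs ! a)"
  let ?P1 = "\<lambda>s'. frame {''c'', ''w'', ''j'', ''l''} {''acc''} s s' \<and> nreg s' ''c'' = ?c"
  let ?P2 = "\<lambda>s1 s'. frame {''t'', ''l''} {''T''} s1 s' \<and> (\<forall>t<dp. rmem s' ''T'' t = ?q $ t)"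
  let ?P3 = "\<lambda>s2 s'. frame {''i'', ''t''} {''S''} s2 s' \<and>
    (\<forall>i<n. rmem s' ''S'' i = rmem s2 ''S'' i + query_term d k dp \<omega> F (qs ! a) r (Suc i))"
  have same: "nreg s x = nreg s0 x" if "x \<notin> X" for x using fr that by (rule frameD)
  have same': "rmem s x = rmem s0 x" if "x \<notin> Y" for x using fr that by (rule frameD)
  have in1: "nreg s ''d'' = d" "nreg s ''ksim'' = k" "nreg s ''dproj'' = dp" "nreg s ''n'' = n"
    using inp same[of "''d''"] same[of "''ksim''"] same[of "''dproj''"] same[of "''n''"]
    by (simp_all add: query_input_def X_def)
  have in2: "rmem s ''Q'' = rmem s0 ''Q''" "rmem s ''G'' = rmem s0 ''G''" "rmem s ''A'' = rmem s0 ''A''" "rmem s ''F'' = rmem s0 ''F''"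
    by (rule same'; simp add: Y_def)+
  have c: "?c < 2 ^ k" using bits_code_less[of "simhash d k \<omega> r (qs ! a)"] by simp
  have hash: "map (\<lambda>j. (\<Sum>l<d. gauss_vec d \<omega> r j $ l * (qs ! a) $ l) > 0) [0..<k] = simhash d k \<omega> r (qs ! a)"
    using dim by (auto simp: simhash_def scalar_prod_def atLeast0LessThan)
  have proj: "(\<Sum>l<d. proj_mat d dp \<omega> r $$ (t, l) * (qs ! a) $ l) = ?q $ t" if "t < dp" for t
    using dim that by (simp add: scalar_prod_def atLeast0LessThan)
  show ?thesis
  proof (rule runs_Seq[where \<Phi>="?P1"], goal_cases)
    case 1
    show ?case unfolding hash[symmetric]
      by (rule runs_hash_prog) (use in1 in2 regs pos inp ra in \<open>auto simp: query_input_def\<close>)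
  next
    case s1: (2 s1)
    show ?case
    proof (rule runs_Seq[where \<Phi>="?P2 s1"], goal_cases)
      case 1
      have "runs proj_prog s1 (60 * dp * d + 5) (\<lambda>s'. frame {''t'', ''l''} {''T''} s1 s' \<and>
          (\<forall>t<dp. rmem s' ''T'' t = (\<Sum>l<d. proj_mat d dp \<omega> r $$ (t, l) * (qs ! a) $ l)))"
        by (rule runs_proj_prog) (use s1 in1 in2 regs pos inp ra in \<open>auto simp: query_input_def frame_def\<close>)
      then show ?case by (simp add: proj)
    next
      case s2: (2 s2)
      have r2: "nreg s2 ''fd'' = fde_dim k dp R" "nreg s2 ''r'' = r" "nreg s2 ''pw'' = 2 ^ k" "nreg s2 ''c'' = ?c"
        "rmem s2 ''F'' = rmem s0 ''F''" "nreg s2 ''n'' = n" "nreg s2 ''dproj'' = dp"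
        using s1 s2 regs in1 in2 by (auto simp: frame_def)
      show ?case
      proof (rule runs_mono[where T="60 * n * dp + 5" and \<Phi>="?P3 s2"], goal_cases)
        case 1
        show ?case unfolding query_term_def
        proof (rule runs_score_prog)
          show "nreg s2 ''n'' = n" "nreg s2 ''dproj'' = dp" "dp \<ge> 1" by (fact r2 pos)+
          show "rmem s2 ''T'' t = ?q $ t" if "t < dp" for t using s2 that by blast
          show "rmem s2 ''F'' (i * nreg s2 ''fd'' + ((nreg s2 ''r'' * nreg s2 ''pw'' + nreg s2 ''c'') * dp + t)) =
              F (Suc i) $ ((r * 2 ^ k + ?c) * dp + t)" if "i < n" "t < dp" for i t
          proof -
            \<comment> \<open>The address must stay below the length of an encoding, since only
              there does \<open>query_input\<close> prescribe the contents of the array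
              \<open>F\<close>.\<close>
            have "Suc r * 2 ^ k \<le> R * 2 ^ k" using ra by (intro mult_right_mono) auto
            then have "Suc (r * 2 ^ k + ?c) \<le> R * 2 ^ k" using c by simp
            then have "Suc (r * 2 ^ k + ?c) * dp \<le> R * 2 ^ k * dp" by (rule mult_right_mono) simp
            then have "(r * 2 ^ k + ?c) * dp + t < fde_dim k dp R"
              using that by (simp add: fde_dim_def mult_ac)
            then show ?thesis using inp that r2 by (simp add: query_input_def)
          qed
        qed
      next
        case (3 s3)
        have "rmem s2 ''S'' = rmem s ''S''" using s1 s2 by (auto simp: frame_def)
        moreover have "frame {''c'', ''w'', ''j'', ''l'', ''t'', ''i''} Y s s3"
          using s1 s2 3 by (auto simp: frame_def Y_def)
        ultimately show ?case using 3 by simp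
      qed simp
    qed
  qed
qed

lemma runs_retrieval_prog:
  fixes F :: "nat \<Rightarrow> real vec"
  assumes inp: "query_input d k dp R \<omega> n F qs s0" and pos: "d \<ge> 1" "dp \<ge> 1" "n \<ge> 1"
    and dim: "\<And>q. q \<in> set qs \<Longrightarrow> q \<in> carrier_vec d"
  shows "runs retrieval_prog s0
    (R * (length qs * (90 * k * d + 60 * dp * d + 60 * n * dp + 27) + 12) + 11 * k + 30 * n + 60)
    (\<lambda>s'. is_arg_max (\<lambda>i. \<Sum>r<R. \<Sum>a<length qs. query_term d k dp \<omega> F (qs ! a) r i)
       (\<lambda>i. i \<in> {1..n}) (nreg s' ''out''))"
proof -
  define X where "X = {''pw'', ''fd'', ''i'', ''r'', ''a'', ''c'', ''w'', ''j'', ''l'', ''t'', ''best'', ''out''}"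
  define Y where "Y = {''acc'', ''T'', ''S''}"
  define f where "f r a i = query_term d k dp \<omega> F (qs ! a) r i" for r a i
  define step where "step = Seq hash_prog (Seq proj_prog score_prog)"
  define B where "B = 90 * k * d + 10 + (60 * dp * d + 5 + (60 * n * dp + 5))"
  define nq where "nq = length qs"
  define I0 where "I0 s \<longleftrightarrow> frame X Y s0 s \<and> nreg s ''pw'' = 2 ^ k \<and> nreg s ''fd'' = fde_dim k dp R" for s
  have inreg: "nreg s0 ''ksim'' = k" "nreg s0 ''n'' = n" "nreg s0 ''R'' = R" "nreg s0 ''nq'' = nq" "nreg s0 ''dproj'' = dp"
    using inp by (auto simp: query_input_def nq_def)
  have mem: "''i'' \<in> X" "''pw'' \<in> X" "''j'' \<in> X" "''S'' \<in> Y" by (simp_all add: X_def Y_def)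
  have pw: "runs (Seq (NSet ''pw'' (NConst 1)) (For ''j'' ''ksim'' (NSet ''pw'' (NAdd (NReg ''pw'') (NReg ''pw''))))) s0
      (2 + (k * (4 + 7) + 5)) (\<lambda>s. frame X Y s0 s \<and> nreg s ''pw'' = 2 ^ k)"
  proof -
    let ?I = "\<lambda>j s. frame X Y s0 s \<and> nreg s ''pw'' = 2 ^ j"
    show ?thesis
    proof (rule runs_Seq[where \<Phi>="?I 0"], goal_cases)
      case 1
      show ?case by (rule runs_NSet) (simp_all add: frame_nreg[OF frame_refl] X_def)
    next
      case (2 s1)
      have "runs (For ''j'' ''ksim'' (NSet ''pw'' (NAdd (NReg ''pw'') (NReg ''pw'')))) s1 (k * (4 + 7) + 5)
        (\<lambda>s. ?I k s \<and> nreg s ''j'' = k)"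
      proof (rule runs_For[where I="?I"], goal_cases)
        case 1
        show ?case using 2 by (simp add: frame_nreg X_def)
      next
        case (2 a s)
        then show ?case using inreg frameD(1)[of X Y s0 s "''ksim''"] by (simp add: X_def)
      next
        case (3 a s)
        then show ?case using mem by (intro runs_NSet) (auto simp: frame_def)
      qed
      then show ?case by (rule runs_mono) auto
    qed
  qed
  have main: "runs (For ''r'' ''R'' (For ''a'' ''nq'' step)) s
      (R * (nq * (B + 7) + 5 + 7) + 5) (\<lambda>s'. I0 s' \<and> (\<forall>i<n. rmem s' ''S'' i = (\<Sum>r<R. \<Sum>a<nq. f r a (Suc i))))"
    if s: "I0 s" "\<forall>i<n. rmem s ''S'' i = 0" for s
  proof -
    define I where "I r s \<longleftrightarrow> I0 s \<and> (\<forall>i<n. rmem s ''S'' i = (\<Sum>r<r. \<Sum>a<nq. f r a (Suc i)))" for r s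
    have "runs (For ''r'' ''R'' (For ''a'' ''nq'' step)) s
      (R * (nq * (B + 7) + 5 + 7) + 5) (\<lambda>s'. I R s' \<and> nreg s' ''r'' = R)"
    proof (rule runs_For[where I=I], goal_cases)
      case 1
      show ?case using s by (simp add: I_def I0_def frame_nreg X_def)
    next
      case (2 a s)
      then show ?case using inreg frameD(1)[of X Y s0 s "''R''"] by (simp add: I_def I0_def X_def)
    next
      case r: (3 r s1)
      \<comment> \<open>Within repetition r the scores consist of the completed repetitions and of
        the first a query vectors.\<close>
      define J where "J a s \<longleftrightarrow> I0 s \<and> nreg s ''r'' = r \<and>
        (\<forall>i<n. rmem s ''S'' i = (\<Sum>r<r. \<Sum>a<nq. f r a (Suc i)) + (\<Sum>a<a. f r a (Suc i)))" for a s
      have "runs (For ''a'' ''nq'' step) s1 (nq * (B + 7) + 5) (\<lambda>s'. J nq s' \<and> nreg s' ''a'' = nq)"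
      proof (rule runs_For[where I=J], goal_cases)
        case 1
        show ?case using r by (simp add: I_def J_def I0_def frame_nreg X_def)
      next
        case (2 a s)
        then show ?case using inreg frameD(1)[of X Y s0 s "''nq''"] by (simp add: J_def I0_def X_def)
      next
        case a: (3 a s2)
        then have f2: "frame X Y s0 s2" and r2: "nreg s2 ''pw'' = 2 ^ k" "nreg s2 ''fd'' = fde_dim k dp R" "nreg s2 ''r'' = r"
          by (simp_all add: J_def I0_def)
        have "runs step s2 B (\<lambda>s'. frame {''c'', ''w'', ''j'', ''l'', ''t'', ''i''} Y s2 s' \<and>
            (\<forall>i<n. rmem s' ''S'' i = rmem s2 ''S'' i + f r a (Suc i)))"
          unfolding B_def f_def Y_def step_def
          by (rule runs_retrieval_step[OF inp f2[unfolded X_def Y_def] pos(1,2) r2 a(3) r(1)])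
            (use a(1) dim in \<open>simp_all add: nq_def\<close>)
        then show ?case
        proof (rule runs_mono, goal_cases)
          case (2 s3)
          then have "frame {''c'', ''w'', ''j'', ''l'', ''t'', ''i''} Y s2 s3" by blast
          with f2 have "frame X Y s0 s3" by (rule frame_trans) (simp_all add: X_def)
          then have "frame X Y s0 (s3\<lparr>nreg := (nreg s3)(''a'' := Suc a)\<rparr>)"
            by (rule frame_nreg) (simp add: X_def)
          moreover have "nreg s3 ''a'' = nreg s2 ''a''" "nreg s3 ''r'' = nreg s2 ''r''" "nreg s3 ''pw'' = nreg s2 ''pw''"
            "nreg s3 ''fd'' = nreg s2 ''fd''"
            using 2 by (auto simp: frame_def)
          ultimately show ?case using 2 a by (simp add: J_def I0_def)
        qed simp
      qed
      then show ?case
      proof (rule runs_mono, goal_cases)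
        case (2 s3)
        then have "frame X Y s0 (s3\<lparr>nreg := (nreg s3)(''r'' := Suc r)\<rparr>)"
          by (intro frame_nreg) (auto simp: X_def J_def I0_def)
        then show ?case using 2 by (simp add: J_def I_def I0_def)
      qed simp
    qed
    then show ?thesis by (rule runs_mono) (auto simp: I_def)
  qed
  have "runs retrieval_prog s0 (2 + (k * (4 + 7) + 5) + (6 + ((n * (3 + 7) + 5) + ((R * (nq * (B + 7) + 5 + 7) + 5) + (20 * n + 20)))))
    (\<lambda>s'. is_arg_max (\<lambda>i. \<Sum>r<R. \<Sum>a<nq. f r a i) (\<lambda>i. i \<in> {1..n}) (nreg s' ''out''))"
    unfolding retrieval_prog_def step_def[symmetric]
  proof (rule runs_Seq[OF pw], rule runs_Seq[where \<Phi>="I0"], goal_cases)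
    case (1 s1)
    then have "I0 (s1\<lparr>nreg := (nreg s1)(''fd'' := nval (NMul (NMul (NReg ''pw'') (NReg ''dproj'')) (NReg ''R'')) s1)\<rparr>)"
      using inreg frameD(1)[of X Y s0 s1 "''dproj''"] frameD(1)[of X Y s0 s1 "''R''"]
      by (simp add: I0_def frame_nreg X_def fde_dim_def)
    then show ?case by (rule runs_NSet) simp
  next
    case (2 s1 s2)
    show ?case
    proof (rule runs_Seq[where \<Phi>="\<lambda>s. I0 s \<and> (\<forall>i<n. rmem s ''S'' i = 0)"], goal_cases)
      case 1
      define I where "I j s \<longleftrightarrow> I0 s \<and> (\<forall>i<j. rmem s ''S'' i = 0)" for j s
      have "runs (For ''i'' ''n'' (RSet ''S'' (NReg ''i'') RZero)) s2 (n * (3 + 7) + 5) (\<lambda>s. I n s \<and> nreg s ''i'' = n)"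
      proof (rule runs_For[where I=I], goal_cases)
        case 1
        show ?case using 2 by (simp add: I_def I0_def frame_nreg X_def)
      next
        case (2 a s)
        then show ?case using inreg frameD(1)[of X Y s0 s "''n''"] by (simp add: I_def I0_def X_def)
      next
        case (3 a s)
        then show ?case using mem by (intro runs_RSet) (auto simp: I_def I0_def less_Suc_eq frame_def)
      qed
      then show ?case by (rule runs_mono) (auto simp: I_def)
    next
      case (2 s3)
      then show ?case
      proof (intro runs_Seq[OF main], goal_cases)
        case (3 s4)
        show ?case
          by (rule runs_argmax_prog)
            (use 3 inreg pos frameD(1)[of X Y s0 s4 "''n''"] in \<open>auto simp: I0_def X_def\<close>)
      qed auto
    qed
  qed
  moreover have "2 + (k * (4 + 7) + 5) + (6 + ((n * (3 + 7) + 5) + ((R * (nq * (B + 7) + 5 + 7) + 5) + (20 * n + 20)))) \<le>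
     R * (nq * (90 * k * d + 60 * dp * d + 60 * n * dp + 27) + 12) + 11 * k + 30 * n + 60"
  proof -
    define W where "W = 90 * k * d + 60 * dp * d + 60 * n * dp + 27"
    have "B + 7 = W" by (simp add: B_def W_def)
    then show ?thesis unfolding W_def[symmetric] by (simp add: algebra_simps)
  qed
  ultimately show ?thesis
    unfolding f_def nq_def by (rule runs_mono) simp
qed

lemma unit_vec_setD:
  assumes "unit_vec_set d A"
  shows "finite A" "A \<noteq> {}" "A \<subseteq> carrier_vec d" "d \<ge> 1" "card A \<ge> 1"
    and "x \<in> A \<Longrightarrow> (\<Sum>l<d. (x $ l)\<^sup>2) = 1"
proof -
  show A: "finite A" "A \<noteq> {}" "A \<subseteq> carrier_vec d" using assms by (auto simp: unit_vec_set_def)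
  have *: "(\<Sum>l<d. (x $ l)\<^sup>2) = 1" if "x \<in> A" for x
  proof -
    have "sqrt (x \<bullet> x) = 1" "dim_vec x = d" using assms that by (auto simp: unit_vec_set_def)
    then show ?thesis by (simp add: scalar_prod_def atLeast0LessThan power2_eq_square)
  qed
  then show "x \<in> A \<Longrightarrow> (\<Sum>l<d. (x $ l)\<^sup>2) = 1" .
  obtain x where "x \<in> A" using A by blast
  from *[OF this] show "d \<ge> 1" by (cases d) auto
  show "card A \<ge> 1" using A by (simp add: Suc_le_eq card_gt_0_iff)
qed

lemma recovers_in_time_retrieval_prog:
  assumes Q: "unit_vec_set d Q" and pos: "dp \<ge> 1" "n \<ge> 1"
    and T: "real (R * (card Q * (90 * k * d + 60 * dp * d + 60 * n * dp + 27) + 12) + 11 * k + 30 * n + 60) \<le> T"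
  shows "recovers_in_time retrieval_prog d k dp R n Q P T"
  unfolding recovers_in_time_def
proof (intro ballI allI impI)
  fix \<omega> F qs s
  assume A: "is_fde_docs d k dp R \<omega> n P F \<and> distinct qs \<and> set qs = Q \<and> query_input d k dp R \<omega> n F qs s"
  note D = unit_vec_setD[OF Q]
  have card: "length qs = card Q" using A distinct_card by metis
  define f where "f i = (\<Sum>r<R. \<Sum>a<length qs. query_term d k dp \<omega> F (qs ! a) r i)" for i
  have f: "f i = fde_query d k dp R \<omega> Q \<bullet> F i" if "i \<in> {1..n}" for i
  proof -
    have "dim_vec (F i) = fde_dim k dp R"
    proof -
      have "is_fde_doc d k dp R \<omega> (P i) (F i)" using A that unfolding is_fde_docs_def by blast
      then obtain blk where "F i = fde_concat d k dp R \<omega> blk" unfolding is_fde_doc_def by blast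
      then show ?thesis by (simp add: dim_fde_concat)
    qed
    then show ?thesis
      unfolding f_def query_term_def fde_query_scalar_prod[OF D(1,3) \<open>dim_vec (F i) = _\<close>]
      using A by (intro sum.cong refl sum.reindex_bij_betw[OF bij_betw_nth]) auto
  qed
  have "runs retrieval_prog s (R * (length qs * (90 * k * d + 60 * dp * d + 60 * n * dp + 27) + 12) + 11 * k + 30 * n + 60)
    (\<lambda>s'. is_arg_max f (\<lambda>i. i \<in> {1..n}) (nreg s' ''out''))"
    unfolding f_def by (rule runs_retrieval_prog) (use A D pos in auto)
  then obtain t s' where *: "exec retrieval_prog s t s'"
      "t \<le> R * (card Q * (90 * k * d + 60 * dp * d + 60 * n * dp + 27) + 12) + 11 * k + 30 * n + 60"
      "is_arg_max f (\<lambda>i. i \<in> {1..n}) (nreg s' ''out'')"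
    unfolding runs_def card by blast
  have "real t \<le> T" using *(2) T by (meson of_nat_mono order_trans)
  \<comment> \<open>The computed scores agree with the inner products for indices in
    \<open>{1..n}\<close>, and \<open>is_arg_max\<close> compares no others.\<close>
  moreover have "is_best_doc n (fde_query d k dp R \<omega> Q) F (nreg s' ''out'')"
    using *(3) unfolding is_best_doc_def is_arg_max_def by (metis f)
  ultimately show "\<exists>t s'. exec retrieval_prog s t s' \<and> real t \<le> T \<and>
      is_best_doc n (fde_query d k dp R \<omega> Q) F (nreg s' ''out'')"
    using *(1) by blast
qed

section \<open>Parameters\<close>

lemma param_ge_one: "param C f \<ge> 1"
  by (simp add: param_def)

lemma param_ge: "C * f \<le> real (param C f)"
  unfolding param_def by linarith

lemma param_le: "C * f \<ge> 0 \<Longrightarrow> real (param C f) \<le> C * f + 1"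
  unfolding param_def by linarith

lemma param_mono: "f \<le> g \<Longrightarrow> param 1 f \<le> param 1 g"
  unfolding param_def by (intro max.mono nat_mono ceiling_mono) auto

text \<open>Compares parameters after rounding and after the cut-off at 1, for f of either sign.
  Hence the first time bound can hold for all \<open>\<epsilon>\<close> and n.\<close>

lemma param_le_param_one:
  assumes "C \<ge> 0"
  shows "real (param C f) \<le> (C + 1) * real (param 1 f)"
proof (cases "f \<ge> 0")
  case True
  have "real (param C f) \<le> C * f + 1" using True assms by (intro param_le) auto
  also have "\<dots> \<le> C * real (param 1 f) + real (param 1 f)"
    using assms param_ge[of 1 f] param_ge_one[of 1 f] by (intro add_mono mult_left_mono) auto
  finally show ?thesis by (simp add: algebra_simps)
next
  case False
  then have "C * f \<le> 0" using assms by (simp add: mult_nonneg_nonpos)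
  then have "param C f = 1" by (simp add: param_def)
  moreover have "1 * 1 \<le> (C + 1) * real (param 1 f)"
    using assms param_ge_one[of 1 f] by (intro mult_mono) auto
  ultimately show ?thesis by simp
qed

text \<open>All terms are compared with one product U = B q A M of numbers at least 1, where A = c
  a, B = c b and M = max d n. The inner loops take 90 + 60 + 60 + 27 = 237, the loop overhead 12
  makes 249, and 11 + 30 + 60 for the rest stays below 350.\<close>

lemma query_cost_le:
  fixes a b c :: real
  assumes "real k \<le> c * a" "real dp \<le> c * a" "real R \<le> c * b" "c \<ge> 1" "a \<ge> 1" "b \<ge> 1"
    "q \<ge> 1" "d \<ge> 1" "n \<ge> 1"
  shows "real (R * (q * (90 * k * d + 60 * dp * d + 60 * n * dp + 27) + 12) + 11 * k + 30 * n + 60)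
    \<le> 350 * c\<^sup>2 * (real q * real (max d n) * (a * b))"
proof -
  define M where "M = real (max d n)"
  define A where "A = c * a"
  define B where "B = c * b"
  define U where "U = B * (real q * (A * M))"
  have M: "real d \<le> M" "real n \<le> M" "1 \<le> M" using assms by (auto simp: M_def)
  have A: "1 \<le> A" unfolding A_def using assms mult_mono[of 1 c 1 a] by auto
  have B: "1 \<le> B" unfolding B_def using assms mult_mono[of 1 c 1 b] by auto
  have q: "1 \<le> real q" using assms by simp
  have AM: "1 \<le> A * M" using A M mult_mono[of 1 A 1 M] by auto
  have qAM: "1 \<le> real q * (A * M)" using q AM mult_mono[of 1 "real q" 1 "A * M"] by auto
  have le1: "x * y \<le> A * M" if "x \<le> A" "y \<le> M" "0 \<le> x" "0 \<le> y" for x y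
    using that A M by (intro mult_mono) auto
  have "real (90 * k * d + 60 * dp * d + 60 * n * dp + 27) =
      90 * (real k * real d) + 60 * (real dp * real d) + 60 * (real dp * real n) + 27" by simp
  also have "\<dots> \<le> 90 * (A * M) + 60 * (A * M) + 60 * (A * M) + 27 * (A * M)"
    using AM assms M by (intro add_mono mult_left_mono le1) (auto simp: A_def)
  finally have 1: "real (90 * k * d + 60 * dp * d + 60 * n * dp + 27) \<le> 237 * (A * M)" by simp
  have "real q * real (90 * k * d + 60 * dp * d + 60 * n * dp + 27) + 12 \<le> real q * (237 * (A * M)) + 12 * (real q * (A * M))"
    using qAM 1 by (intro add_mono mult_left_mono) auto
  also have "\<dots> = 249 * (real q * (A * M))" by simp
  finally have "real R * (real q * real (90 * k * d + 60 * dp * d + 60 * n * dp + 27) + 12) \<le> B * (249 * (real q * (A * M)))"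
    using assms B by (intro mult_mono) (auto simp: B_def)
  then have 2: "real R * (real q * real (90 * k * d + 60 * dp * d + 60 * n * dp + 27) + 12) \<le> 249 * U"
    by (simp add: U_def)
  have U: "1 * (real q * (A * M)) \<le> U" unfolding U_def using B qAM by (intro mult_right_mono) auto
  have "1 * (A * M) \<le> real q * (A * M)" using q AM by (intro mult_right_mono) auto
  then have AMU: "A * M \<le> U" using U by linarith
  have "A * 1 \<le> A * M" "1 * M \<le> A * M" using A M by (intro mult_mono; simp)+
  moreover have "real k \<le> A" using assms by (simp add: A_def)
  ultimately have 3: "real k \<le> U" "real n \<le> U" "1 \<le> U" using AMU M A by linarith+
  have "real (R * (q * (90 * k * d + 60 * dp * d + 60 * n * dp + 27) + 12) + 11 * k + 30 * n + 60) =
     real R * (real q * real (90 * k * d + 60 * dp * d + 60 * n * dp + 27) + 12) + 11 * real k + 30 * real n + 60"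
    by (simp only: of_nat_add of_nat_mult of_nat_numeral)
  also have "\<dots> \<le> 350 * U" using 2 3 by linarith
  also have "\<dots> = 350 * c\<^sup>2 * (real q * real (max d n) * (a * b))"
    by (simp add: U_def A_def B_def M_def power2_eq_square)
  finally show ?thesis .
qed

section \<open>The size of the encodings\<close>

lemma ln_two_ge_half: "1 / 2 \<le> ln (2 :: real)"
proof -
  have "exp (1 / 2 :: real) \<le> 2"
  proof -
    have "(exp (1 / 2 :: real))\<^sup>2 = exp 1" by (simp add: exp_double[symmetric])
    also have "\<dots> \<le> 2\<^sup>2" using exp_le by simp
    finally show ?thesis by (rule power2_le_imp_le) simp
  qed
  then show ?thesis by (subst ln_ge_iff) auto
qed

text \<open>Turns two-sided bounds into an equation with an O-term in the exponent: the exponent is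
  the logarithm of y / z to base x, and z <= y makes it nonnegative.\<close>

lemma exponent_exists:
  fixes x :: real
  assumes "x > 1" "z > 0" "z \<le> y" "y \<le> x powr E * z"
  shows "\<exists>e\<in>{0..E}. y = x powr e * z"
proof (rule bexI)
  let ?e = "ln (y / z) / ln x"
  have lx: "ln x > 0" using assms by simp
  show "y = x powr ?e * z" using assms lx by (simp add: powr_def)
  have "y / z \<le> x powr E" using assms by (simp add: field_simps)
  then have "ln (y / z) \<le> ln (x powr E)" using assms by (subst ln_le_cancel_iff) auto
  also have "\<dots> = E * ln x" using assms by (simp add: ln_powr)
  finally show "?e \<in> {0..E}" using assms lx by (simp add: field_simps)
qed

text \<open>Apart from two logarithms everything is absorbed into powers of X = m /
  \<open>\<epsilon>\<close>, which is at least 2: 1 / \<open>\<epsilon>\<close>^2 <= X^2, ln X <= X,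
  and a factor c becomes a power with exponent log 2 c. The 7 in the exponent is 2 for rounding the
  number of bits plus 5 for X^3 in the target dimension and X^2 in the repetitions. If (ln n)^2 is
  to be the last factor, ln d has to move into the exponent.\<close>

lemma fde_dim_bounds:
  fixes \<epsilon> m d n :: real
  assumes e: "0 < \<epsilon>" "\<epsilon> \<le> 1" and C: "1 \<le> Ck" "1 \<le> Cd" "1 \<le> Cr"
    and m: "2 \<le> m" and d: "1 \<le> d" and n: "2 \<le> n"
  defines "L \<equiv> ln (m * d * n / \<epsilon>)"
  defines "D \<equiv> real (fde_dim (param Ck (ln (m / \<epsilon>) / \<epsilon>\<^sup>2)) (param Cd (1 / \<epsilon>\<^sup>2 * L)) (param Cr (1 / \<epsilon>\<^sup>2 * ln n)))"
  shows "ln n * ln (d * n) \<le> D" "(ln n)\<^sup>2 \<le> D"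
    and "D \<le> (m / \<epsilon>) powr ((Ck + 7 + log 2 (3 * (Cd + 1) * (Cr + 2))) / \<epsilon>\<^sup>2) * (ln n * ln (d * n))"
    and "D \<le> (m / \<epsilon>) powr ((Ck + 7 + log 2 (3 * (Cd + 1) * (Cr + 2) * (1 + 2 * ln d))) / \<epsilon>\<^sup>2) * (ln n)\<^sup>2"
proof -
  define X where "X = m / \<epsilon>"
  have X: "2 \<le> X" using e m mult_mono[of 2 m \<epsilon> 1] by (simp add: X_def field_simps)
  have "X * (d * n) = m * d * n / \<epsilon>" by (simp add: X_def)
  moreover have dn: "2 \<le> d * n" "n \<le> d * n" using d n mult_mono[of 1 d 2 n] by auto
  ultimately have L: "L = ln X + ln (d * n)"
    using X d n ln_mult[of X "d * n"] by (simp add: L_def)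
  have half: "1 / 2 \<le> ln x" if "2 \<le> x" for x :: real
    using that ln_two_ge_half by (smt (verit) ln_le_cancel_iff)
  have lX: "1 / 2 \<le> ln X" and ln: "1 / 2 \<le> ln n" and ldn: "1 / 2 \<le> ln (d * n)" and lnn: "ln n \<le> ln (d * n)"
    using half[OF X] half[OF n] half[OF dn(1)] dn n by auto
  have L1: "1 \<le> L" "ln (d * n) \<le> L" using L lX ldn by auto
  define I where "I = 1 / \<epsilon>\<^sup>2"
  have I: "1 \<le> I" using e by (simp add: I_def power_le_one)
  have IX: "I \<le> X\<^sup>2"
  proof -
    have "1 / \<epsilon> \<le> X" unfolding X_def using e m by (intro divide_right_mono) auto
    then have "(1 / \<epsilon>)\<^sup>2 \<le> X\<^sup>2" using e by (intro power_mono) auto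
    then show ?thesis by (simp add: I_def power_divide)
  qed
  define k where "k = param Ck (ln (m / \<epsilon>) / \<epsilon>\<^sup>2)"
  define dp where "dp = param Cd (1 / \<epsilon>\<^sup>2 * L)"
  define R where "R = param Cr (1 / \<epsilon>\<^sup>2 * ln n)"
  have D: "D = 2 ^ k * (real dp * real R)" by (simp add: D_def fde_dim_def k_def dp_def R_def)
  have pw: "1 * (real dp * real R) \<le> D" unfolding D by (intro mult_right_mono) auto
  have "1 * L \<le> Cd * (I * L)" using mult_mono[of 1 "Cd * I" L L] mult_mono[of 1 Cd 1 I] C I L1 by (simp add: mult.assoc)
  also have "\<dots> \<le> real dp" unfolding dp_def I_def[symmetric] by (rule param_ge)
  finally have dpL: "L \<le> real dp" by simp
  have "1 * ln n \<le> Cr * (I * ln n)" using mult_mono[of 1 "Cr * I" "ln n" "ln n"] mult_mono[of 1 Cr 1 I] C I ln by (simp add: mult.assoc)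
  also have "\<dots> \<le> real R" unfolding R_def I_def[symmetric] by (rule param_ge)
  finally have Rn: "ln n \<le> real R" by simp
  have "ln (d * n) * ln n \<le> real dp * real R"
    using dpL Rn L1 ln ldn by (intro mult_mono) auto
  then show l1: "ln n * ln (d * n) \<le> D" using pw by (simp add: mult.commute)
  have "ln n * ln n \<le> ln n * ln (d * n)" using lnn ln by (intro mult_left_mono) auto
  then show "(ln n)\<^sup>2 \<le> D" using l1 by (simp add: power2_eq_square)
  have k: "real k \<le> (Ck + 2) * I * ln X"
  proof -
    have "real k \<le> Ck * (ln X * I) + 1"
      using param_le[of Ck "ln (m / \<epsilon>) / \<epsilon>\<^sup>2"] C lX e by (simp add: k_def X_def[symmetric] I_def)
    moreover have "1 \<le> 2 * (I * ln X)" using mult_mono[of 1 I "1/2" "ln X"] I lX by simp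
    ultimately show ?thesis by (simp add: algebra_simps)
  qed
  have p2: "2 ^ k \<le> X powr ((Ck + 2) * I)"
  proof -
    have "real k * ln 2 \<le> real k * 1" using ln_2_less_1 by (intro mult_left_mono) auto
    then have "exp (real k * ln 2) \<le> exp ((Ck + 2) * I * ln X)" using k by simp
    then show ?thesis using X by (simp add: powr_def exp_of_nat_mult)
  qed
  have dp: "real dp \<le> (Cd + 1) * (I * L)"
  proof -
    have "real dp \<le> Cd * (I * L) + 1" unfolding dp_def I_def[symmetric] using C I L1 by (intro param_le) auto
    moreover have "1 \<le> I * L" using mult_mono[of 1 I 1 L] I L1 by simp
    ultimately show ?thesis by (simp add: algebra_simps)
  qed
  \<comment> \<open>L is a sum of logarithms; ln (d n) >= 1 / 2 turns the summand ln X into a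
    multiple of ln (d n).\<close>
  have "L \<le> 3 * X * ln (d * n)"
  proof -
    have "ln X \<le> X" using X ln_less_self[of X] by linarith
    then have "1 / 2 * ln X \<le> ln (d * n) * X" using ldn lX X by (intro mult_mono) auto
    moreover have "1 * ln (d * n) \<le> X * ln (d * n)" using X ldn by (intro mult_right_mono) auto
    ultimately show ?thesis unfolding L by (simp add: algebra_simps)
  qed
  then have "I * L \<le> X\<^sup>2 * (3 * X * ln (d * n))" using IX I L1 by (intro mult_mono) auto
  then have "(Cd + 1) * (I * L) \<le> (Cd + 1) * (X\<^sup>2 * (3 * X * ln (d * n)))" using C by (intro mult_left_mono) auto
  with dp have dp: "real dp \<le> 3 * (Cd + 1) * X ^ 3 * ln (d * n)" by (simp add: power2_eq_square power3_eq_cube algebra_simps)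
  have R: "real R \<le> (Cr + 2) * X\<^sup>2 * ln n"
  proof -
    have "real R \<le> Cr * (I * ln n) + 1" unfolding R_def I_def[symmetric] using C I ln by (intro param_le) auto
    moreover have "1 \<le> 2 * (I * ln n)" using mult_mono[of 1 I "1/2" "ln n"] I ln by simp
    ultimately have "real R \<le> (Cr + 2) * (I * ln n)" by (simp add: algebra_simps)
    also have "\<dots> \<le> (Cr + 2) * (X\<^sup>2 * ln n)" using C IX ln by (intro mult_left_mono mult_right_mono) auto
    finally show ?thesis by simp
  qed
  define c where "c = 3 * (Cd + 1) * (Cr + 2)"
  have c: "1 \<le> c"
  proof -
    have "1 * (1 * 1) \<le> 3 * ((Cd + 1) * (Cr + 2))" using C by (intro mult_mono) auto
    then show ?thesis unfolding c_def by (simp only: mult.assoc)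
  qed
  have "real dp * real R \<le> (3 * (Cd + 1) * X ^ 3 * ln (d * n)) * ((Cr + 2) * X\<^sup>2 * ln n)"
    using dp R X ldn C by (intro mult_mono) auto
  also have "\<dots> = c * X ^ 5 * (ln n * ln (d * n))"
    by (simp add: c_def power_add[symmetric] mult_ac eval_nat_numeral)
  finally have prod: "real dp * real R \<le> c * X ^ 5 * (ln n * ln (d * n))" .
  have nn: "0 \<le> ln n * ln (d * n)" using ln ldn by simp
  \<comment> \<open>Base 2 of the logarithm fits X >= 2. The exponents 5 and log 2 c' are inflated
    by 1 / \<open>\<epsilon>\<close>^2 >= 1 to give all summands the same form.\<close>
  have up: "2 ^ k * (c' * X ^ 5) \<le> X powr ((Ck + 7 + log 2 c') / \<epsilon>\<^sup>2)" if c': "1 \<le> c'" for c'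
  proof -
    have lc: "0 \<le> log 2 c'" using c' by simp
    have "c' = 2 powr (log 2 c')" using c' by simp
    also have "\<dots> \<le> X powr (log 2 c')" using X lc by (intro powr_mono2) auto
    finally have "c' * X ^ 5 \<le> X powr (log 2 c') * X powr 5"
      using X by (intro mult_mono) (auto simp: powr_numeral)
    then have "2 ^ k * (c' * X ^ 5) \<le> X powr ((Ck + 2) * I) * (X powr (log 2 c') * X powr 5)"
      using p2 X c' by (intro mult_mono) auto
    also have "\<dots> = X powr ((Ck + 2) * I + log 2 c' + 5)" by (simp add: powr_add)
    also have "\<dots> \<le> X powr ((Ck + 7 + log 2 c') * I)"
    proof (rule powr_mono)
      have "(log 2 c' + 5) * 1 \<le> (log 2 c' + 5) * I" using lc I by (intro mult_left_mono) auto
      then show "(Ck + 2) * I + log 2 c' + 5 \<le> (Ck + 7 + log 2 c') * I" by (simp add: algebra_simps)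
    qed (use X in auto)
    finally show ?thesis by (simp add: I_def)
  qed
  have "D \<le> 2 ^ k * (c * X ^ 5 * (ln n * ln (d * n)))" unfolding D using prod by (intro mult_left_mono) auto
  also have "\<dots> = 2 ^ k * (c * X ^ 5) * (ln n * ln (d * n))" by simp
  also have "\<dots> \<le> X powr ((Ck + 7 + log 2 c) / \<epsilon>\<^sup>2) * (ln n * ln (d * n))"
    by (intro mult_right_mono up c nn)
  finally show "D \<le> (m / \<epsilon>) powr ((Ck + 7 + log 2 (3 * (Cd + 1) * (Cr + 2))) / \<epsilon>\<^sup>2) * (ln n * ln (d * n))"
    by (simp add: X_def c_def)
  have ld: "0 \<le> ln d" using d by simp
  \<comment> \<open>ln n >= 1 / 2 turns the sum into the product (1 + 2 ln d) ln n.\<close>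
  have "ln (d * n) = ln d + ln n" using d n by (simp add: ln_mult)
  also have "\<dots> \<le> 2 * ln d * ln n + ln n"
    using mult_left_mono[OF ln ld] by simp
  finally have "ln n * ln (d * n) \<le> ln n * ((1 + 2 * ln d) * ln n)"
    using ln by (intro mult_left_mono) (auto simp: algebra_simps)
  then have "c * X ^ 5 * (ln n * ln (d * n)) \<le> c * X ^ 5 * (ln n * ((1 + 2 * ln d) * ln n))"
    using c X by (intro mult_left_mono[where c="c * X ^ 5"]) auto
  with prod have "real dp * real R \<le> c * X ^ 5 * (ln n * ((1 + 2 * ln d) * ln n))" by (rule order_trans)
  then have "D \<le> 2 ^ k * (c * X ^ 5 * (ln n * ((1 + 2 * ln d) * ln n)))" unfolding D by (intro mult_left_mono) auto
  also have "\<dots> = 2 ^ k * ((c * (1 + 2 * ln d)) * X ^ 5) * (ln n)\<^sup>2" by (simp add: power2_eq_square)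
  also have "\<dots> \<le> X powr ((Ck + 7 + log 2 (c * (1 + 2 * ln d))) / \<epsilon>\<^sup>2) * (ln n)\<^sup>2"
    using c ld mult_mono[of 1 c 1 "1 + 2 * ln d"] by (intro mult_right_mono up) auto
  finally show "D \<le> (m / \<epsilon>) powr ((Ck + 7 + log 2 (3 * (Cd + 1) * (Cr + 2) * (1 + 2 * ln d))) / \<epsilon>\<^sup>2) * (ln n)\<^sup>2"
    by (simp add: X_def c_def)
qed

section \<open>Independence in the outcome space\<close>

text \<open>A random function whose law is a product measure has independent coordinates with the
  prescribed laws; applied to the Gaussian and to the sign part of an outcome.\<close>

lemma (in prob_space) indep_vars_coordinates:
  assumes I: "I \<noteq> {}" and N: "\<And>i. i \<in> I \<Longrightarrow> prob_space (N i)"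
    and f[measurable]: "f \<in> M \<rightarrow>\<^sub>M PiM I N" and distr: "distr M (PiM I N) f = PiM I N"
  shows "indep_vars N (\<lambda>i \<omega>. f \<omega> i) I" and "i \<in> I \<Longrightarrow> distr M (N i) (\<lambda>\<omega>. f \<omega> i) = N i"
proof -
  have comp: "distr M (N i) (\<lambda>\<omega>. f \<omega> i) = N i" if i: "i \<in> I" for i
  proof -
    have "distr M (N i) (\<lambda>\<omega>. f \<omega> i) = distr (distr M (PiM I N) f) (N i) (\<lambda>z. z i)"
      using i by (subst distr_distr) (auto simp: comp_def)
    then show ?thesis using distr_PiM_component[OF N i] by (simp add: distr)
  qed
  then show "i \<in> I \<Longrightarrow> distr M (N i) (\<lambda>\<omega>. f \<omega> i) = N i" .
  have rv: "random_variable (N i) (\<lambda>\<omega>. f \<omega> i)" if "i \<in> I" for i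
    using that by measurable
  have "distr M (PiM I N) (\<lambda>\<omega>. \<lambda>i\<in>I. f \<omega> i) = distr M (PiM I N) f"
    using measurable_space[OF f] by (intro distr_cong) (auto simp: space_PiM PiE_def extensional_restrict)
  also have "\<dots> = PiM I (\<lambda>i. distr M (N i) (\<lambda>\<omega>. f \<omega> i))"
    unfolding distr by (rule PiM_cong) (auto simp: comp)
  finally show "indep_vars N (\<lambda>i \<omega>. f \<omega> i) I"
    by (subst indep_vars_iff_distr_eq_PiM'[OF I rv])
qed

lemma distr_pair_snd:
  assumes "prob_space N" "sigma_finite_measure M"
  shows "distr (N \<Otimes>\<^sub>M M) M snd = M"
proof (rule measure_eqI)
  interpret N: prob_space N by fact
  interpret sigma_finite_measure M by fact
  fix A assume A: "A \<in> sets (distr (N \<Otimes>\<^sub>M M) M snd)"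
  then have "snd -` A \<inter> space (N \<Otimes>\<^sub>M M) = space N \<times> A"
    by (auto simp: space_pair_measure dest: sets.sets_into_space)
  then show "emeasure (distr (N \<Otimes>\<^sub>M M) M snd) A = emeasure M A"
    using A by (simp add: emeasure_distr emeasure_pair_measure_Times N.emeasure_space_1)
qed simp

text \<open>A finite product of countable discrete spaces is discrete, so an arbitrary predicate of
  finitely many discrete variables defines an event. This settles comparisons of Hamming distances
  and the admissibility of document blocks.\<close>

lemma sets_finite_discrete:
  fixes X :: "'i \<Rightarrow> 'a \<Rightarrow> 'b :: countable"
  assumes A: "finite A" and X: "\<And>i. i \<in> A \<Longrightarrow> X i \<in> M \<rightarrow>\<^sub>M count_space UNIV"
    and \<Phi>: "\<And>\<omega>. \<omega> \<in> space M \<Longrightarrow> \<Phi> \<omega> \<longleftrightarrow> \<Psi> (\<lambda>i\<in>A. X i \<omega>)"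
  shows "{\<omega> \<in> space M. \<Phi> \<omega>} \<in> sets M"
proof -
  have "(\<lambda>\<omega>. \<lambda>i\<in>A. X i \<omega>) \<in> M \<rightarrow>\<^sub>M PiM A (\<lambda>_. count_space UNIV)"
    by (rule measurable_restrict) (rule X)
  then have m: "(\<lambda>\<omega>. \<lambda>i\<in>A. X i \<omega>) \<in> M \<rightarrow>\<^sub>M count_space (PiE A (\<lambda>_. UNIV))"
    using A by (subst (asm) count_space_PiM_finite) auto
  have "{\<omega> \<in> space M. \<Phi> \<omega>} = (\<lambda>\<omega>. \<lambda>i\<in>A. X i \<omega>) -` {z \<in> PiE A (\<lambda>_. UNIV). \<Psi> z} \<inter> space M"
    using \<Phi> by auto
  also have "\<dots> \<in> sets M" by (rule measurable_sets[OF m]) auto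
  finally show ?thesis .
qed

locale fde_parameters =
  fixes d k dp R :: nat
  assumes pos: "1 \<le> d" "1 \<le> k" "1 \<le> dp" "1 \<le> R"
begin

abbreviation "M \<equiv> fde_space d k dp R"

definition "GI = {..<R} \<times> {..<k} \<times> {..<d}"
definition "SI = {..<R} \<times> {..<dp} \<times> {..<d}"

lemma finite_index [simp]: "finite GI" "finite SI"
  by (simp_all add: GI_def SI_def)

lemma index_nonempty: "GI \<noteq> {}" "SI \<noteq> {}"
  using pos by (auto simp: GI_def SI_def lessThan_empty_iff)

abbreviation "gauss_space \<equiv> PiM GI (\<lambda>_. std_normal_distribution)"
abbreviation "sign_space \<equiv> PiM SI (\<lambda>_. measure_pmf (pmf_of_set {-1, 1 :: real}))"

lemma M_eq: "M = gauss_space \<Otimes>\<^sub>M sign_space"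
  by (simp add: fde_space_def GI_def SI_def)

lemma prob_spaces: "prob_space std_normal_distribution" "prob_space gauss_space" "prob_space sign_space"
  by (auto intro!: prob_space_PiM prob_space_normal_density measure_pmf.prob_space_axioms)

sublocale prob_space M
  unfolding M_eq using prob_spaces by (intro prob_space_pair) auto

lemma gaussians:
  "indep_vars (\<lambda>_. borel) (\<lambda>x \<omega>. fst \<omega> x) GI"
  "x \<in> GI \<Longrightarrow> distr M borel (\<lambda>\<omega>. fst \<omega> x) = std_normal_distribution"
proof -
  have f: "fst \<in> M \<rightarrow>\<^sub>M gauss_space" unfolding M_eq by simp
  have "distr M gauss_space fst = gauss_space"
    unfolding M_eq using prob_spaces(3) by (rule prob_space.distr_pair_fst)
  note * = indep_vars_coordinates[OF index_nonempty(1) prob_spaces(1) f this]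
  from *(1) show "indep_vars (\<lambda>_. borel) (\<lambda>x \<omega>. fst \<omega> x) GI"
    by (rule indep_vars_compose2[where Y="\<lambda>_ x. x"]) simp
  assume "x \<in> GI"
  then show "distr M borel (\<lambda>\<omega>. fst \<omega> x) = std_normal_distribution"
    using *(2) distr_cong[of M M borel std_normal_distribution "\<lambda>\<omega>. fst \<omega> x" "\<lambda>\<omega>. fst \<omega> x"] by simp
qed

lemma gaussian_measurable: "x \<in> GI \<Longrightarrow> (\<lambda>\<omega>. fst \<omega> x) \<in> borel_measurable M"
  using gaussians(1) by (simp add: indep_vars_def)

lemma rademacher_signs: "rademacher (\<lambda>x \<omega>. snd \<omega> x) SI"
proof -
  let ?N = "measure_pmf (pmf_of_set {-1, 1 :: real})"
  have f: "snd \<in> M \<rightarrow>\<^sub>M sign_space" unfolding M_eq by simp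
  have "distr M sign_space snd = sign_space"
    unfolding M_eq using prob_spaces by (intro distr_pair_snd prob_space_imp_sigma_finite)
  note * = indep_vars_coordinates[OF index_nonempty(2) measure_pmf.prob_space_axioms f this]
  have "(AE \<omega> in M. snd \<omega> x \<in> {-1, 1}) \<and> expectation (\<lambda>\<omega>. snd \<omega> x) = 0" if x: "x \<in> SI" for x
  proof
    have m: "(\<lambda>\<omega>. snd \<omega> x) \<in> M \<rightarrow>\<^sub>M ?N" using *(1) x by (auto simp: indep_vars_def)
    have "AE y in distr M ?N (\<lambda>\<omega>. snd \<omega> x). y \<in> {-1, 1}"
      unfolding *(2)[OF x] by (simp add: AE_measure_pmf_iff)
    then show "AE \<omega> in M. snd \<omega> x \<in> {-1, 1}" by (subst (asm) AE_distr_iff[OF m]) auto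
    have "expectation (\<lambda>\<omega>. snd \<omega> x) = (\<integral>y. y \<partial>distr M ?N (\<lambda>\<omega>. snd \<omega> x))"
      by (subst integral_distr[OF m]) auto
    also have "\<dots> = 0" unfolding *(2)[OF x] by (simp add: integral_pmf_of_set)
    finally show "expectation (\<lambda>\<omega>. snd \<omega> x) = 0" .
  qed
  moreover have "indep_vars (\<lambda>_. borel) (\<lambda>x \<omega>. snd \<omega> x) SI"
    by (rule indep_vars_compose2[OF *(1), where Y="\<lambda>_ x. x"]) simp
  ultimately show ?thesis by (simp add: rademacher_def)
qed

section \<open>Hash bits and misordered pairs of points\<close>

definition GK :: "nat \<Rightarrow> nat \<Rightarrow> (nat \<times> nat \<times> nat) set" where "GK r j = {r} \<times> {j} \<times> {..<d}"

lemma GK_subset: "r < R \<Longrightarrow> j < k \<Longrightarrow> GK r j \<subseteq> GI"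
  by (auto simp: GK_def GI_def)

lemma sum_GK: "(\<Sum>x\<in>GK r j. f x) = (\<Sum>l<d. f (r, j, l))"
  unfolding GK_def by (rule sum.reindex_bij_witness[of _ "\<lambda>l. (r, j, l)" "\<lambda>x. snd (snd x)"]) auto

text \<open>Written as a sum over the index block \<open>GK r j\<close>, which exhibits the bit as a
  function of one Gaussian vector and matches \<open>gaussian_family.lin\<close>.\<close>

definition hash_bit :: "nat \<Rightarrow> nat \<Rightarrow> real vec \<Rightarrow> randomness \<Rightarrow> bool" where
  "hash_bit r j x \<omega> \<longleftrightarrow> (\<Sum>i\<in>GK r j. fst \<omega> i * x $ snd (snd i)) > 0"

lemma simhash_eq:
  assumes "x \<in> carrier_vec d"
  shows "simhash d k \<omega> r x = map (\<lambda>j. hash_bit r j x \<omega>) [0..<k]"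
  using assms by (auto simp: simhash_def hash_bit_def sum_GK gauss_vec_def scalar_prod_def atLeast0LessThan)

lemma hash_bit_measurable [measurable]: "r < R \<Longrightarrow> j < k \<Longrightarrow> Measurable.pred M (hash_bit r j x)"
proof -
  assume "r < R" "j < k"
  then have "(\<lambda>\<omega>. \<Sum>i\<in>GK r j. fst \<omega> i * x $ snd (snd i)) \<in> borel_measurable M"
    using GK_subset by (intro borel_measurable_sum borel_measurable_times gaussian_measurable) auto
  then show ?thesis unfolding hash_bit_def by measurable
qed

lemma simhash_measurable:
  assumes "r < R" "x \<in> carrier_vec d"
  shows "(\<lambda>\<omega>. simhash d k \<omega> r x) \<in> M \<rightarrow>\<^sub>M count_space UNIV"
proof -
  have "{\<omega> \<in> space M. simhash d k \<omega> r x = b} \<in> sets M" for b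
  proof -
    have "{\<omega> \<in> space M. \<forall>j\<in>{..<k}. hash_bit r j x \<omega> = b ! j} \<in> sets M"
      by (intro sets.sets_Collect_finite_All') (use assms pos in \<open>auto simp: lessThan_empty_iff\<close>)
    moreover have "simhash d k \<omega> r x = b \<longleftrightarrow> length b = k \<and> (\<forall>j\<in>{..<k}. hash_bit r j x \<omega> = b ! j)" for \<omega>
      using assms by (auto simp: simhash_eq list_eq_iff_nth_eq)
    ultimately show ?thesis by (cases "length b = k") auto
  qed
  then show ?thesis
    by (subst measurable_count_space_eq_countable) (auto simp: vimage_def Int_def conj_commute)
qed

end

lemma hamming_map:
  "hamming (map f [0..<k]) (map g [0..<k]) = (\<Sum>j<k. of_bool (f j \<noteq> g j))"
proof -
  have "{j. j < length (map f [0..<k]) \<and> map f [0..<k] ! j \<noteq> map g [0..<k] ! j} = {j \<in> {..<k}. f j \<noteq> g j}"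
    by auto
  then show ?thesis by (simp add: hamming_def sum.inter_filter[symmetric] of_bool_def)
qed

context fde_parameters
begin

lemma hamming_simhash:
  assumes "x \<in> carrier_vec d" "y \<in> carrier_vec d"
  shows "hamming (simhash d k \<omega> r x) (simhash d k \<omega> r y) = (\<Sum>j<k. of_bool (hash_bit r j x \<omega> \<noteq> hash_bit r j y \<omega>))"
  using assms by (simp add: simhash_eq hamming_map)

text \<open>The difference of the two Hamming distances is a sum of k independent terms, each with
  mean at least \<open>\<theta> / 100\<close>.\<close>

lemma prob_misordered_le:
  fixes \<theta> :: real
  assumes r: "r < R" and dims: "q \<in> carrier_vec d" "p \<in> carrier_vec d" "p' \<in> carrier_vec d"
    and unit: "(\<Sum>l<d. (q $ l)\<^sup>2) = 1" "(\<Sum>l<d. (p $ l)\<^sup>2) = 1" "(\<Sum>l<d. (p' $ l)\<^sup>2) = 1"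
    and gap: "q \<bullet> p \<le> q \<bullet> p' - \<theta>" and \<theta>: "0 \<le> \<theta>"
  shows "prob {\<omega> \<in> space M. hamming (simhash d k \<omega> r p) (simhash d k \<omega> r q) \<le>
      hamming (simhash d k \<omega> r p') (simhash d k \<omega> r q)} \<le> exp (- (k * \<theta>\<^sup>2 / 20000))"
proof -
  define D where "D x j \<omega> = (of_bool (hash_bit r j q \<omega> \<noteq> hash_bit r j x \<omega>) :: real)" for x j \<omega>
  define X where "X j \<omega> = D p j \<omega> - D p' j \<omega>" for j \<omega>
  have DM[measurable]: "D x j \<in> borel_measurable M" if "j < k" for x j
    unfolding D_def using that r by measurable
  define c where "c = (\<lambda>x z j. \<Sum>i\<in>GK r j. z i * x $ snd (snd i) :: real)"
  \<comment> \<open>The difference of the two disagreements as a function of the j-th Gaussian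
    vector alone, in the form that independence of blocks requires.\<close>
  define f where "f j z = (of_bool ((c q z j > 0) \<noteq> (c p z j > 0)) - of_bool ((c q z j > 0) \<noteq> (c p' z j > 0)) :: real)" for j z
  have "indep_vars (\<lambda>_. borel) (\<lambda>j \<omega>. f j (\<lambda>i\<in>GK r j. fst \<omega> i)) {..<k}"
  proof (rule indep_vars_blocks[OF gaussians(1)])
    show "GK r j \<subseteq> GI" if "j \<in> {..<k}" for j using GK_subset r that by auto
    show "disjoint_family_on (GK r) {..<k}" by (auto simp: disjoint_family_on_def GK_def)
    show "f j \<in> borel_measurable (PiM (GK r j) (\<lambda>_. borel))" for j
      unfolding f_def c_def by measurable
  qed
  moreover have "f j (\<lambda>i\<in>GK r j. fst \<omega> i) = X j \<omega>" for j \<omega>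
    by (simp add: f_def c_def X_def D_def hash_bit_def cong: sum.cong)
  ultimately have ind: "indep_vars (\<lambda>_. borel) X {..<k}" by simp
  have mean: "\<theta> / 100 \<le> expectation (X j)" if j: "j < k" for j
  proof -
    have ED: "expectation (D x j) = prob {\<omega> \<in> space M. hash_bit r j q \<omega> \<noteq> hash_bit r j x \<omega>}" for x
    proof -
      have "expectation (D x j) = expectation (indicator {\<omega> \<in> space M. hash_bit r j q \<omega> \<noteq> hash_bit r j x \<omega>})"
        by (rule Bochner_Integration.integral_cong) (auto simp: D_def indicator_def)
      also have "\<dots> = prob {\<omega> \<in> space M. hash_bit r j q \<omega> \<noteq> hash_bit r j x \<omega>}"
        using r j by (subst Bochner_Integration.integral_indicator) (auto intro!: arg_cong[where f=prob])
      finally show ?thesis .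
    qed
    have int: "integrable M (D x j)" for x
      by (rule integrable_const_bound[where B=1]) (use DM[OF j] in \<open>auto simp: D_def\<close>)
    have ip: "(\<Sum>i\<in>GK r j. q $ snd (snd i) * x $ snd (snd i)) = q \<bullet> x" if "x \<in> carrier_vec d" for x
      using that by (simp add: sum_GK scalar_prod_def atLeast0LessThan)
    interpret G: gaussian_family M "\<lambda>x \<omega>. fst \<omega> x" "GK r j"
      using indep_vars_subset[OF gaussians(1) GK_subset[OF r j]] gaussians(2) GK_subset[OF r j]
      by unfold_locales auto
    have "((\<Sum>i\<in>GK r j. q $ snd (snd i) * p' $ snd (snd i)) - (\<Sum>i\<in>GK r j. q $ snd (snd i) * p $ snd (snd i))) / 100
       \<le> prob {\<omega> \<in> space M. hash_bit r j q \<omega> \<noteq> hash_bit r j p \<omega>} - prob {\<omega> \<in> space M. hash_bit r j q \<omega> \<noteq> hash_bit r j p' \<omega>}"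
      unfolding hash_bit_def G.lin_def[symmetric]
      by (rule G.separation_gap) (use unit gap \<theta> in \<open>simp_all add: ip[OF dims(2)] ip[OF dims(3)], simp_all add: sum_GK\<close>)
    then have "(q \<bullet> p' - q \<bullet> p) / 100 \<le> expectation (D p j) - expectation (D p' j)"
      unfolding ip[OF dims(2)] ip[OF dims(3)] ED .
    also have "\<dots> = expectation (X j)" unfolding X_def using int by simp
    finally show ?thesis using gap by (simp add: field_simps)
  qed
  define \<mu> where "\<mu> = (\<Sum>j<k. expectation (X j))"
  have \<mu>: "k * (\<theta> / 100) \<le> \<mu>" unfolding \<mu>_def using sum_mono[of "{..<k}" "\<lambda>_. \<theta> / 100" "\<lambda>j. expectation (X j)"] mean by simp
  interpret H: Hoeffding_ineq M "{..<k}" X "\<lambda>_. - 1" "\<lambda>_. 1" \<mu>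
    by unfold_locales (use ind in \<open>auto simp: \<mu>_def X_def D_def\<close>)
  have "{\<omega> \<in> space M. hamming (simhash d k \<omega> r p) (simhash d k \<omega> r q) \<le>
      hamming (simhash d k \<omega> r p') (simhash d k \<omega> r q)} = {\<omega> \<in> space M. (\<Sum>j<k. X j \<omega>) \<le> \<mu> - \<mu>}"
  proof -
    have "real (hamming (simhash d k \<omega> r x) (simhash d k \<omega> r q)) = (\<Sum>j<k. D x j \<omega>)" if "x \<in> carrier_vec d" for x \<omega>
      unfolding hamming_simhash[OF that dims(1)] D_def of_nat_sum by (intro sum.cong) auto
    then have "hamming (simhash d k \<omega> r p) (simhash d k \<omega> r q) \<le> hamming (simhash d k \<omega> r p') (simhash d k \<omega> r q)
        \<longleftrightarrow> (\<Sum>j<k. D p j \<omega>) \<le> (\<Sum>j<k. D p' j \<omega>)" for \<omega>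
      using dims by (metis of_nat_le_iff)
    then show ?thesis by (simp add: X_def sum_subtractf)
  qed
  \<comment> \<open>Misordering means that the sum falls from its mean to 0, a deviation of the full
    mean. The terms range over [-1, 1], so the exponent is -2 \<open>\<mu>\<close>^2 / (4 k), and
    \<open>\<mu>\<close> >= k \<open>\<theta>\<close> / 100 produces 2 * 100^2 = 20000.\<close>
  also have "prob \<dots> \<le> exp (- 2 * \<mu>\<^sup>2 / (\<Sum>j<k. (1 - - 1)\<^sup>2))"
  proof (rule H.Hoeffding_ineq_le)
    show "0 \<le> \<mu>" using \<mu> \<theta> by (intro order_trans[OF _ \<mu>]) auto
  qed (use pos in auto)
  also have "\<dots> \<le> exp (- (k * \<theta>\<^sup>2 / 20000))"
  proof -
    have "(k * (\<theta> / 100))\<^sup>2 \<le> \<mu>\<^sup>2" using \<mu> \<theta> by (intro power_mono) auto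
    then have "k * (k * \<theta>\<^sup>2 / 20000) \<le> \<mu>\<^sup>2 / 2" by (simp add: power2_eq_square field_simps)
    then have "k * \<theta>\<^sup>2 / 20000 \<le> \<mu>\<^sup>2 / 2 / k" using pos by (simp add: field_simps)
    then show ?thesis by (simp add: field_simps)
  qed
  finally show ?thesis .
qed

text \<open>Equal Hamming distances count as misordered. A repetition that is not misordered is
  therefore safe for every way of breaking ties.\<close>

definition misordered :: "real \<Rightarrow> real vec set \<Rightarrow> real vec set \<Rightarrow> nat \<Rightarrow> randomness \<Rightarrow> bool" where
  "misordered \<theta> Q P r \<omega> \<longleftrightarrow> (\<exists>q\<in>Q. \<exists>p\<in>P. \<exists>p'\<in>P. q \<bullet> p < q \<bullet> p' - \<theta> \<and>
     hamming (simhash d k \<omega> r p) (simhash d k \<omega> r q) \<le> hamming (simhash d k \<omega> r p') (simhash d k \<omega> r q))"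

lemma hash_event:
  assumes "r < R" "p \<in> carrier_vec d" "p' \<in> carrier_vec d" "q \<in> carrier_vec d"
  shows "{\<omega> \<in> space M. hamming (simhash d k \<omega> r p) (simhash d k \<omega> r q) \<le>
      hamming (simhash d k \<omega> r p') (simhash d k \<omega> r q)} \<in> events"
  by (rule sets_finite_discrete[where A="{p, p', q}" and X="\<lambda>x \<omega>. simhash d k \<omega> r x" and
        \<Psi>="\<lambda>z. hamming (z p) (z q) \<le> hamming (z p') (z q)"])
    (use assms simhash_measurable in auto)

lemma misordered_event:
  assumes "r < R" and Q: "unit_vec_set d Q" and P: "unit_vec_set d P"
  shows "{\<omega> \<in> space M. misordered \<theta> Q P r \<omega>} \<in> events"
  unfolding misordered_def
  using assms unit_vec_setD(1,3)[OF Q] unit_vec_setD(1,3)[OF P]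
  by (intro sets.sets_Collect_finite_Ex sets.sets_Collect_conj sets.sets_Collect_const hash_event) auto

text \<open>Union bound over triples. One-point documents are split off: they allow m = 2, where for
  \<open>\<epsilon>\<close> just below 2 there may be a single hash bit and the exponential bound
  would be too weak.\<close>

lemma prob_misordered:
  fixes \<theta> :: real
  assumes r: "r < R" and Q: "unit_vec_set d Q" and P: "unit_vec_set d P" and \<theta>: "0 \<le> \<theta>"
  shows "prob {\<omega> \<in> space M. misordered \<theta> Q P r \<omega>} \<le>
    (if card P \<le> 1 then 0 else real (card Q * card P * card P) * exp (- (k * \<theta>\<^sup>2 / 20000)))"
proof (cases "card P \<le> 1")
  case True
  have "p = p'" if "p \<in> P" "p' \<in> P" for p p'
    using True that unit_vec_setD(1)[OF P] by (metis One_nat_def card_le_Suc0_iff_eq)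
  then have "\<not> misordered \<theta> Q P r \<omega>" for \<omega>
    unfolding misordered_def using \<theta> by force
  then show ?thesis using True by simp
next
  case False
  note DQ = unit_vec_setD[OF Q] and DP = unit_vec_setD[OF P]
  define T where "T = {t \<in> Q \<times> P \<times> P. fst t \<bullet> fst (snd t) < fst t \<bullet> snd (snd t) - \<theta>}"
  have T: "finite T" "card T \<le> card Q * card P * card P"
  proof -
    show "finite T" unfolding T_def using DQ DP by auto
    have "card T \<le> card (Q \<times> P \<times> P)" unfolding T_def using DQ DP by (intro card_mono) auto
    then show "card T \<le> card Q * card P * card P" by (simp add: card_cartesian_product mult.assoc)
  qed
  define E where "E t = {\<omega> \<in> space M. hamming (simhash d k \<omega> r (fst (snd t))) (simhash d k \<omega> r (fst t)) \<le>
      hamming (simhash d k \<omega> r (snd (snd t))) (simhash d k \<omega> r (fst t))}" for t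
  have "{\<omega> \<in> space M. misordered \<theta> Q P r \<omega>} = (\<Union>t\<in>T. E t)"
    by (force simp: misordered_def T_def E_def)
  also have "prob \<dots> \<le> (\<Sum>t\<in>T. prob (E t))"
  proof (rule finite_measure_subadditive_finite[OF T(1)])
    show "E ` T \<subseteq> events" unfolding E_def T_def using DQ(3) DP(3) r by (auto intro!: hash_event)
  qed
  also have "\<dots> \<le> (\<Sum>t\<in>T. exp (- (k * \<theta>\<^sup>2 / 20000)))"
  proof (rule sum_mono)
    fix t assume "t \<in> T"
    then show "prob (E t) \<le> exp (- (k * \<theta>\<^sup>2 / 20000))"
      unfolding E_def T_def using DQ(3,6) DP(3,6) r \<theta> by (intro prob_misordered_le) auto
  qed
  also have "\<dots> = real (card T) * exp (- (k * \<theta>\<^sup>2 / 20000))" by simp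
  also have "\<dots> \<le> real (card Q * card P * card P) * exp (- (k * \<theta>\<^sup>2 / 20000))"
    using T(2) by (intro mult_right_mono) (simp_all only: of_nat_le_iff exp_ge_zero)
  finally show ?thesis using False by simp
qed

definition misordered_count :: "real \<Rightarrow> real vec set \<Rightarrow> real vec set \<Rightarrow> randomness \<Rightarrow> real" where
  "misordered_count \<theta> Q P \<omega> = (\<Sum>r<R. of_bool (misordered \<theta> Q P r \<omega>))"

lemma misordered_count_measurable:
  assumes "unit_vec_set d Q" "unit_vec_set d P"
  shows "misordered_count \<theta> Q P \<in> borel_measurable M"
proof -
  have "Measurable.pred M (misordered \<theta> Q P r)" if "r < R" for r
    using misordered_event[OF that assms] by (simp add: pred_def)
  then show ?thesis unfolding misordered_count_def
    by (intro borel_measurable_sum measurable_compose[of _ M "count_space UNIV" of_bool]) auto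
qed

text \<open>The mean number is at most t R, and the threshold leaves a deviation of another t R;
  Hoeffding's inequality with R terms in [0, 1] gives the exponent -2 (R t)^2 / R.\<close>

lemma prob_misordered_count:
  fixes t :: real
  assumes Q: "unit_vec_set d Q" and P: "unit_vec_set d P" and t: "0 \<le> t"
    and p: "\<And>r. r < R \<Longrightarrow> prob {\<omega> \<in> space M. misordered \<theta> Q P r \<omega>} \<le> t"
  shows "prob {\<omega> \<in> space M. misordered_count \<theta> Q P \<omega> \<ge> 2 * t * R} \<le> exp (- 2 * real R * t\<^sup>2)"
proof -
  note DQ = unit_vec_setD[OF Q] and DP = unit_vec_setD[OF P]
  define X where "X r \<omega> = (of_bool (misordered \<theta> Q P r \<omega>) :: real)" for r \<omega>
  define K where "K r = {r} \<times> {..<k} \<times> {..<d}" for r :: nat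
  \<comment> \<open>Misordering depends on the Gaussian part of the outcome only, so any value may
    fill the sign part; this makes it a function of the Gaussians of repetition r.\<close>
  define f where "f r z = (of_bool (misordered \<theta> Q P r (z, undefined)) :: real)" for r z
  have hb: "hash_bit r j x ((\<lambda>i\<in>K r. fst \<omega> i), undefined) = hash_bit r j x \<omega>" if "j < k" for r j x \<omega>
    using that by (simp add: hash_bit_def sum_GK K_def)
  have sh: "simhash d k ((\<lambda>i\<in>K r. fst \<omega> i), undefined) r x = simhash d k \<omega> r x" if "x \<in> carrier_vec d" for r x \<omega>
    using that hb by (simp add: simhash_eq)
  have fX: "f r (\<lambda>i\<in>K r. fst \<omega> i) = X r \<omega>" for r \<omega>
  proof -
    have "misordered \<theta> Q P r ((\<lambda>i\<in>K r. fst \<omega> i), undefined) = misordered \<theta> Q P r \<omega>"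
      unfolding misordered_def using DQ(3) DP(3) sh by (intro bex_cong refl) (auto simp: subset_iff)
    then show ?thesis by (simp add: f_def X_def)
  qed
  have fm: "f r \<in> borel_measurable (PiM (K r) (\<lambda>_. borel))" for r
  proof -
    let ?N = "PiM (K r) (\<lambda>_. borel :: real measure)"
    have "(\<lambda>z. \<Sum>l<d. z (r, j, l) * x $ l) \<in> borel_measurable ?N" if "j < k" for j and x :: "real vec"
      using that by (intro borel_measurable_sum borel_measurable_times measurable_component_singleton) (auto simp: K_def)
    then have hm: "(\<lambda>z. hash_bit r j x (z, undefined)) \<in> ?N \<rightarrow>\<^sub>M count_space UNIV" if "j < k" for j x
      unfolding hash_bit_def sum_GK using that by simp
    have sm: "(\<lambda>z. simhash d k (z, undefined) r x) \<in> ?N \<rightarrow>\<^sub>M count_space UNIV" if x: "x \<in> carrier_vec d" for x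
    proof -
      have "{z \<in> space ?N. simhash d k (z, undefined) r x = b} \<in> sets ?N" for b
      proof (rule sets_finite_discrete[where A="{..<k}" and X="\<lambda>j z. hash_bit r j x (z, undefined)"
            and \<Psi>="\<lambda>h. map h [0..<k] = b"])
        show "simhash d k (z, undefined) r x = b \<longleftrightarrow> map (\<lambda>j\<in>{..<k}. hash_bit r j x (z, undefined)) [0..<k] = b" for z
        proof -
          have "map (\<lambda>j\<in>{..<k}. hash_bit r j x (z, undefined)) [0..<k] = map (\<lambda>j. hash_bit r j x (z, undefined)) [0..<k]"
            by (rule map_cong) auto
          then show ?thesis using x by (simp only: simhash_eq)
        qed
      qed (use hm in auto)
      then show ?thesis
        by (subst measurable_count_space_eq_countable) (auto simp: vimage_def Int_def conj_commute)
    qed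
    have "{z \<in> space ?N. misordered \<theta> Q P r (z, undefined)} \<in> sets ?N"
      unfolding misordered_def
    proof (intro sets.sets_Collect_finite_Ex sets.sets_Collect_conj sets.sets_Collect_const)
      fix q p p' assume "q \<in> Q" "p \<in> P" "p' \<in> P"
      then show "{z \<in> space ?N. hamming (simhash d k (z, undefined) r p) (simhash d k (z, undefined) r q) \<le>
          hamming (simhash d k (z, undefined) r p') (simhash d k (z, undefined) r q)} \<in> sets ?N"
        using DQ(3) DP(3) sm
        by (intro sets_finite_discrete[where A="{p, p', q}" and X="\<lambda>x z. simhash d k (z, undefined) r x" and
           \<Psi>="\<lambda>z. hamming (z p) (z q) \<le> hamming (z p') (z q)"]) auto
    qed (use DQ DP in auto)
    then have "Measurable.pred ?N (\<lambda>z. misordered \<theta> Q P r (z, undefined))" by (simp add: pred_def)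
    then show ?thesis unfolding f_def by (rule measurable_compose) auto
  qed
  have "indep_vars (\<lambda>_. borel) (\<lambda>r \<omega>. f r (\<lambda>i\<in>K r. fst \<omega> i)) {..<R}"
    by (rule indep_vars_blocks[OF gaussians(1) _ _ fm]) (auto simp: K_def GI_def disjoint_family_on_def)
  then have ind: "indep_vars (\<lambda>_. borel) X {..<R}" by (simp add: fX)
  define \<mu> where "\<mu> = (\<Sum>r<R. expectation (X r))"
  have \<mu>: "\<mu> \<le> R * t"
  proof -
    have "expectation (X r) \<le> t" if "r < R" for r
    proof -
      have "expectation (X r) = expectation (indicator {\<omega> \<in> space M. misordered \<theta> Q P r \<omega>})"
        by (rule Bochner_Integration.integral_cong) (auto simp: X_def indicator_def)
      also have "\<dots> = prob {\<omega> \<in> space M. misordered \<theta> Q P r \<omega>}"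
        by (subst Bochner_Integration.integral_indicator) (auto intro!: arg_cong[where f=prob])
      finally show ?thesis using p[OF that] by simp
    qed
    then show ?thesis unfolding \<mu>_def using sum_mono[of "{..<R}" "\<lambda>r. expectation (X r)" "\<lambda>_. t"] by simp
  qed
  interpret H: Hoeffding_ineq M "{..<R}" X "\<lambda>_. 0" "\<lambda>_. 1" \<mu>
    by unfold_locales (use ind in \<open>auto simp: \<mu>_def X_def\<close>)
  have [measurable]: "misordered_count \<theta> Q P \<in> borel_measurable M" by (rule misordered_count_measurable[OF Q P])
  have "prob {\<omega> \<in> space M. misordered_count \<theta> Q P \<omega> \<ge> 2 * t * R} \<le>
      prob {\<omega> \<in> space M. misordered_count \<theta> Q P \<omega> \<ge> \<mu> + R * t}"
  proof (rule finite_measure_mono)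
    show "{\<omega> \<in> space M. misordered_count \<theta> Q P \<omega> \<ge> 2 * t * R} \<subseteq> {\<omega> \<in> space M. misordered_count \<theta> Q P \<omega> \<ge> \<mu> + R * t}"
      using \<mu> by (auto simp: algebra_simps)
  qed measurable
  also have "\<dots> = prob {\<omega> \<in> space M. (\<Sum>r<R. X r \<omega>) \<ge> \<mu> + R * t}"
    by (simp add: misordered_count_def X_def)
  also have "\<dots> \<le> exp (- 2 * (R * t)\<^sup>2 / (\<Sum>r<R. (1 - 0)\<^sup>2))"
    by (rule H.Hoeffding_ineq_ge) (use t pos in auto)
  also have "- 2 * (R * t)\<^sup>2 / (\<Sum>r<R. (1 - 0)\<^sup>2) = - 2 * real R * t\<^sup>2"
    using pos by (simp add: power2_eq_square field_simps)
  finally show ?thesis .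
qed

end

section \<open>Document blocks as averages of nearest points\<close>

text \<open>Unifies the two cases of a block: in an occupied cluster all averaged points have
  Hamming distance 0, and a filled-in point is the average over a singleton. Either way the block
  averages points of least distance to the cluster.\<close>

lemma doc_block_average:
  assumes P: "finite P" "P \<noteq> {}" "P \<subseteq> carrier_vec d" and b: "is_doc_block d \<phi> P \<beta> b" and len: "\<And>p. length (\<phi> p) = length \<beta>"
  obtains C where "C \<subseteq> P" "C \<noteq> {}" "b = (1 / real (card C)) \<cdot>\<^sub>v vec_sum d C"
    "\<And>p p'. p \<in> C \<Longrightarrow> p' \<in> P \<Longrightarrow> hamming (\<phi> p) \<beta> \<le> hamming (\<phi> p') \<beta>"
proof (cases "{p \<in> P. \<phi> p = \<beta>} = {}")
  case False
  show ?thesis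
  proof (rule that)
    show "b = (1 / real (card {p \<in> P. \<phi> p = \<beta>})) \<cdot>\<^sub>v vec_sum d {p \<in> P. \<phi> p = \<beta>}"
      using b False by (simp add: is_doc_block_def Let_def)
    show "hamming (\<phi> p) \<beta> \<le> hamming (\<phi> p') \<beta>" if "p \<in> {p \<in> P. \<phi> p = \<beta>}" for p p'
      using that by (simp add: hamming_def)
  qed (use False in auto)
next
  case True
  then have bP: "b \<in> P" "\<forall>p\<in>P. hamming (\<phi> b) \<beta> \<le> hamming (\<phi> p) \<beta>"
    using b by (auto simp: is_doc_block_def Let_def)
  then have bc: "b \<in> carrier_vec d" using P by auto
  show ?thesis
  proof (rule that[of "{b}"])
    have "vec_sum d {b} = b"
      using vec_sum_index[of "{b}" d] vec_sum_closed[of "{b}" d] bc by (intro eq_vecI) auto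
    then show "b = (1 / real (card {b})) \<cdot>\<^sub>v vec_sum d {b}" by simp
  qed (use bP in auto)
qed

lemma scalar_prod_mult_mat_vec_average:
  assumes C: "finite C" "C \<subseteq> carrier_vec d" and A: "dim_col A = d"
  shows "w \<bullet> (A *\<^sub>v ((1 / c) \<cdot>\<^sub>v vec_sum d C)) = (\<Sum>p\<in>C. w \<bullet> (A *\<^sub>v p)) / (c :: real)"
proof -
  have vs: "vec_sum d C \<in> carrier_vec d" using C(2) by (rule vec_sum_closed)
  have "A *\<^sub>v ((1 / c) \<cdot>\<^sub>v vec_sum d C) = (1 / c) \<cdot>\<^sub>v (A *\<^sub>v vec_sum d C)"
    using vs A by (intro mult_mat_vec[of A "dim_row A" d]) auto
  then have "w \<bullet> (A *\<^sub>v ((1 / c) \<cdot>\<^sub>v vec_sum d C)) = (\<Sum>i<dim_row A. w $ i * ((A *\<^sub>v vec_sum d C) $ i)) / c"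
    by (simp add: scalar_prod_def[of w] atLeast0LessThan sum_divide_distrib mult_ac)
  also have "(\<Sum>i<dim_row A. w $ i * ((A *\<^sub>v vec_sum d C) $ i)) = (\<Sum>i<dim_row A. w $ i * (\<Sum>p\<in>C. (A *\<^sub>v p) $ i))"
    using mult_mat_vec_vec_sum[OF C A] by (intro sum.cong refl) auto
  also have "\<dots> = (\<Sum>p\<in>C. w \<bullet> (A *\<^sub>v p))"
    by (simp add: scalar_prod_def[of w] atLeast0LessThan sum_distrib_left sum.swap[of _ C])
  finally show ?thesis .
qed

lemma unit_scalar_prod_abs_le:
  assumes "unit_vec_set d Q" "unit_vec_set d P" "q \<in> Q" "p \<in> P"
  shows "\<bar>q \<bullet> p\<bar> \<le> 1"
proof -
  have "q \<bullet> p = (\<Sum>l<d. q $ l * p $ l)"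
    using unit_vec_setD(3)[OF assms(2)] assms(4) by (auto simp: scalar_prod_def atLeast0LessThan)
  then show ?thesis
    using abs_sum_mult_le_one[where I="{..<d}" and x="($) q" and y="($) p"] unit_vec_setD(6)[OF assms(1,3)] unit_vec_setD(6)[OF assms(2,4)] by simp
qed

lemma average_bounds:
  fixes f :: "'a \<Rightarrow> real"
  assumes "finite C" "C \<noteq> {}"
  shows "(\<And>x. x \<in> C \<Longrightarrow> f x \<le> u) \<Longrightarrow> (\<Sum>x\<in>C. f x) / real (card C) \<le> u"
    and "(\<And>x. x \<in> C \<Longrightarrow> u \<le> f x) \<Longrightarrow> u \<le> (\<Sum>x\<in>C. f x) / real (card C)"
proof -
  have c: "real (card C) > 0" using assms by (simp add: card_gt_0_iff)
  show "(\<Sum>x\<in>C. f x) / real (card C) \<le> u" if "\<And>x. x \<in> C \<Longrightarrow> f x \<le> u"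
    using sum_bounded_above[of C f u] that c by (simp add: field_simps)
  show "u \<le> (\<Sum>x\<in>C. f x) / real (card C)" if "\<And>x. x \<in> C \<Longrightarrow> u \<le> f x"
    using sum_bounded_below[of C u f] that c by (simp add: field_simps)
qed

section \<open>Projection errors and the accuracy of one score\<close>

context fde_parameters
begin

definition SK :: "nat \<Rightarrow> nat \<Rightarrow> (nat \<times> nat \<times> nat) set" where "SK r i = {r} \<times> {i} \<times> {..<d}"

lemma sum_SK: "(\<Sum>x\<in>SK r i. f x) = (\<Sum>l<d. f (r, i, l))"
  unfolding SK_def by (rule sum.reindex_bij_witness[of _ "\<lambda>l. (r, i, l)" "\<lambda>x. snd (snd x)"]) auto

lemma proj_mat_apply:
  assumes "q \<in> carrier_vec d" "i < dp"
  shows "(proj_mat d dp \<omega> r *\<^sub>v q) $ i =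
    (if dp = d then q $ i else (\<Sum>x\<in>SK r i. snd \<omega> x * q $ snd (snd x)) / sqrt dp)"
proof (cases "dp = d")
  case True
  then show ?thesis using assms by (simp add: proj_mat_def)
next
  case False
  then show ?thesis using assms
    by (simp add: proj_mat_def sum_SK scalar_prod_def atLeast0LessThan sum_divide_distrib)
qed

lemma proj_mat_apply_measurable:
  assumes "q \<in> carrier_vec d" "i < dp" "r < R"
  shows "(\<lambda>\<omega>. (proj_mat d dp \<omega> r *\<^sub>v q) $ i) \<in> borel_measurable M"
proof -
  have "(\<lambda>\<omega>. \<Sum>x\<in>SK r i. snd \<omega> x * q $ snd (snd x)) \<in> borel_measurable M"
    using assms(2,3) by (intro borel_measurable_sum borel_measurable_times rademacher_rv[OF rademacher_signs])
      (auto simp: SK_def SI_def)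
  then show ?thesis unfolding proj_mat_apply[OF assms(1,2)] by simp
qed

definition proj_dot :: "nat \<Rightarrow> real vec \<Rightarrow> real vec \<Rightarrow> randomness \<Rightarrow> real" where
  "proj_dot r q p \<omega> = (proj_mat d dp \<omega> r *\<^sub>v q) \<bullet> (proj_mat d dp \<omega> r *\<^sub>v p)"

lemma proj_dot_measurable:
  assumes "q \<in> carrier_vec d" "p \<in> carrier_vec d" "r < R"
  shows "proj_dot r q p \<in> borel_measurable M"
proof -
  have "proj_dot r q p = (\<lambda>\<omega>. \<Sum>i<dp. (proj_mat d dp \<omega> r *\<^sub>v q) $ i * (proj_mat d dp \<omega> r *\<^sub>v p) $ i)"
    by (rule ext) (simp add: proj_dot_def scalar_prod_def[of "_ *\<^sub>v _"] atLeast0LessThan)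
  also have "\<dots> \<in> borel_measurable M"
    by (intro borel_measurable_sum borel_measurable_times proj_mat_apply_measurable) (use assms in auto)
  finally show ?thesis .
qed

text \<open>Above the threshold the whole error is kept rather than its part beyond e; this is the
  quantity that \<open>rademacher_rows_excess\<close> controls, and e plus it still bounds the
  error.\<close>

definition excess :: "real \<Rightarrow> nat \<Rightarrow> real vec \<Rightarrow> real vec \<Rightarrow> randomness \<Rightarrow> real" where
  "excess e r q p \<omega> = (if \<bar>proj_dot r q p \<omega> - q \<bullet> p\<bar> > e then \<bar>proj_dot r q p \<omega> - q \<bullet> p\<bar> else 0)"

lemma excess_nonneg: "0 \<le> excess e r q p \<omega>"
  by (simp add: excess_def)

lemma excess_ge: "0 \<le> e \<Longrightarrow> \<bar>proj_dot r q p \<omega> - q \<bullet> p\<bar> \<le> e + excess e r q p \<omega>"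
  by (simp add: excess_def)

lemma excess_measurable:
  assumes "q \<in> carrier_vec d" "p \<in> carrier_vec d" "r < R"
  shows "excess e r q p \<in> borel_measurable M"
  using proj_dot_measurable[OF assms] unfolding excess_def[abs_def] by measurable

text \<open>In the case dp = d the projection is the identity and makes no error; otherwise the rows
  of the sign matrix form the independent blocks, each row contributing a product of mean
  \<open>q \<bullet> p\<close>.\<close>

lemma nn_integral_excess:
  fixes e :: real
  assumes dims: "q \<in> carrier_vec d" "p \<in> carrier_vec d" and r: "r < R"
    and unit: "(\<Sum>l<d. (q $ l)\<^sup>2) = 1" "(\<Sum>l<d. (p $ l)\<^sup>2) = 1" and e: "0 < e" "e \<le> 1"
  shows "(\<integral>\<^sup>+\<omega>. excess e r q p \<omega> \<partial>M) \<le> ennreal (4096 / (dp * e) * exp (- (dp * e\<^sup>2 / 4096)))"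
proof (cases "dp = d")
  case True
  then have "proj_mat d dp \<omega> r *\<^sub>v x = x" if "x \<in> carrier_vec d" for x \<omega>
    using that by (simp add: proj_mat_def)
  then have "proj_dot r q p \<omega> = q \<bullet> p" for \<omega>
    using dims by (simp add: proj_dot_def)
  then have "excess e r q p \<omega> = 0" for \<omega> using e by (simp add: excess_def)
  then show ?thesis by simp
next
  case False
  let ?x = "\<lambda>i. q $ snd (snd i)" and ?y = "\<lambda>i. p $ snd (snd i)"
  have dot: "proj_dot r q p \<omega> = (\<Sum>j<dp. (\<Sum>i\<in>SK r j. snd \<omega> i * ?x i) * (\<Sum>i\<in>SK r j. snd \<omega> i * ?y i)) / card {..<dp}" for \<omega>
  proof -
    have "proj_dot r q p \<omega> = (\<Sum>j<dp. (proj_mat d dp \<omega> r *\<^sub>v q) $ j * (proj_mat d dp \<omega> r *\<^sub>v p) $ j)"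
      by (simp add: proj_dot_def scalar_prod_def[of "_ *\<^sub>v _"] atLeast0LessThan)
    also have "\<dots> = (\<Sum>j<dp. (\<Sum>i\<in>SK r j. snd \<omega> i * ?x i) * (\<Sum>i\<in>SK r j. snd \<omega> i * ?y i) / dp)"
    proof (intro sum.cong refl)
      fix j assume "j \<in> {..<dp}"
      then have j: "j < dp" by simp
      show "(proj_mat d dp \<omega> r *\<^sub>v q) $ j * (proj_mat d dp \<omega> r *\<^sub>v p) $ j =
          (\<Sum>i\<in>SK r j. snd \<omega> i * ?x i) * (\<Sum>i\<in>SK r j. snd \<omega> i * ?y i) / dp"
        unfolding proj_mat_apply[OF dims(1) j] proj_mat_apply[OF dims(2) j] using False by simp
    qed
    finally show ?thesis by (simp add: sum_divide_distrib)
  qed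
  have "(\<integral>\<^sup>+\<omega>. ennreal (if \<bar>(\<Sum>j<dp. (\<Sum>i\<in>SK r j. snd \<omega> i * ?x i) * (\<Sum>i\<in>SK r j. snd \<omega> i * ?y i)) / card {..<dp} - q \<bullet> p\<bar> > e
      then \<bar>(\<Sum>j<dp. (\<Sum>i\<in>SK r j. snd \<omega> i * ?x i) * (\<Sum>i\<in>SK r j. snd \<omega> i * ?y i)) / card {..<dp} - q \<bullet> p\<bar> else 0) \<partial>M)
    \<le> ennreal (4096 / (card {..<dp} * e) * exp (- (card {..<dp} * e\<^sup>2 / 4096)))"
  proof (rule rademacher_rows_excess[OF rademacher_signs])
    show "SK r j \<subseteq> SI" if "j \<in> {..<dp}" for j using that r by (auto simp: SK_def SI_def)
    show "disjoint_family_on (SK r) {..<dp}" by (auto simp: disjoint_family_on_def SK_def)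
    show "(\<Sum>i\<in>SK r j. q $ snd (snd i) * p $ snd (snd i)) = q \<bullet> p" for j
      using dims by (simp add: sum_SK scalar_prod_def atLeast0LessThan)
  qed (use unit e pos in \<open>auto simp: sum_SK lessThan_empty_iff\<close>)
  then show ?thesis unfolding excess_def dot[symmetric] by simp
qed

text \<open>An average over the repetitions but a sum over Q and P: the sum over P dominates the
  excess of whichever points a block averages.\<close>

definition mean_excess :: "real \<Rightarrow> real vec set \<Rightarrow> real vec set \<Rightarrow> randomness \<Rightarrow> real" where
  "mean_excess e Q P \<omega> = (\<Sum>r<R. \<Sum>q\<in>Q. \<Sum>p\<in>P. excess e r q p \<omega>) / R"

lemma mean_excess_nonneg: "0 \<le> mean_excess e Q P \<omega>"
  unfolding mean_excess_def by (intro divide_nonneg_nonneg sum_nonneg excess_nonneg) auto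

lemma mean_excess_measurable:
  assumes "unit_vec_set d Q" "unit_vec_set d P"
  shows "mean_excess e Q P \<in> borel_measurable M"
  unfolding mean_excess_def[abs_def]
  using unit_vec_setD(3)[OF assms(1)] unit_vec_setD(3)[OF assms(2)]
  by (intro borel_measurable_divide borel_measurable_sum excess_measurable) auto

text \<open>By linearity all repetitions contribute the same bound and the division by R cancels
  their number, so that R does not occur on the right.\<close>

lemma nn_integral_mean_excess:
  fixes e :: real
  assumes Q: "unit_vec_set d Q" and P: "unit_vec_set d P" and e: "0 < e" "e \<le> 1"
  shows "(\<integral>\<^sup>+\<omega>. mean_excess e Q P \<omega> \<partial>M) \<le>
    ennreal (card Q * card P * (4096 / (dp * e) * exp (- (dp * e\<^sup>2 / 4096))))"
proof -
  note DQ = unit_vec_setD[OF Q] and DP = unit_vec_setD[OF P]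
  define B where "B = 4096 / (dp * e) * exp (- (dp * e\<^sup>2 / 4096))"
  have B: "0 \<le> B" using e by (simp add: B_def)
  have split: "ennreal (mean_excess e Q P \<omega>) = (\<Sum>r<R. \<Sum>q\<in>Q. \<Sum>p\<in>P. ennreal (1 / R) * ennreal (excess e r q p \<omega>))" for \<omega>
  proof -
    have "mean_excess e Q P \<omega> = (\<Sum>r<R. \<Sum>q\<in>Q. \<Sum>p\<in>P. 1 / R * excess e r q p \<omega>)"
      by (simp add: mean_excess_def sum_divide_distrib)
    then show ?thesis
      by (simp add: sum_ennreal[symmetric] ennreal_mult'[symmetric] excess_nonneg sum_nonneg del: sum_ennreal)
  qed
  have m: "(\<lambda>\<omega>. ennreal (excess e r q p \<omega>)) \<in> borel_measurable M" if "r < R" "q \<in> Q" "p \<in> P" for r q p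
  proof -
    have "excess e r q p \<in> borel_measurable M"
      by (rule excess_measurable) (use DQ(3) DP(3) that in auto)
    then show ?thesis by simp
  qed
  have cm: "(\<lambda>\<omega>. ennreal (1 / R) * ennreal (excess e r q p \<omega>)) \<in> borel_measurable M" if "r < R" "q \<in> Q" "p \<in> P" for r q p
    using m[OF that] by simp
  have "(\<integral>\<^sup>+\<omega>. mean_excess e Q P \<omega> \<partial>M) = (\<Sum>r<R. \<Sum>q\<in>Q. \<Sum>p\<in>P. ennreal (1 / R) * (\<integral>\<^sup>+\<omega>. excess e r q p \<omega> \<partial>M))"
  proof -
    have "(\<integral>\<^sup>+\<omega>. mean_excess e Q P \<omega> \<partial>M) = (\<Sum>r<R. \<integral>\<^sup>+\<omega>. (\<Sum>q\<in>Q. \<Sum>p\<in>P. ennreal (1 / R) * ennreal (excess e r q p \<omega>)) \<partial>M)"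
      unfolding split by (rule nn_integral_sum) (intro borel_measurable_sum cm, auto)
    also have "\<dots> = (\<Sum>r<R. \<Sum>q\<in>Q. \<integral>\<^sup>+\<omega>. (\<Sum>p\<in>P. ennreal (1 / R) * ennreal (excess e r q p \<omega>)) \<partial>M)"
      by (intro sum.cong refl nn_integral_sum borel_measurable_sum cm) auto
    also have "\<dots> = (\<Sum>r<R. \<Sum>q\<in>Q. \<Sum>p\<in>P. \<integral>\<^sup>+\<omega>. ennreal (1 / R) * ennreal (excess e r q p \<omega>) \<partial>M)"
      by (intro sum.cong refl nn_integral_sum cm) auto
    also have "\<dots> = (\<Sum>r<R. \<Sum>q\<in>Q. \<Sum>p\<in>P. ennreal (1 / R) * (\<integral>\<^sup>+\<omega>. excess e r q p \<omega> \<partial>M))"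
      by (intro sum.cong refl nn_integral_cmult m) auto
    finally show ?thesis .
  qed
  also have "\<dots> \<le> (\<Sum>r<R. \<Sum>q\<in>Q. \<Sum>p\<in>P. ennreal (1 / R) * ennreal B)"
    unfolding B_def using DQ(3,6) DP(3,6) e
    by (intro sum_mono mult_left_mono nn_integral_excess) auto
  also have "\<dots> = ennreal (\<Sum>r<R. \<Sum>q\<in>Q. \<Sum>p\<in>P. 1 / R * B)"
    using B by (simp add: sum_ennreal[symmetric] ennreal_mult'[symmetric] sum_nonneg del: sum_ennreal sum_constant)
  also have "(\<Sum>r<R. \<Sum>q\<in>Q. \<Sum>p\<in>P. 1 / R * B) = card Q * card P * B" using pos by simp
  finally show ?thesis by (simp add: B_def)
qed

text \<open>The deterministic half of the accuracy. Up to projection errors, the contribution of a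
  query vector is an average of inner products with points of P. It never exceeds the maximum, and
  falls short of it by at most \<open>\<theta>\<close> unless the repetition is misordered.\<close>

lemma score_close:
  fixes e \<theta> u :: real
  assumes Q: "unit_vec_set d Q" and P: "unit_vec_set d P" and v: "is_fde_doc d k dp R \<omega> P v"
    and e: "0 \<le> e" "mean_excess e Q P \<omega> \<le> e" and \<theta>: "0 \<le> \<theta>"
    and u: "misordered_count \<theta> Q P \<omega> \<le> u * R"
  shows "\<bar>(fde_query d k dp R \<omega> Q \<bullet> v) / (R * card Q) - NChamfer Q P\<bar> \<le> 2 * e + \<theta> + 2 * u"
proof -
  note DQ = unit_vec_setD[OF Q] and DP = unit_vec_setD[OF P]
  obtain blk where blk: "\<And>r b. r < R \<Longrightarrow> length b = k \<Longrightarrow> is_doc_block d (simhash d k \<omega> r) P b (blk r b)"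
    and v: "v = fde_concat d k dp R \<omega> blk"
    using v unfolding is_fde_doc_def set_clusters by auto
  define mx where "mx q = (MAX p\<in>P. q \<bullet> p)" for q
  define T where "T r q = (proj_mat d dp \<omega> r *\<^sub>v q) \<bullet> (proj_mat d dp \<omega> r *\<^sub>v blk r (simhash d k \<omega> r q))" for r q
  define ex where "ex r q = (\<Sum>p\<in>P. excess e r q p \<omega>)" for r q
  define w where "w r = (of_bool (misordered \<theta> Q P r \<omega>) :: real)" for r
  have main: "T r q \<le> mx q + (e + ex r q) \<and> mx q - \<theta> - 2 * w r - (e + ex r q) \<le> T r q" if r: "r < R" and q: "q \<in> Q" for r q
  proof -
    obtain C where C: "C \<subseteq> P" "C \<noteq> {}" "blk r (simhash d k \<omega> r q) = (1 / real (card C)) \<cdot>\<^sub>v vec_sum d C"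
      and near: "\<And>p p'. p \<in> C \<Longrightarrow> p' \<in> P \<Longrightarrow> hamming (simhash d k \<omega> r p) (simhash d k \<omega> r q) \<le> hamming (simhash d k \<omega> r p') (simhash d k \<omega> r q)"
    proof (rule doc_block_average[OF DP(1,2,3) blk[OF r length_simhash]])
      show "length (simhash d k \<omega> r p) = length (simhash d k \<omega> r q)" for p by simp
    qed (rule that)
    have fC: "finite C" using C DP finite_subset by blast
    have T: "T r q = (\<Sum>p\<in>C. proj_dot r q p \<omega>) / real (card C)"
      unfolding T_def C(3) proj_dot_def
      by (rule scalar_prod_mult_mat_vec_average[OF fC]) (use C DP in auto)
    have dev: "\<bar>proj_dot r q p \<omega> - q \<bullet> p\<bar> \<le> e + ex r q" if "p \<in> P" for p
    proof -
      have "excess e r q p \<omega> \<le> ex r q"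
        unfolding ex_def by (rule member_le_sum[OF that]) (use DP excess_nonneg in auto)
      then show ?thesis using excess_ge[OF e(1), of r q p \<omega>] by linarith
    qed
    have le_mx: "q \<bullet> p \<le> mx q" if "p \<in> P" for p
      unfolding mx_def using that DP by (intro Max_ge) auto
    obtain p0 where p0: "p0 \<in> P" "mx q = q \<bullet> p0"
    proof -
      have "mx q \<in> (\<lambda>p. q \<bullet> p) ` P" unfolding mx_def using DP by (intro Max_in) auto
      then show ?thesis using that by auto
    qed
    \<comment> \<open>A misordered repetition can lose the whole range of [-1, 1], hence the weight
      2.\<close>
    have ge: "mx q - \<theta> - 2 * w r \<le> q \<bullet> p" if "p \<in> C" for p
    proof (cases "misordered \<theta> Q P r \<omega>")
      case True
      have "\<bar>q \<bullet> p\<bar> \<le> 1" "\<bar>q \<bullet> p0\<bar> \<le> 1"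
        using unit_scalar_prod_abs_le[OF Q P q] C(1) that p0 by auto
      then show ?thesis using True p0 \<theta> by (simp add: w_def)
    next
      case False
      then have "\<not> q \<bullet> p < q \<bullet> p0 - \<theta>"
        using near[OF that p0(1)] q C(1) that p0(1) unfolding misordered_def by blast
      then show ?thesis using False p0 by (simp add: w_def)
    qed
    have U: "proj_dot r q p \<omega> \<le> mx q + (e + ex r q)" if "p \<in> C" for p
    proof -
      have "p \<in> P" using that C by auto
      then show ?thesis using dev[of p] le_mx[of p] by linarith
    qed
    have V: "mx q - \<theta> - 2 * w r - (e + ex r q) \<le> proj_dot r q p \<omega>" if "p \<in> C" for p
    proof -
      have "p \<in> P" using that C by auto
      then show ?thesis using dev[of p] ge[OF that] by linarith
    qed
    show ?thesis unfolding T
    proof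
      show "(\<Sum>p\<in>C. proj_dot r q p \<omega>) / real (card C) \<le> mx q + (e + ex r q)"
        by (rule average_bounds(1)[OF fC C(2)]) (rule U)
      show "mx q - \<theta> - 2 * w r - (e + ex r q) \<le> (\<Sum>p\<in>C. proj_dot r q p \<omega>) / real (card C)"
        by (rule average_bounds(2)[OF fC C(2)]) (rule V)
    qed
  qed
  have q1: "real (card Q) \<ge> 1" using DQ by simp
  have R1: "real R \<ge> 1" using pos by simp
  define N where "N = real (card Q) * real R"
  have N: "N > 0" using q1 R1 by (simp add: N_def)
  define CH where "CH = (\<Sum>q\<in>Q. mx q)"
  have score: "fde_query d k dp R \<omega> Q \<bullet> v = (\<Sum>r<R. \<Sum>q\<in>Q. T r q)"
    unfolding v fde_query_scalar_prod_doc[OF DQ(1,3)] T_def ..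
  have NC: "R * CH = N * NChamfer Q P"
    using q1 by (simp add: CH_def N_def NChamfer_def Chamfer_def mx_def)
  \<comment> \<open>\<open>mean_excess\<close> already sums over Q, so its bound e is used against
    card Q >= 1 copies of e; nothing is lost in the normalized score.\<close>
  have EX: "(\<Sum>r<R. \<Sum>q\<in>Q. ex r q) \<le> N * e"
  proof -
    have "(\<Sum>r<R. \<Sum>q\<in>Q. ex r q) = R * mean_excess e Q P \<omega>"
      using R1 by (simp add: mean_excess_def ex_def)
    also have "\<dots> \<le> R * e" using e by (intro mult_left_mono) auto
    also have "\<dots> \<le> real (card Q) * (R * e)" using mult_right_mono[OF q1, of "R * e"] e by simp
    finally show ?thesis by (simp add: N_def mult_ac)
  qed
  have W: "(\<Sum>r<R. \<Sum>q\<in>Q. 2 * w r) \<le> 2 * N * u"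
  proof -
    have "(\<Sum>r<R. \<Sum>q\<in>Q. 2 * w r) = 2 * card Q * misordered_count \<theta> Q P \<omega>"
      unfolding misordered_count_def w_def[symmetric] by (simp add: sum_distrib_left mult_ac)
    also have "\<dots> \<le> 2 * card Q * (u * R)" using u by (intro mult_left_mono) auto
    finally show ?thesis by (simp add: N_def mult_ac)
  qed
  have "(\<Sum>r<R. \<Sum>q\<in>Q. T r q) \<le> (\<Sum>r<R. \<Sum>q\<in>Q. mx q + (e + ex r q))"
    by (intro sum_mono) (use main in auto)
  also have "\<dots> = R * CH + N * e + (\<Sum>r<R. \<Sum>q\<in>Q. ex r q)"
    by (simp add: sum.distrib CH_def N_def)
  also have "\<dots> \<le> N * NChamfer Q P + 2 * (N * e)" using EX NC by linarith
  also have "\<dots> = N * (NChamfer Q P + 2 * e)" by (simp add: algebra_simps)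
  finally have up: "(\<Sum>r<R. \<Sum>q\<in>Q. T r q) \<le> N * (NChamfer Q P + 2 * e)" .
  have "N * (NChamfer Q P - (2 * e + \<theta> + 2 * u)) = N * NChamfer Q P - 2 * (N * e) - N * \<theta> - 2 * N * u"
    by (simp add: algebra_simps)
  also have "\<dots> \<le> R * CH - N * \<theta> - (\<Sum>r<R. \<Sum>q\<in>Q. 2 * w r) - (N * e + (\<Sum>r<R. \<Sum>q\<in>Q. ex r q))"
    using EX NC W by linarith
  also have "\<dots> = (\<Sum>r<R. \<Sum>q\<in>Q. mx q - \<theta> - 2 * w r - (e + ex r q))"
    by (simp add: sum.distrib sum_subtractf CH_def N_def algebra_simps)
  also have "\<dots> \<le> (\<Sum>r<R. \<Sum>q\<in>Q. T r q)"
    by (intro sum_mono) (use main in auto)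
  finally have low: "N * (NChamfer Q P - (2 * e + \<theta> + 2 * u)) \<le> (\<Sum>r<R. \<Sum>q\<in>Q. T r q)" .
  have u0: "0 \<le> u"
  proof -
    have "0 \<le> misordered_count \<theta> Q P \<omega>" by (simp add: misordered_count_def sum_nonneg)
    then have "0 \<le> u * R" using u by linarith
    then show ?thesis using R1 by (simp add: zero_le_mult_iff)
  qed
  have "NChamfer Q P - (2 * e + \<theta> + 2 * u) \<le> (\<Sum>r<R. \<Sum>q\<in>Q. T r q) / N"
    using low N by (simp add: pos_le_divide_eq mult.commute)
  moreover have "(\<Sum>r<R. \<Sum>q\<in>Q. T r q) / N \<le> NChamfer Q P + 2 * e"
    using up N by (simp add: pos_divide_le_eq mult.commute)
  moreover have "(fde_query d k dp R \<omega> Q \<bullet> v) / (R * card Q) = (\<Sum>r<R. \<Sum>q\<in>Q. T r q) / N"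
    by (simp add: score N_def mult.commute)
  ultimately show ?thesis using \<theta> u0 by (simp only: abs_le_iff) linarith
qed

end

section \<open>Measurability of the accuracy event\<close>

lemma is_doc_block_cong:
  assumes "\<And>p. p \<in> P \<Longrightarrow> \<phi> p = \<psi> p"
  shows "is_doc_block d \<phi> P b v \<longleftrightarrow> is_doc_block d \<psi> P b v"
proof -
  have "{p \<in> P. \<phi> p = b} = {p \<in> P. \<psi> p = b}" using assms by auto
  then show ?thesis unfolding is_doc_block_def Let_def using assms by auto
qed

lemma fde_concat_cong:
  assumes "\<And>r b. r < R \<Longrightarrow> length b = k \<Longrightarrow> f r b = g r b"
  shows "fde_concat d k dp R \<omega> f = fde_concat d k dp R \<omega> g"
proof -
  have "map (\<lambda>b. list_of_vec (proj_mat d dp \<omega> r *\<^sub>v f r b)) (clusters k) = map (\<lambda>b. list_of_vec (proj_mat d dp \<omega> r *\<^sub>v g r b)) (clusters k)"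
    if "r < R" for r
    using assms that by (intro map_cong) (auto simp: set_clusters)
  then have "map (\<lambda>r. map (\<lambda>b. list_of_vec (proj_mat d dp \<omega> r *\<^sub>v f r b)) (clusters k)) [0..<R] =
    map (\<lambda>r. map (\<lambda>b. list_of_vec (proj_mat d dp \<omega> r *\<^sub>v g r b)) (clusters k)) [0..<R]"
    by (intro map_cong) auto
  then show ?thesis unfolding fde_concat_def by (simp only:)
qed

context fde_parameters
begin

text \<open>Which blocks are admissible varies with the outcome, but all of them belong to this
  fixed finite set.\<close>

definition doc_candidates :: "real vec set \<Rightarrow> real vec set" where
  "doc_candidates P = P \<union> (\<lambda>C. (1 / real (card C)) \<cdot>\<^sub>v vec_sum d C) ` Pow P"

lemma doc_candidates:
  assumes "unit_vec_set d P"
  shows "finite (doc_candidates P)" "doc_candidates P \<subseteq> carrier_vec d"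
    and "is_doc_block d \<phi> P b v \<Longrightarrow> v \<in> doc_candidates P"
proof -
  note DP = unit_vec_setD[OF assms]
  show "finite (doc_candidates P)" using DP by (simp add: doc_candidates_def)
  show "doc_candidates P \<subseteq> carrier_vec d"
  proof -
    have "(1 / real (card C)) \<cdot>\<^sub>v vec_sum d C \<in> carrier_vec d" if "C \<in> Pow P" for C
      using vec_sum_closed[of C d] DP(3) that by (intro smult_carrier_vec[THEN iffD2]) auto
    then show ?thesis using DP(3) by (auto simp: doc_candidates_def)
  qed
  show "v \<in> doc_candidates P" if "is_doc_block d \<phi> P b v"
  proof (cases "{p \<in> P. \<phi> p = b} = {}")
    case True
    then show ?thesis using that by (simp add: is_doc_block_def doc_candidates_def)
  next
    case False
    then have "v = (1 / real (card {p \<in> P. \<phi> p = b})) \<cdot>\<^sub>v vec_sum d {p \<in> P. \<phi> p = b}"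
      using that by (simp add: is_doc_block_def Let_def)
    moreover have "{p \<in> P. \<phi> p = b} \<in> Pow P" by simp
    ultimately show ?thesis unfolding doc_candidates_def by (intro UnI2 image_eqI)
  qed
qed

text \<open>The accuracy event is described by finitely many choices of document blocks, hence
  measurable.\<close>

lemma accuracy_event:
  assumes Q: "unit_vec_set d Q" and P: "\<And>i. i \<in> {1..n} \<Longrightarrow> unit_vec_set d (P i)"
  shows "{\<omega> \<in> space M. \<forall>F. is_fde_docs d k dp R \<omega> n P F \<longrightarrow>
      (\<forall>i. is_best_doc n (fde_query d k dp R \<omega> Q) F i \<longrightarrow> good i)} \<in> events"
proof -
  note DQ = unit_vec_setD[OF Q]
  define L where "L = set (clusters k)"
  have L: "finite L" "b \<in> L \<longleftrightarrow> length b = k" for b unfolding L_def by (rule finite_set, simp add: set_clusters)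
  define J where "J = {1..n} \<times> {..<R} \<times> L"
  define BB where "BB = PiE J (\<lambda>x. doc_candidates (P (fst x)))"
  have finJ: "finite J" using L by (simp add: J_def)
  have finBB: "finite BB" unfolding BB_def using finJ doc_candidates(1)[OF P] by (intro finite_PiE) (auto simp: J_def)
  define adm where "adm B \<omega> \<longleftrightarrow> (\<forall>x\<in>J. is_doc_block d (simhash d k \<omega> (fst (snd x))) (P (fst x)) (snd (snd x)) (B x))" for B \<omega>
  define score :: "(nat \<times> nat \<times> bool list \<Rightarrow> real vec) \<Rightarrow> nat \<Rightarrow> randomness \<Rightarrow> real" where "score B i \<omega> = fde_query d k dp R \<omega> Q \<bullet> fde_concat d k dp R \<omega> (\<lambda>r b. B (i, r, b))" for B i \<omega>
  have score: "score B i \<in> borel_measurable M" if B: "B \<in> BB" and i: "i \<in> {1..n}" for B i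
  proof -
    have dims: "B (i, r, b) \<in> carrier_vec d" if "r < R" "b \<in> L" for r b
    proof -
      have "(i, r, b) \<in> J" using that i by (simp add: J_def)
      then have "B (i, r, b) \<in> doc_candidates (P (fst (i, r, b)))" using B unfolding BB_def by (rule PiE_mem[rotated])
      then show ?thesis using doc_candidates(2)[OF P[OF i]] by auto
    qed
    \<comment> \<open>Summing over all clusters with indicators fixes the block in each term,
      leaving products of a discrete variable and a measurable projected inner product.\<close>
    have "score B i = (\<lambda>\<omega>. \<Sum>r<R. \<Sum>q\<in>Q. \<Sum>b\<in>L. of_bool (simhash d k \<omega> r q = b) * proj_dot r q (B (i, r, b)) \<omega>)"
    proof
      fix \<omega>
      have "(\<Sum>b\<in>L. of_bool (simhash d k \<omega> r q = b) * proj_dot r q (B (i, r, b)) \<omega>) = proj_dot r q (B (i, r, simhash d k \<omega> r q)) \<omega>" for r q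
        using sum.remove[OF L(1), of "simhash d k \<omega> r q" "\<lambda>b. of_bool (simhash d k \<omega> r q = b) * proj_dot r q (B (i, r, b)) \<omega>"]
        by (simp add: L)
      then show "score B i \<omega> = (\<Sum>r<R. \<Sum>q\<in>Q. \<Sum>b\<in>L. of_bool (simhash d k \<omega> r q = b) * proj_dot r q (B (i, r, b)) \<omega>)"
        unfolding score_def fde_query_scalar_prod_doc[OF DQ(1,3)] proj_dot_def[symmetric] by simp
    qed
    moreover have hb: "(\<lambda>\<omega>. of_bool (simhash d k \<omega> r q = b) :: real) \<in> borel_measurable M" if "r < R" "q \<in> Q" for r q b
      by (rule measurable_compose[OF simhash_measurable, of r q "\<lambda>x. of_bool (x = b)"]) (use that DQ(3) in auto)
    moreover have "(\<lambda>\<omega>. \<Sum>r<R. \<Sum>q\<in>Q. \<Sum>b\<in>L. of_bool (simhash d k \<omega> r q = b) * proj_dot r q (B (i, r, b)) \<omega>) \<in> borel_measurable M"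
      using DQ(3) dims by (intro borel_measurable_sum borel_measurable_times hb proj_dot_measurable) auto
    ultimately show ?thesis by simp
  qed
  have adm: "{\<omega> \<in> space M. adm B \<omega>} \<in> events" for B
    unfolding adm_def
  proof (intro sets.sets_Collect_finite_All finJ)
    fix x assume x: "x \<in> J"
    note DP = unit_vec_setD[OF P, of "fst x"]
    show "{\<omega> \<in> space M. is_doc_block d (simhash d k \<omega> (fst (snd x))) (P (fst x)) (snd (snd x)) (B x)} \<in> events"
    proof (rule sets_finite_discrete[where A="P (fst x)" and X="\<lambda>p \<omega>. simhash d k \<omega> (fst (snd x)) p" and
        \<Psi>="\<lambda>z. is_doc_block d z (P (fst x)) (snd (snd x)) (B x)"])
      show "is_doc_block d (simhash d k \<omega> (fst (snd x))) (P (fst x)) (snd (snd x)) (B x) \<longleftrightarrow>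
        is_doc_block d (\<lambda>p\<in>P (fst x). simhash d k \<omega> (fst (snd x)) p) (P (fst x)) (snd (snd x)) (B x)" for \<omega>
        by (rule is_doc_block_cong) simp
    next
      have x': "fst x \<in> {1..n}" "fst (snd x) < R" using x by (auto simp: J_def)
      then show "finite (P (fst x))" using DP(1) by simp
      show "(\<lambda>\<omega>. simhash d k \<omega> (fst (snd x)) p) \<in> M \<rightarrow>\<^sub>M count_space UNIV" if "p \<in> P (fst x)" for p
        by (rule simhash_measurable[OF x'(2)]) (use that DP(3)[OF x'(1)] in blast)
    qed
  qed
  \<comment> \<open>The quantifier over all encodings becomes one over the finite set
    \<open>BB\<close> of block assignments, whose admissibility \<open>adm\<close> is itself an
    event.\<close>
  have eq: "(\<forall>F. is_fde_docs d k dp R \<omega> n P F \<longrightarrow> (\<forall>i. is_best_doc n (fde_query d k dp R \<omega> Q) F i \<longrightarrow> good i)) \<longleftrightarrow>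
     (\<forall>B\<in>BB. adm B \<omega> \<longrightarrow> (\<forall>i\<in>{1..n}. (\<forall>j\<in>{1..n}. score B j \<omega> \<le> score B i \<omega>) \<longrightarrow> good i))" (is "?l \<longleftrightarrow> ?r") for \<omega>
  proof
    assume l: ?l
    show ?r
    proof (intro ballI impI)
      fix B i assume B: "B \<in> BB" "adm B \<omega>" and i: "i \<in> {1..n}" "\<forall>j\<in>{1..n}. score B j \<omega> \<le> score B i \<omega>"
      define F where "F i = fde_concat d k dp R \<omega> (\<lambda>r b. B (i, r, b))" for i
      have "is_fde_docs d k dp R \<omega> n P F"
        unfolding is_fde_docs_def is_fde_doc_def F_def
      proof (intro ballI exI conjI)
        fix j assume j: "j \<in> {1..n}"
        show "\<forall>r<R. \<forall>b\<in>set (clusters k). is_doc_block d (simhash d k \<omega> r) (P j) b (B (j, r, b))"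
        proof (intro allI impI ballI)
          fix r b assume "r < R" "b \<in> set (clusters k)"
          then have "(j, r, b) \<in> J" using j by (simp add: J_def L_def)
          then show "is_doc_block d (simhash d k \<omega> r) (P j) b (B (j, r, b))"
          proof -
            from \<open>(j, r, b) \<in> J\<close> B(2) have "is_doc_block d (simhash d k \<omega> (fst (snd (j, r, b)))) (P (fst (j, r, b))) (snd (snd (j, r, b))) (B (j, r, b))"
              unfolding adm_def by (rule bspec[rotated])
            then show ?thesis by simp
          qed
        qed
      qed simp
      moreover have "is_best_doc n (fde_query d k dp R \<omega> Q) F i"
        using i by (auto simp: is_best_doc_def is_arg_max_def F_def score_def not_less)
      ultimately show "good i" using l by blast
    qed
  next
    assume r: ?r
    show ?l
    proof (intro allI impI)
      fix F i assume F: "is_fde_docs d k dp R \<omega> n P F" and i: "is_best_doc n (fde_query d k dp R \<omega> Q) F i"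
      from F have "\<forall>i\<in>{1..n}. \<exists>blk. (\<forall>r<R. \<forall>b\<in>L. is_doc_block d (simhash d k \<omega> r) (P i) b (blk r b)) \<and> F i = fde_concat d k dp R \<omega> blk"
        unfolding is_fde_docs_def is_fde_doc_def L_def .
      from bchoice[OF this] obtain blk where
        *: "\<forall>i\<in>{1..n}. (\<forall>r<R. \<forall>b\<in>L. is_doc_block d (simhash d k \<omega> r) (P i) b (blk i r b)) \<and> F i = fde_concat d k dp R \<omega> (blk i)" ..
      have blk: "is_doc_block d (simhash d k \<omega> r) (P i) b (blk i r b)" if "i \<in> {1..n}" "r < R" "b \<in> L" for i r b
        using bspec[OF * that(1)] that(2,3) by simp
      have Fi: "F i = fde_concat d k dp R \<omega> (blk i)" if "i \<in> {1..n}" for i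
        using bspec[OF * that] by simp
      \<comment> \<open>Restriction to \<open>J\<close> puts the assignment into \<open>PiE\<close>;
        the encodings only read blocks with indices in \<open>J\<close>.\<close>
      define B where "B = (\<lambda>x\<in>J. blk (fst x) (fst (snd x)) (snd (snd x)))"
      have J: "is_doc_block d (simhash d k \<omega> (fst (snd x))) (P (fst x)) (snd (snd x)) (B x)" "fst x \<in> {1..n}" if "x \<in> J" for x
      proof -
        have "fst x \<in> {1..n}" "fst (snd x) < R" "snd (snd x) \<in> L" using that by (auto simp: J_def)
        then show "is_doc_block d (simhash d k \<omega> (fst (snd x))) (P (fst x)) (snd (snd x)) (B x)" "fst x \<in> {1..n}"
          using blk that by (simp_all add: B_def)
      qed
      have "B \<in> BB" unfolding BB_def
      proof (rule PiE_I)
        show "B x \<in> doc_candidates (P (fst x))" if "x \<in> J" for x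
          by (rule doc_candidates(3)[OF P[OF J(2)[OF that]] J(1)[OF that]])
      qed (simp add: B_def)
      moreover have "adm B \<omega>" unfolding adm_def using J(1) by (rule ballI)
      moreover have "score B j \<omega> = fde_query d k dp R \<omega> Q \<bullet> F j" if "j \<in> {1..n}" for j
      proof -
        have "F j = fde_concat d k dp R \<omega> (\<lambda>r b. B (j, r, b))"
          unfolding Fi[OF that] by (rule fde_concat_cong) (use that L in \<open>auto simp: B_def J_def\<close>)
        then show ?thesis by (simp add: score_def)
      qed
      moreover have "i \<in> {1..n}" "\<forall>j\<in>{1..n}. fde_query d k dp R \<omega> Q \<bullet> F j \<le> fde_query d k dp R \<omega> Q \<bullet> F i"
        using i by (auto simp: is_best_doc_def is_arg_max_def not_less)
      ultimately show "good i" using r by simp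
    qed
  qed
  show ?thesis unfolding eq
    by (intro sets.sets_Collect_finite_All sets.sets_Collect_imp sets.sets_Collect_const adm finBB borel_measurable_le score)
      auto
qed

section \<open>The probability of accuracy\<close>

text \<open>Documents with too many misordered repetitions are excluded by a union bound, large
  projection errors by Markov's inequality. Outside these events every normalized score is within
  \<open>\<epsilon>\<close> / 2 of the Chamfer value, so comparing the best score with that of an
  optimal document loses at most \<open>\<epsilon>\<close>.\<close>

lemma prob_accuracy_ge:
  fixes \<epsilon> m :: real
  assumes Q: "unit_vec_set d Q" and P: "\<And>i. i \<in> {1..n} \<Longrightarrow> unit_vec_set d (P i)" and n: "n \<ge> 1"
    and \<epsilon>: "0 < \<epsilon>" "\<epsilon> \<le> 8" and m: "\<And>i. i \<in> {1..n} \<Longrightarrow> real (card Q * card (P i)) \<le> m\<^sup>2"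
    and mis: "\<And>i r. i \<in> {1..n} \<Longrightarrow> r < R \<Longrightarrow> prob {\<omega> \<in> space M. misordered (\<epsilon> / 8) Q (P i) r \<omega>} \<le> \<epsilon> / 64"
  shows "prob {\<omega> \<in> space M. \<forall>F. is_fde_docs d k dp R \<omega> n P F \<longrightarrow>
      (\<forall>i. is_best_doc n (fde_query d k dp R \<omega> Q) F i \<longrightarrow>
         NChamfer Q (P i) \<ge> (MAX i\<in>{1..n}. NChamfer Q (P i)) - \<epsilon>)}
    \<ge> 1 - (n * exp (- 2 * real R * (\<epsilon> / 64)\<^sup>2) +
        8 / \<epsilon> * (n * (m\<^sup>2 * (4096 / (dp * (\<epsilon> / 8)) * exp (- (dp * (\<epsilon> / 8)\<^sup>2 / 4096))))))"
proof -
  define e where "e = \<epsilon> / 8"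
  define t where "t = \<epsilon> / 64"
  have e: "0 < e" "e \<le> 1" "0 \<le> e" using \<epsilon> by (auto simp: e_def)
  have t: "0 \<le> t" using \<epsilon> by (simp add: t_def)
  define B where "B = 4096 / (dp * e) * exp (- (dp * e\<^sup>2 / 4096))"
  have B: "0 \<le> B" using e by (simp add: B_def)
  define A where "A = {\<omega> \<in> space M. \<forall>F. is_fde_docs d k dp R \<omega> n P F \<longrightarrow>
      (\<forall>i. is_best_doc n (fde_query d k dp R \<omega> Q) F i \<longrightarrow>
         NChamfer Q (P i) \<ge> (MAX i\<in>{1..n}. NChamfer Q (P i)) - \<epsilon>)}"
  have A: "A \<in> events" unfolding A_def by (rule accuracy_event[OF Q P])
  define E1 where "E1 i = {\<omega> \<in> space M. misordered_count e Q (P i) \<omega> \<ge> 2 * t * R}" for i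
  \<comment> \<open>The nonnegative excesses of all documents are added up before Markov's
    inequality is applied; a single application then bounds each of them.\<close>
  define TE where "TE \<omega> = (\<Sum>i\<in>{1..n}. mean_excess e Q (P i) \<omega>)" for \<omega>
  define E2 where "E2 = {\<omega> \<in> space M. 1 \<le> ennreal (1 / e) * ennreal (TE \<omega>)}"
  have TE[measurable]: "TE \<in> borel_measurable M"
    unfolding TE_def[abs_def] by (intro borel_measurable_sum mean_excess_measurable Q P)
  have E1: "E1 i \<in> events" if "i \<in> {1..n}" for i
    using misordered_count_measurable[OF Q P[OF that]] unfolding E1_def by measurable
  have E2: "E2 \<in> events" unfolding E2_def by measurable
  have sub: "space M - A \<subseteq> (\<Union>i\<in>{1..n}. E1 i) \<union> E2"
  proof (rule subsetI, rule ccontr)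
    fix \<omega> assume w: "\<omega> \<in> space M - A" and nb: "\<omega> \<notin> (\<Union>i\<in>{1..n}. E1 i) \<union> E2"
    have mc: "misordered_count e Q (P i) \<omega> \<le> (2 * t) * R" if "i \<in> {1..n}" for i
    proof -
      have "\<omega> \<notin> E1 i" using nb that by blast
      then show ?thesis using w by (simp add: E1_def)
    qed
    have "TE \<omega> \<le> e"
    proof (rule ccontr)
      assume "\<not> TE \<omega> \<le> e"
      then have "1 \<le> 1 / e * TE \<omega>" using e by (simp add: field_simps)
      then have "ennreal 1 \<le> ennreal (1 / e * TE \<omega>)" by (rule ennreal_leI)
      then have "1 \<le> ennreal (1 / e) * ennreal (TE \<omega>)"
        using ennreal_mult'[of "1 / e" "TE \<omega>"] e by (simp only: ennreal_1 zero_le_divide_1_iff)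
      then show False using nb w by (simp add: E2_def)
    qed
    then have me: "mean_excess e Q (P i) \<omega> \<le> e" if "i \<in> {1..n}" for i
      using member_le_sum[OF that, of "\<lambda>i. mean_excess e Q (P i) \<omega>"] mean_excess_nonneg
      by (simp add: TE_def)
    have "\<omega> \<in> A"
      unfolding A_def
    proof (intro CollectI conjI allI impI)
      show "\<omega> \<in> space M" using w by simp
      fix F i assume F: "is_fde_docs d k dp R \<omega> n P F" and best: "is_best_doc n (fde_query d k dp R \<omega> Q) F i"
      define N where "N = real R * real (card Q)"
      define s where "s j = fde_query d k dp R \<omega> Q \<bullet> F j" for j
      have N: "N > 0" unfolding N_def using pos unit_vec_setD(5)[OF Q] by simp
      have close: "\<bar>s j / N - NChamfer Q (P j)\<bar> \<le> \<epsilon> / 2" if "j \<in> {1..n}" for j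
      proof -
        have "\<bar>s j / N - NChamfer Q (P j)\<bar> \<le> 2 * e + e + 2 * (2 * t)"
          unfolding s_def N_def of_nat_mult[symmetric]
          by (rule score_close[OF Q P[OF that] _ e(3) me[OF that] e(3) mc[OF that]])
            (use F that in \<open>auto simp: is_fde_docs_def\<close>)
        also have "\<dots> \<le> \<epsilon> / 2" using \<epsilon> by (simp add: e_def t_def)
        finally show ?thesis .
      qed
      have i: "i \<in> {1..n}" and max: "s j \<le> s i" if "j \<in> {1..n}" for j
        using best that by (auto simp: is_best_doc_def is_arg_max_def s_def not_less)
      obtain j where j: "j \<in> {1..n}" "(MAX i\<in>{1..n}. NChamfer Q (P i)) = NChamfer Q (P j)"
      proof -
        have "(MAX i\<in>{1..n}. NChamfer Q (P i)) \<in> (\<lambda>i. NChamfer Q (P i)) ` {1..n}"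
          using n by (intro Max_in) auto
        then show ?thesis using that by auto
      qed
      have "s j / N \<le> s i / N" using max[OF j(1)] N by (simp add: divide_right_mono)
      then show "NChamfer Q (P i) \<ge> (MAX i\<in>{1..n}. NChamfer Q (P i)) - \<epsilon>"
        unfolding j(2) using close[OF i[OF j(1)]] close[OF j(1)] unfolding abs_le_iff by linarith
    qed
    then show False using w by simp
  qed
  have p1: "prob (E1 i) \<le> exp (- 2 * real R * t\<^sup>2)" if "i \<in> {1..n}" for i
    unfolding E1_def
    by (rule prob_misordered_count[OF Q P[OF that] t]) (use mis that in \<open>simp add: e_def t_def\<close>)
  have p2: "prob E2 \<le> 1 / e * (n * (m\<^sup>2 * B))"
  proof -
    have "(\<integral>\<^sup>+\<omega>. TE \<omega> \<partial>M) = (\<Sum>i\<in>{1..n}. \<integral>\<^sup>+\<omega>. mean_excess e Q (P i) \<omega> \<partial>M)"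
    proof -
      have m1: "(\<lambda>\<omega>. ennreal (mean_excess e Q (P i) \<omega>)) \<in> borel_measurable M" if "i \<in> {1..n}" for i
        using mean_excess_measurable[OF Q P[OF that], of e] by simp
      have "ennreal (TE \<omega>) = (\<Sum>i\<in>{1..n}. ennreal (mean_excess e Q (P i) \<omega>))" for \<omega>
        unfolding TE_def by (rule sum_ennreal[symmetric]) (rule mean_excess_nonneg)
      then show ?thesis by (simp only: nn_integral_sum[OF m1])
    qed
    also have "\<dots> \<le> (\<Sum>i\<in>{1..n}. ennreal (m\<^sup>2 * B))"
    proof (rule sum_mono)
      fix i assume i: "i \<in> {1..n}"
      have "(\<integral>\<^sup>+\<omega>. mean_excess e Q (P i) \<omega> \<partial>M) \<le> ennreal (card Q * card (P i) * B)"
        unfolding B_def by (rule nn_integral_mean_excess[OF Q P[OF i] e(1,2)])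
      also have "\<dots> \<le> ennreal (m\<^sup>2 * B)"
        using m[OF i] B by (intro ennreal_leI mult_right_mono) auto
      finally show "(\<integral>\<^sup>+\<omega>. mean_excess e Q (P i) \<omega> \<partial>M) \<le> ennreal (m\<^sup>2 * B)" .
    qed
    also have "\<dots> = ennreal (n * (m\<^sup>2 * B))"
      using B by (subst sum_ennreal) auto
    finally have TEi: "(\<integral>\<^sup>+\<omega>. TE \<omega> \<partial>M) \<le> ennreal (n * (m\<^sup>2 * B))" .
    have "emeasure M E2 \<le> ennreal (1 / e) * (\<integral>\<^sup>+\<omega>. ennreal (TE \<omega>) * indicator (space M) \<omega> \<partial>M)"
      unfolding E2_def by (rule nn_integral_Markov_inequality) auto
    also have "(\<integral>\<^sup>+\<omega>. ennreal (TE \<omega>) * indicator (space M) \<omega> \<partial>M) = (\<integral>\<^sup>+\<omega>. TE \<omega> \<partial>M)"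
      by (rule nn_integral_cong) simp
    also have "ennreal (1 / e) * (\<integral>\<^sup>+\<omega>. TE \<omega> \<partial>M) \<le> ennreal (1 / e) * ennreal (n * (m\<^sup>2 * B))"
      using TEi by (intro mult_left_mono) auto
    also have "\<dots> = ennreal (1 / e * (n * (m\<^sup>2 * B)))"
      by (rule ennreal_mult'[symmetric]) (use e in simp)
    finally show ?thesis using e B by (simp add: emeasure_eq_measure)
  qed
  have "1 - prob A = prob (space M - A)" using A by (simp add: prob_compl)
  also have "\<dots> \<le> prob ((\<Union>i\<in>{1..n}. E1 i) \<union> E2)"
    using E1 E2 sub by (intro finite_measure_mono) auto
  also have "\<dots> \<le> prob (\<Union>i\<in>{1..n}. E1 i) + prob E2"
    using E1 E2 by (intro measure_Un_le) auto
  also have "prob (\<Union>i\<in>{1..n}. E1 i) \<le> (\<Sum>i\<in>{1..n}. prob (E1 i))"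
    using E1 by (intro finite_measure_subadditive_finite) auto
  also have "\<dots> \<le> (\<Sum>i\<in>{1..n}. exp (- 2 * real R * t\<^sup>2))" by (rule sum_mono) (rule p1)
  also have "\<dots> = n * exp (- 2 * real R * t\<^sup>2)" by simp
  also have "prob E2 \<le> 1 / e * (n * (m\<^sup>2 * B))" by (rule p2)
  finally have "1 - prob A \<le> n * exp (- 2 * real R * t\<^sup>2) + 1 / e * (n * (m\<^sup>2 * B))" by simp
  then show ?thesis unfolding A_def[symmetric] B_def e_def t_def by simp
qed

end

section \<open>The choice of constants\<close>

lemma exp_mult_ln: "(x :: real) > 0 \<Longrightarrow> exp (a * ln x) = x powr a"
  by (simp add: powr_def)

text \<open>With 26880000 = 21 * 64 * 20000 the exponential is at most X^(-21) for X = m /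
  \<open>\<epsilon>\<close> > 3 / 2. Of the 21 powers, 9 cover m^3 because m <= 2 X <= X^3, 11 cover
  the factor 64 and one covers 1 / \<open>\<epsilon>\<close>.\<close>

lemma misordered_bound:
  fixes k m \<epsilon> C :: real
  assumes m: "3 \<le> m" and \<epsilon>: "0 < \<epsilon>" "\<epsilon> < 2" and C: "26880000 \<le> C" and k: "C * (ln (m / \<epsilon>) / \<epsilon>\<^sup>2) \<le> k"
  shows "m ^ 3 * exp (- (k * (\<epsilon> / 8)\<^sup>2 / 20000)) \<le> \<epsilon> / 64"
proof -
  define X where "X = m / \<epsilon>"
  have X: "3 / 2 \<le> X" using m \<epsilon> by (simp add: X_def field_simps)
  then have X0: "0 < X" and lX: "0 \<le> ln X" by auto
  have "21 * ln X \<le> C * ln X / 1280000" using C lX mult_right_mono[of 26880000 C "ln X"] by simp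
  also have "\<dots> = C * (ln X / \<epsilon>\<^sup>2) * (\<epsilon> / 8)\<^sup>2 / 20000" using \<epsilon> by (simp add: power2_eq_square)
  also have "\<dots> \<le> k * (\<epsilon> / 8)\<^sup>2 / 20000"
    using k unfolding X_def by (intro divide_right_mono mult_right_mono) auto
  finally have "exp (- (k * (\<epsilon> / 8)\<^sup>2 / 20000)) \<le> exp (- (21 * ln X))" by simp
  also have "\<dots> = 1 / X ^ 21"
    using exp_mult_ln[OF X0, of 21] X0 by (simp add: exp_minus inverse_eq_divide powr_numeral)
  finally have ex: "exp (- (k * (\<epsilon> / 8)\<^sup>2 / 20000)) \<le> 1 / X ^ 21" .
  have mX: "m \<le> X ^ 3"
  proof -
    have "m = X * \<epsilon>" using \<epsilon> by (simp add: X_def)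
    also have "\<dots> \<le> X * 2" using X0 \<epsilon> by (intro mult_left_mono) auto
    also have "\<dots> \<le> X * X\<^sup>2" using power_mono[OF X, of 2] X0 by (intro mult_left_mono) (auto simp: power2_eq_square)
    finally show ?thesis by (simp add: power3_eq_cube power2_eq_square)
  qed
  have "1 / \<epsilon> \<le> X" unfolding X_def using m \<epsilon> by (intro divide_right_mono) auto
  moreover have "64 \<le> X ^ 11"
  proof -
    have "(64 :: real) \<le> (3 / 2) ^ 11" by (simp add: eval_nat_numeral)
    also have "\<dots> \<le> X ^ 11" using X by (intro power_mono) auto
    finally show ?thesis .
  qed
  ultimately have a: "64 * (1 / \<epsilon>) \<le> X ^ 11 * X" using \<epsilon> X0 by (intro mult_mono) auto
  have b: "m ^ 3 \<le> (X ^ 3) ^ 3" using mX m by (intro power_mono) auto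
  have "m ^ 3 * (64 * (1 / \<epsilon>)) \<le> (X ^ 3) ^ 3 * (X ^ 11 * X)"
    using \<epsilon> X0 by (intro mult_mono[OF b a]) auto
  also have "\<dots> = X ^ 21" by (simp add: power_mult[symmetric] power_add[symmetric] mult.assoc power_Suc2[symmetric] del: power_Suc)
  finally have "m ^ 3 * (1 / X ^ 21) \<le> \<epsilon> / 64" using X0 \<epsilon> by (simp add: field_simps)
  then show ?thesis using mult_left_mono[OF ex, of "m ^ 3"] m by (intro order_trans[OF mult_left_mono[OF ex]]) auto
qed

text \<open>Here 2048 = 64^2 / 2, so the exponential is at most n powr (- c - 2). One of the two
  spare powers of n pays for the union bound, the other for the factor 1 / 2.\<close>

lemma repetition_bound:
  fixes n R \<epsilon> C c :: real
  assumes n: "2 \<le> n" and \<epsilon>: "0 < \<epsilon>" and C: "2048 * (c + 2) \<le> C" and R: "C * (1 / \<epsilon>\<^sup>2 * ln n) \<le> R"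
  shows "n * exp (- 2 * R * (\<epsilon> / 64)\<^sup>2) \<le> 1 / 2 * (1 / n powr c)"
proof -
  have ln: "0 \<le> ln n" using n by simp
  have "2048 * ((c + 2) * ln n) \<le> C * ln n" using mult_right_mono[OF C ln] by (simp only: mult.assoc)
  then have "(c + 2) * ln n \<le> C * ln n / 2048" by simp
  also have "\<dots> = 2 * (C * (1 / \<epsilon>\<^sup>2 * ln n)) * (\<epsilon> / 64)\<^sup>2" using \<epsilon> by (simp add: power2_eq_square)
  also have "\<dots> \<le> 2 * R * (\<epsilon> / 64)\<^sup>2" using R by (intro mult_right_mono mult_left_mono) auto
  finally have "exp (- 2 * R * (\<epsilon> / 64)\<^sup>2) \<le> exp (- ((c + 2) * ln n))" by simp
  also have "\<dots> = 1 / n powr (c + 2)"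
    using exp_mult_ln[of n "c + 2"] n by (simp add: exp_minus inverse_eq_divide)
  also have "n powr (c + 2) = n powr c * (n * n)" using n by (simp add: powr_add power2_eq_square)
  finally have "n * exp (- 2 * R * (\<epsilon> / 64)\<^sup>2) \<le> n * (1 / (n powr c * (n * n)))" using n by (intro mult_left_mono) auto
  also have "\<dots> = 1 / n * (1 / n powr c)" using n by simp
  also have "\<dots> \<le> 1 / 2 * (1 / n powr c)" using n by (intro mult_right_mono) (auto simp: field_simps)
  finally show ?thesis .
qed

text \<open>Here 262144 = 64 * 4096, so the exponential is at most X powr (- c - 24) with X >= 2. Of
  the 24 spare powers, 18 cover the numerical factor 8 * 32768 = 2^18, five cover 1 /
  \<open>\<epsilon>\<close>^2, n and m^2, and the last gives 1 / 2.\<close>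

lemma projection_bound:
  fixes n m d dp \<epsilon> C c :: real
  assumes n: "2 \<le> n" and m: "2 \<le> m" and d: "1 \<le> d" and \<epsilon>: "0 < \<epsilon>" "\<epsilon> < 2" and c: "0 \<le> c"
    and C: "262144 * (c + 24) \<le> C" and dp: "C * (1 / \<epsilon>\<^sup>2 * ln (m * d * n / \<epsilon>)) \<le> dp" "1 \<le> dp"
  shows "8 / \<epsilon> * (n * (m\<^sup>2 * (4096 / (dp * (\<epsilon> / 8)) * exp (- (dp * (\<epsilon> / 8)\<^sup>2 / 4096))))) \<le> 1 / 2 * (1 / n powr c)"
proof -
  define X where "X = m * d * n / \<epsilon>"
  define J where "J = 1 / \<epsilon>"
  have J: "1 / 2 \<le> J" "0 < J" using \<epsilon> by (auto simp: J_def field_simps)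
  have XJ: "X = m * d * n * J" by (simp add: X_def J_def)
  have "m * 1 \<le> m * d" using m d by (intro mult_left_mono) auto
  then have md: "2 \<le> m * d" "m \<le> m * d" using m by linarith+
  have "2 * 2 \<le> m * d * n" "2 * n \<le> m * d * n" "m * 2 \<le> m * d * n"
    by (rule mult_mono; use md n m in linarith)+
  then have mdn: "4 \<le> m * d * n" "2 * n \<le> m * d * n" "m * 2 \<le> m * d * n" "1 \<le> m * d * n"
    by linarith+
  have X2: "2 \<le> X" using mult_mono[of 4 "m * d * n" "1 / 2" J] mdn J by (simp add: XJ)
  have Xn: "n \<le> X" using mult_mono[of "2 * n" "m * d * n" "1 / 2" J] mdn J n by (simp add: XJ)
  have Xm: "m \<le> X" using mult_mono[of "m * 2" "m * d * n" "1 / 2" J] mdn J m by (simp add: XJ)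
  have XJ': "J \<le> X" using mult_mono[of 1 "m * d * n" J J] mdn J by (simp add: XJ)
  have lX: "0 \<le> ln X" using X2 by simp
  have "262144 * ((c + 24) * ln X) \<le> C * ln X" using mult_right_mono[OF C lX] by (simp only: mult.assoc)
  then have "(c + 24) * ln X \<le> C * ln X / 262144" by simp
  also have "\<dots> = C * (1 / \<epsilon>\<^sup>2 * ln X) * (\<epsilon> / 8)\<^sup>2 / 4096" using \<epsilon> by (simp add: power2_eq_square)
  also have "\<dots> \<le> dp * (\<epsilon> / 8)\<^sup>2 / 4096"
    using dp unfolding X_def by (intro divide_right_mono mult_right_mono) auto
  finally have "exp (- (dp * (\<epsilon> / 8)\<^sup>2 / 4096)) \<le> exp (- ((c + 24) * ln X))" by simp
  also have "\<dots> = 1 / X powr (c + 24)"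
    using exp_mult_ln[of X "c + 24"] X2 by (simp add: exp_minus inverse_eq_divide)
  also have "X powr (c + 24) = X powr c * X ^ 24" using X2 by (simp add: powr_add powr_numeral)
  finally have ex: "exp (- (dp * (\<epsilon> / 8)\<^sup>2 / 4096)) \<le> 1 / (X powr c * X ^ 24)" .
  have "4096 / (dp * (\<epsilon> / 8)) = 32768 * J * (1 / dp)" by (simp add: J_def)
  also have "\<dots> \<le> 32768 * J * 1" using dp J by (intro mult_left_mono) auto
  finally have f: "4096 / (dp * (\<epsilon> / 8)) \<le> 32768 * J" by simp
  have "8 / \<epsilon> * (n * (m\<^sup>2 * (4096 / (dp * (\<epsilon> / 8)) * exp (- (dp * (\<epsilon> / 8)\<^sup>2 / 4096))))) \<le>
      8 * J * (n * (m\<^sup>2 * (32768 * J * (1 / (X powr c * X ^ 24)))))"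
    using f ex J n dp \<epsilon> by (intro mult_mono) (auto simp: J_def)
  also have "\<dots> = 262144 * (J * J * (n * (m * m))) * (1 / (X powr c * X ^ 24))"
    by (simp add: power2_eq_square)
  also have "\<dots> \<le> X ^ 18 * (X * X * (X * (X * X))) * (1 / (X powr c * X ^ 24))"
  proof (intro mult_right_mono mult_mono)
    show "262144 \<le> X ^ 18" using power_mono[OF X2, of 18] by simp
  qed (use XJ' Xn Xm J n m X2 in auto)
  also have "\<dots> = X ^ 23 * (1 / (X powr c * X ^ 24))" by (simp add: power_numeral_reduce)
  also have "\<dots> = 1 / X * (1 / X powr c)" using X2 by (simp add: power_numeral_reduce)
  also have "\<dots> \<le> 1 / 2 * (1 / n powr c)"
    using X2 Xn n c by (intro mult_mono frac_le powr_mono2) auto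
  finally show ?thesis .
qed


lemma NChamfer_abs_le:
  assumes Q: "unit_vec_set d Q" and P: "unit_vec_set d P"
  shows "\<bar>NChamfer Q P\<bar> \<le> 1"
proof -
  note DQ = unit_vec_setD[OF Q] and DP = unit_vec_setD[OF P]
  have mx: "\<bar>MAX p\<in>P. q \<bullet> p\<bar> \<le> 1" if "q \<in> Q" for q
  proof -
    have "(MAX p\<in>P. q \<bullet> p) \<in> (\<lambda>p. q \<bullet> p) ` P" using DP by (intro Max_in) auto
    then show ?thesis using unit_scalar_prod_abs_le[OF Q P that] by auto
  qed
  have "(\<Sum>q\<in>Q. MAX p\<in>P. q \<bullet> p) / real (card Q) \<le> 1" "- 1 \<le> (\<Sum>q\<in>Q. MAX p\<in>P. q \<bullet> p) / real (card Q)"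
    using mx by (intro average_bounds[OF DQ(1,2)]; fastforce simp: abs_le_iff)+
  then show ?thesis by (simp add: NChamfer_def Chamfer_def abs_le_iff)
qed

text \<open>30000000 (c + 1) exceeds the three thresholds 26880000, 2048 (c + 2) and 262144 (c +
  24); each of the two failure probabilities then takes half of n powr (- c).\<close>

lemma accuracy:
  fixes \<epsilon> c Ck Cd Cr :: real
  assumes \<epsilon>: "0 < \<epsilon>" and n: "n \<ge> 1" and Q: "unit_vec_set d Q" and docs: "\<forall>i\<in>{1..n}. unit_vec_set d (P i)"
    and c: "0 < c" and C: "30000000 * (c + 1) \<le> Ck" "30000000 * (c + 1) \<le> Cd" "30000000 * (c + 1) \<le> Cr"
  defines "m \<equiv> card Q + (MAX i\<in>{1..n}. card (P i))"
  defines "k \<equiv> param Ck (ln (real m / \<epsilon>) / \<epsilon>\<^sup>2)" and "dp \<equiv> param Cd (1 / \<epsilon>\<^sup>2 * ln (real m * real d * real n / \<epsilon>))"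
    and "R \<equiv> param Cr (1 / \<epsilon>\<^sup>2 * ln (real n))"
  shows "\<P>(\<omega> in fde_space d k dp R. \<forall>F. is_fde_docs d k dp R \<omega> n P F \<longrightarrow>
      (\<forall>istar. is_best_doc n (fde_query d k dp R \<omega> Q) F istar \<longrightarrow>
         NChamfer Q (P istar) \<ge> (MAX i\<in>{1..n}. NChamfer Q (P i)) - \<epsilon>)) \<ge> 1 - 1 / real n powr c"
proof -
  note DQ = unit_vec_setD[OF Q] and P = docs[rule_format]
  interpret fde_parameters d k dp R
    by unfold_locales (simp_all only: DQ(4) k_def dp_def R_def param_ge_one)
  let ?A = "{\<omega> \<in> space M. \<forall>F. is_fde_docs d k dp R \<omega> n P F \<longrightarrow>
      (\<forall>i. is_best_doc n (fde_query d k dp R \<omega> Q) F i \<longrightarrow>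
         NChamfer Q (P i) \<ge> (MAX i\<in>{1..n}. NChamfer Q (P i)) - \<epsilon>)}"
  \<comment> \<open>In the first two cases a logarithm in the parameters may be nonpositive, so they
    are settled directly: for n = 1 the claimed probability is 0, and for \<open>\<epsilon>\<close>
    >= 2 every document is accurate because \<open>NChamfer\<close> lies in [-1, 1].\<close>
  consider "n = 1" | "n \<ge> 2" "2 \<le> \<epsilon>" | "n \<ge> 2" "\<epsilon> < 2" using n by linarith
  then show ?thesis
  proof cases
    case 1
    then show ?thesis by simp
  next
    case 2
    have "NChamfer Q (P i) \<ge> (MAX i\<in>{1..n}. NChamfer Q (P i)) - \<epsilon>" if "i \<in> {1..n}" for i
    proof -
      have "(MAX i\<in>{1..n}. NChamfer Q (P i)) \<le> 1"
        using n NChamfer_abs_le[OF Q P] by (auto simp: abs_le_iff)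
      then show ?thesis using NChamfer_abs_le[OF Q P[OF that]] 2 by linarith
    qed
    then have "?A = space M" by (auto simp: is_best_doc_def is_arg_max_def)
    then show ?thesis using prob_space by simp
  next
    case 3
    have cardP: "card (P i) \<ge> 1" "card Q + card (P i) \<le> m" if "i \<in> {1..n}" for i
    proof -
      show "card (P i) \<ge> 1" by (rule unit_vec_setD(5)[OF P[OF that]])
      have "card (P i) \<le> (MAX i\<in>{1..n}. card (P i))" using that by (intro Max_ge) auto
      then show "card Q + card (P i) \<le> m" by (simp add: m_def)
    qed
    have m2: "2 \<le> real m" using cardP[of 1] DQ(5) n by simp
    have dims: "1 \<le> real d" "2 \<le> real n" using DQ(4) 3 by auto
    have prodle: "real (card Q * card (P i)) \<le> (real m)\<^sup>2" if "i \<in> {1..n}" for i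
    proof -
      have "card Q * card (P i) \<le> m * m" using cardP[OF that] by (intro mult_mono) auto
      then have "real (card Q * card (P i)) \<le> real (m * m)" by (simp only: of_nat_le_iff)
      then show ?thesis by (simp add: power2_eq_square)
    qed
    have "1 - (real n * exp (- 2 * real R * (\<epsilon> / 64)\<^sup>2) +
        8 / \<epsilon> * (real n * ((real m)\<^sup>2 * (4096 / (dp * (\<epsilon> / 8)) * exp (- (dp * (\<epsilon> / 8)\<^sup>2 / 4096)))))) \<le> prob ?A"
    proof (rule prob_accuracy_ge[OF Q P n])
      fix i r assume i: "i \<in> {1..n}" and r: "r < R"
      show "prob {\<omega> \<in> space M. misordered (\<epsilon> / 8) Q (P i) r \<omega>} \<le> \<epsilon> / 64"
      proof (cases "card (P i) \<le> 1")
        case True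
        then show ?thesis using prob_misordered[OF r Q P[OF i], of "\<epsilon> / 8"] \<epsilon> by simp
      next
        case False
        then have m3: "3 \<le> real m" using cardP[OF i] DQ(5) by simp
        have "card Q * card (P i) * card (P i) \<le> m * m * m" using cardP[OF i] by (intro mult_mono) auto
        then have "real (card Q * card (P i) * card (P i)) \<le> real (m * m * m)" by (simp only: of_nat_le_iff)
        then have "real (card Q * card (P i) * card (P i)) \<le> real m ^ 3" by (simp add: power3_eq_cube)
        then have "real (card Q * card (P i) * card (P i)) * exp (- (k * (\<epsilon> / 8)\<^sup>2 / 20000)) \<le>
            real m ^ 3 * exp (- (k * (\<epsilon> / 8)\<^sup>2 / 20000))" by (intro mult_right_mono) auto
        also have "\<dots> \<le> \<epsilon> / 64"
        proof (rule misordered_bound[where C=Ck])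
          show "Ck * (ln (real m / \<epsilon>) / \<epsilon>\<^sup>2) \<le> real k" unfolding k_def by (rule param_ge)
        qed (use m3 \<epsilon> 3 C c in simp_all)
        finally show ?thesis using prob_misordered[OF r Q P[OF i], of "\<epsilon> / 8"] \<epsilon> False by simp
      qed
    qed (use \<epsilon> 3 prodle in auto)
    moreover have "real n * exp (- 2 * real R * (\<epsilon> / 64)\<^sup>2) \<le> 1 / 2 * (1 / real n powr c)"
    proof (rule repetition_bound[where C=Cr])
      show "Cr * (1 / \<epsilon>\<^sup>2 * ln (real n)) \<le> real R" unfolding R_def by (rule param_ge)
    qed (use dims \<epsilon> C c in simp_all)
    moreover have "8 / \<epsilon> * (real n * ((real m)\<^sup>2 * (4096 / (dp * (\<epsilon> / 8)) * exp (- (dp * (\<epsilon> / 8)\<^sup>2 / 4096))))) \<le>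
        1 / 2 * (1 / real n powr c)"
    proof (rule projection_bound[where C=Cd and d="real d"])
      show "Cd * (1 / \<epsilon>\<^sup>2 * ln (real m * real d * real n / \<epsilon>)) \<le> real dp" unfolding dp_def by (rule param_ge)
    qed (use m2 dims \<epsilon> 3 C c pos in simp_all)
    ultimately show ?thesis by linarith
  qed
qed

section \<open>Dimension and query time\<close>

text \<open>Squared because bits or target dimension are multiplied by repetitions; the sum of the
  three constants, each at least 1, exceeds each of them by at least 1, as the rounding in
  \<open>param_le_param_one\<close> requires.\<close>

definition time_constant :: "real \<Rightarrow> real \<Rightarrow> real \<Rightarrow> real" where
  "time_constant Ck Cd Cr = 350 * (Ck + Cd + Cr)\<^sup>2"

text \<open>The factor z is 1 for the form with ln n * ln (d n) and 1 + 2 ln d for the form with (ln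
  n)^2.\<close>

definition dim_exponent :: "real \<Rightarrow> real \<Rightarrow> real \<Rightarrow> real \<Rightarrow> real" where
  "dim_exponent Ck Cd Cr z = Ck + 7 + log 2 (3 * (Cd + 1) * (Cr + 2) * z)"

text \<open>Large enough for the second dimension formula and for both time bounds. The absolute
  value ensures that the sum dominates each of its parts.\<close>

definition hidden_constant :: "real \<Rightarrow> real \<Rightarrow> real \<Rightarrow> real" where
  "hidden_constant Ck Cd Cr = \<bar>dim_exponent Ck Cd Cr 1\<bar> + 6 * time_constant Ck Cd Cr"

lemma retrieval_bounds:
  fixes \<epsilon> Ck Cd Cr :: real
  assumes \<epsilon>: "0 < \<epsilon>" and n: "n \<ge> 1" and Q: "unit_vec_set d Q" and docs: "\<forall>i\<in>{1..n}. unit_vec_set d (P i)"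
    and C1: "1 \<le> Ck" "1 \<le> Cd" "1 \<le> Cr"
  defines "m \<equiv> card Q + (MAX i\<in>{1..n}. card (P i))"
  defines "L \<equiv> ln (real m * real d * real n / \<epsilon>)"
  defines "k \<equiv> param Ck (ln (real m / \<epsilon>) / \<epsilon>\<^sup>2)" and "dp \<equiv> param Cd (1 / \<epsilon>\<^sup>2 * L)"
    and "R \<equiv> param Cr (1 / \<epsilon>\<^sup>2 * ln (real n))"
    and "A1 \<equiv> param 1 (1 / \<epsilon>\<^sup>2 * L)" and "B1 \<equiv> param 1 (1 / \<epsilon>\<^sup>2 * ln (real n))"
    and "K \<equiv> hidden_constant Ck Cd Cr"
  shows "n \<ge> 2 \<and> \<epsilon> \<le> 1 \<Longrightarrow>
      (\<exists>e\<in>{0..dim_exponent Ck Cd Cr (1 + 2 * ln (real d)) / \<epsilon>\<^sup>2}.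
         real (fde_dim k dp R) = (real m / \<epsilon>) powr e * (ln (real n))\<^sup>2) \<and>
      (\<exists>e\<in>{0..K / \<epsilon>\<^sup>2}.
         real (fde_dim k dp R) = (real m / \<epsilon>) powr e * ln (real n) * ln (real d * real n))" (is "_ \<Longrightarrow> ?dim")
    and "recovers_in_time retrieval_prog d k dp R n Q P
      (K * (real (card Q) * real (max d n) * (real A1 * real B1)))" (is ?time1)
    and "n \<ge> 2 \<and> \<epsilon> \<le> 1 \<Longrightarrow> recovers_in_time retrieval_prog d k dp R n Q P
      (K * (real (card Q) * real (max d n) * (1 / \<epsilon> ^ 4) * L * ln (real n)))" (is "_ \<Longrightarrow> ?time2")
proof -
  note DQ = unit_vec_setD[OF Q] and P = docs[rule_format]
  have m: "2 \<le> m"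
  proof -
    have "card (P 1) \<le> (MAX i\<in>{1..n}. card (P i))" using n by (intro Max_ge) auto
    moreover have "1 \<le> card (P 1)" using unit_vec_setD(5)[OF P[of 1]] n by simp
    ultimately show ?thesis using DQ(5) unfolding m_def by linarith
  qed
  have dn: "1 \<le> real d * real n" using DQ(4) n mult_mono[of 1 "real d" 1 "real n"] by simp
  define a where "a = Ck + Cd + Cr"
  have a: "Ck + 1 \<le> a" "Cd + 1 \<le> a" "Cr + 1 \<le> a" "1 \<le> a" using C1 by (auto simp: a_def)
  define K1 where "K1 = 350 * a\<^sup>2"
  define K2 where "K2 = dim_exponent Ck Cd Cr 1"
  have K1: "0 \<le> K1" by (simp add: K1_def)
  moreover have "K = \<bar>K2\<bar> + 6 * K1"
    by (simp add: K_def hidden_constant_def time_constant_def K1_def K2_def a_def)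
  ultimately have K: "K1 \<le> K" "6 * K1 \<le> K" "K2 \<le> K" by linarith+
  show ?dim if "n \<ge> 2 \<and> \<epsilon> \<le> 1"
  proof -
    from that have n2: "n \<ge> 2" and e1: "\<epsilon> \<le> 1" by auto
    have ns: "2 \<le> real m" "1 \<le> real d" "2 \<le> real n" using m DQ(4) n2 by auto
    note D = fde_dim_bounds[OF \<epsilon> e1 C1 ns, folded L_def, folded k_def dp_def R_def]
    have X: "real m / \<epsilon> > 1" using ns \<epsilon> e1 by (simp add: field_simps)
    have l: "0 < ln (real n)" "0 < ln (real d * real n)"
      using ns mult_mono[of 1 "real d" 2 "real n"] by auto
    have 1: "\<exists>e\<in>{0..dim_exponent Ck Cd Cr (1 + 2 * ln (real d)) / \<epsilon>\<^sup>2}. real (fde_dim k dp R) = (real m / \<epsilon>) powr e * (ln (real n))\<^sup>2"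
      by (rule exponent_exists[OF X]) (use D(2,4) l in \<open>simp_all add: dim_exponent_def\<close>)
    have "\<exists>e\<in>{0..K2 / \<epsilon>\<^sup>2}. real (fde_dim k dp R) = (real m / \<epsilon>) powr e * (ln (real n) * ln (real d * real n))"
      by (rule exponent_exists[OF X]) (use D(1,3) l in \<open>simp_all add: K2_def dim_exponent_def\<close>)
    then obtain e where e: "0 \<le> e" "e \<le> K2 / \<epsilon>\<^sup>2"
        "real (fde_dim k dp R) = (real m / \<epsilon>) powr e * (ln (real n) * ln (real d * real n))" by auto
    have "K2 / \<epsilon>\<^sup>2 \<le> K / \<epsilon>\<^sup>2" using K by (intro divide_right_mono) auto
    then have "\<exists>e\<in>{0..K / \<epsilon>\<^sup>2}. real (fde_dim k dp R) = (real m / \<epsilon>) powr e * ln (real n) * ln (real d * real n)"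
      using e by (intro bexI[of _ e]) auto
    with 1 show ?thesis by blast
  qed
  have A1: "1 \<le> real A1" and B1: "1 \<le> real B1"
    using param_ge_one by (simp_all add: A1_def B1_def)
  have le_a: "(C + 1) * real x \<le> a * real x" if "C + 1 \<le> a" for C x
    using that by (intro mult_right_mono) auto
  have cost: "real (R * (card Q * (90 * k * d + 60 * dp * d + 60 * n * dp + 27) + 12) + 11 * k + 30 * n + 60)
      \<le> K1 * (real (card Q) * real (max d n) * (real A1 * real B1))"
    unfolding K1_def
  proof (rule query_cost_le)
    have "real m / \<epsilon> * 1 \<le> real m / \<epsilon> * (real d * real n)" using dn \<epsilon> by (intro mult_left_mono) auto
    then have "real m / \<epsilon> \<le> real m * real d * real n / \<epsilon>" by simp
    then have "ln (real m / \<epsilon>) \<le> L" unfolding L_def using m \<epsilon> by (subst ln_le_cancel_iff) (auto intro: less_le_trans[of 0 "real m / \<epsilon>"])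
    then have "param 1 (ln (real m / \<epsilon>) / \<epsilon>\<^sup>2) \<le> A1"
      unfolding A1_def by (intro param_mono) (simp add: divide_right_mono)
    then have "(Ck + 1) * real (param 1 (ln (real m / \<epsilon>) / \<epsilon>\<^sup>2)) \<le> (Ck + 1) * real A1" using C1 by (intro mult_left_mono) auto
    moreover have "real k \<le> (Ck + 1) * real (param 1 (ln (real m / \<epsilon>) / \<epsilon>\<^sup>2))"
      unfolding k_def using C1 by (intro param_le_param_one) auto
    ultimately show "real k \<le> a * real A1" using le_a[OF a(1), of A1] by linarith
    have "real dp \<le> (Cd + 1) * real A1" unfolding dp_def A1_def using C1 by (intro param_le_param_one) auto
    then show "real dp \<le> a * real A1" using le_a[OF a(2), of A1] by linarith
    have "real R \<le> (Cr + 1) * real B1" unfolding R_def B1_def using C1 by (intro param_le_param_one) auto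
    then show "real R \<le> a * real B1" using le_a[OF a(3), of B1] by linarith
  qed (use a A1 B1 DQ n in auto)
  have dp1: "1 \<le> dp" unfolding dp_def by (rule param_ge_one)
  have time: "recovers_in_time retrieval_prog d k dp R n Q P T"
    if "K1 * (real (card Q) * real (max d n) * (real A1 * real B1)) \<le> T" for T
    by (rule recovers_in_time_retrieval_prog[OF Q dp1 n order_trans[OF cost that]])
  show ?time1 by (rule time) (intro mult_right_mono K; simp)
  show ?time2 if "n \<ge> 2 \<and> \<epsilon> \<le> 1"
  proof (rule time)
    from that have n2: "n \<ge> 2" and e1: "\<epsilon> \<le> 1" by auto
    have I: "1 \<le> 1 / \<epsilon>\<^sup>2" using \<epsilon> e1 by (simp add: power_le_one)
    have "1 / 2 \<le> ln (real n)" using ln_two_ge_half n2 by (intro order_trans[OF ln_two_ge_half]) (subst ln_le_cancel_iff, auto)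
    then have n0: "1 / 2 \<le> 1 / \<epsilon>\<^sup>2 * ln (real n)" using mult_mono[OF I, of "1/2" "ln (real n)"] by simp
    have "2 * 2 \<le> real m * (real d * real n)"
      using m n2 DQ(4) mult_mono[of 1 "real d" 2 "real n"] by (intro mult_mono) auto
    also have "real m * (real d * real n) = real m * (real d * real n) * 1" by simp
    also have "\<dots> \<le> real m * (real d * real n) * (1 / \<epsilon>)" using \<epsilon> e1 by (intro mult_left_mono) auto
    finally have "4 \<le> real m * real d * real n / \<epsilon>" by (simp add: mult.assoc)
    then have "ln 4 \<le> L" unfolding L_def by (subst ln_le_cancel_iff) auto
    moreover have "ln 4 = 2 * ln (2 :: real)" using ln_realpow[of "2 :: real" 2] by simp
    ultimately have L1: "1 \<le> L" using ln_two_ge_half by linarith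
    then have L0: "1 \<le> 1 / \<epsilon>\<^sup>2 * L" using mult_mono[OF I, of 1 L] by simp
    \<comment> \<open>Rounding up adds at most 1 to numbers that are at least 1 and at least 1 / 2,
      respectively; they at most double and triple, which explains the factor 6 in
      \<open>hidden_constant\<close>.\<close>
    have "real A1 \<le> 1 * (1 / \<epsilon>\<^sup>2 * L) + 1" unfolding A1_def using L0 by (intro param_le) linarith
    then have 1: "real A1 \<le> 2 * (1 / \<epsilon>\<^sup>2 * L)" using L0 by linarith
    have "real B1 \<le> 1 * (1 / \<epsilon>\<^sup>2 * ln (real n)) + 1" unfolding B1_def using n0 by (intro param_le) linarith
    then have 2: "real B1 \<le> 3 * (1 / \<epsilon>\<^sup>2 * ln (real n))" using n0 by linarith
    have "real A1 * real B1 \<le> (2 * (1 / \<epsilon>\<^sup>2 * L)) * (3 * (1 / \<epsilon>\<^sup>2 * ln (real n)))"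
      using 1 2 L0 by (intro mult_mono) auto
    also have "\<dots> = 6 * ((1 / \<epsilon> ^ 4) * L * ln (real n))" by (simp add: power_numeral_reduce)
    finally have "K1 * (real (card Q) * real (max d n) * (real A1 * real B1)) \<le>
        K1 * (real (card Q) * real (max d n) * (6 * ((1 / \<epsilon> ^ 4) * L * ln (real n))))"
      using K1 by (intro mult_left_mono) auto
    also have "\<dots> = (6 * K1) * (real (card Q) * real (max d n) * (1 / \<epsilon> ^ 4) * L * ln (real n))" by simp
    also have "\<dots> \<le> K * (real (card Q) * real (max d n) * (1 / \<epsilon> ^ 4) * L * ln (real n))"
      using L1 n2 by (intro mult_right_mono K) auto
    finally show "K1 * (real (card Q) * real (max d n) * (real A1 * real B1)) \<le>
        K * (real (card Q) * real (max d n) * (1 / \<epsilon> ^ 4) * L * ln (real n))" .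
  qed
qed

theorem theorem2p2:
  shows "\<exists>query_prog :: prog. \<forall>c>0. \<exists>C0>0. \<forall>Ck Cd Cr :: real. C0 \<le> Ck \<and> C0 \<le> Cd \<and> C0 \<le> Cr \<longrightarrow>
    (\<exists>(K :: real) (Kd :: nat \<Rightarrow> real). \<forall>(\<epsilon> :: real) (d :: nat) (n :: nat)
        (Q :: real vec set) (P :: nat \<Rightarrow> real vec set).
      \<epsilon> > 0 \<and> n \<ge> 1 \<and> unit_vec_set d Q \<and> (\<forall>i\<in>{1..n}. unit_vec_set d (P i)) \<longrightarrow>
      (let m = card Q + (MAX i\<in>{1..n}. card (P i));
           L = ln (real m * real d * real n / \<epsilon>);
           k = param Ck (ln (real m / \<epsilon>) / \<epsilon>\<^sup>2);
           dp = param Cd (1 / \<epsilon>\<^sup>2 * L);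
           R = param Cr (1 / \<epsilon>\<^sup>2 * ln (real n))
       in
         \<comment> \<open>accuracy with probability at least \<open>1 - 1 / n ^ c\<close>\<close>
         \<P>(\<omega> in fde_space d k dp R.
            \<forall>F. is_fde_docs d k dp R \<omega> n P F \<longrightarrow>
                (\<forall>istar. is_best_doc n (fde_query d k dp R \<omega> Q) F istar \<longrightarrow>
                   NChamfer Q (P istar) \<ge> (MAX i\<in>{1..n}. NChamfer Q (P i)) - \<epsilon>))
           \<ge> 1 - 1 / real n powr c
         \<and>
         \<comment> \<open>dimension; the hidden constant of the first form depends on d, since \<open>ln d\<close> enters dp\<close>
         (n \<ge> 2 \<and> \<epsilon> \<le> 1 \<longrightarrow>
            (\<exists>e\<in>{0..Kd d / \<epsilon>\<^sup>2}. real (fde_dim k dp R) = (real m / \<epsilon>) powr e * (ln (real n))\<^sup>2) \<and>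
            (\<exists>e\<in>{0..K / \<epsilon>\<^sup>2}. real (fde_dim k dp R) =
               (real m / \<epsilon>) powr e * ln (real n) * ln (real d * real n)))
         \<and>
         \<comment> \<open>query time, first with the parameters rounded up, valid for all \<open>\<epsilon>\<close> and n\<close>
         recovers_in_time query_prog d k dp R n Q P
           (K * (real (card Q) * real (max d n) *
              (real (param 1 (1 / \<epsilon>\<^sup>2 * L)) * real (param 1 (1 / \<epsilon>\<^sup>2 * ln (real n)))))) \<and>
         (n \<ge> 2 \<and> \<epsilon> \<le> 1 \<longrightarrow>
            recovers_in_time query_prog d k dp R n Q P
              (K * (real (card Q) * real (max d n) * (1 / \<epsilon> ^ 4) * L * ln (real n))))))"
proof (rule exI[of _ retrieval_prog], intro allI impI, goal_cases)
  case (1 c)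
  show ?case
  \<comment> \<open>The threshold depends on c alone, since the three constants above it are chosen
    afterwards and independently of each other.\<close>
  proof (rule exI[of _ "30000000 * (c + 1)"], intro conjI allI impI, goal_cases)
    case 1
    then show ?case using \<open>0 < c\<close> by simp
  next
    case (2 Ck Cd Cr)
    then have C: "30000000 * (c + 1) \<le> Ck" "30000000 * (c + 1) \<le> Cd" "30000000 * (c + 1) \<le> Cr"
      "1 \<le> Ck" "1 \<le> Cd" "1 \<le> Cr"
      using \<open>0 < c\<close> by auto
    show ?case
    proof (rule exI[of _ "hidden_constant Ck Cd Cr"],
        rule exI[of _ "\<lambda>d. dim_exponent Ck Cd Cr (1 + 2 * ln (real d))"], intro allI impI, goal_cases)
      case (1 \<epsilon> d n Q P)
      then have A: "0 < \<epsilon>" "1 \<le> n" "unit_vec_set d Q" "\<forall>i\<in>{1..n}. unit_vec_set d (P i)" by auto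
      note acc = accuracy[where P=P, OF A \<open>0 < c\<close> C(1-3)]
        and bounds = retrieval_bounds[where P=P, OF A C(4-6)]
      show ?case
        unfolding Let_def
        by (rule conjI[OF acc conjI[OF impI[OF bounds(1)] conjI[OF bounds(2) impI[OF bounds(3)]]]])
    qed
  qed
qed

end
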